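(* Let $n$ be a positive integer and let $D=\{x_1,\dots,x_n\}\subset\mathbb{C}\mathbb{P}^1$ be a set of $n$ ordered distinct points. Then the space $X_0^n$ of null hyperpolygons and the moduli space $\mathcal{H}_0^n$ of stable rank-$2$ quasi-parabolic $SL(2,\mathbb{C})$-Higgs bundles over $\mathbb{C}\mathbb{P}^1$ at $D$ with holomorphically trivial underlying vector bundle are isomorphic (as complex manifolds).
   Context: **Null hyperpolygons.** Use coordinates $(p,q)$ on $T^*\mathbb{C}^{2n}$, where $p=(p_1,\dots,p_n)$ with row vectors $p_i=(a_i\ \ b_i)\in(\mathbb{C}^2)^*$ and $q=(q_1,\dots,q_n)$ with column vectors $q_i=(c_i,d_i)^t\in\mathbb{C}^2$. Let $K=(SU(2)\times U(1)^n)/(\mathbb{Z}/2\mathbb{Z})$ and $K^{\mathbb{C}}=(SL(2,\mathbb{C})\times(\mathbb{C}^* )^n)/(\mathbb{Z}/2\mathbb{Z})$, where $\mathbb{Z}/2\mathbb{Z}$ acts by multiplication of each factor by $-1$. They act on $T^*\mathbb{C}^{2n}$ on the right by $$(p,q)\cdot[A;e_1,\dots,e_n]=\big((e_1^{-1}p_1A,\dots,e_n^{-1}p_nA),(A^{-1}q_1e_1,\dots,A^{-1}q_ne_n)\big).$$ Write $(\ )_0$ for the traceless part of a $2\times2$ matrix. Let $\mu_{\mathbb{C}}^{-1}(0,0)$ be the set of $(p,q)$ with $p_iq_i=0$ for all $i$ and $\sum_i(q_ip_i)_0=0$; let $\mu_{\mathbb{R}}^{-1}(0,0)$ be the set of $(p,q)$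 with $|q_i|=|p_i|$ for all $i$ and $\sum_i(q_iq_i^*-p_i^*p_i)_0=0$. Let $\mathcal{P}_0^n$ be the set of $(p,q)\in\mu_{\mathbb{R}}^{-1}(0,0)\cap\mu_{\mathbb{C}}^{-1}(0,0)$ with $|p_i|^2+|q_i|^2\ne0$ for all $i$, and $X_0^n=\mathcal{P}_0^n/K$. A point $(p,q)$ is called stable if $p_i,q_i\neq0$ for all $i$ and the $q_i$, $i=1,\dots,n$, are not all proportional to each other; $\mu_{\mathbb{C}}^{-1}(0,0)^{\rm st}$ denotes the stable points of $\mu_{\mathbb{C}}^{-1}(0,0)$. The inclusion induces an identification $X_0^n=\mu_{\mathbb{C}}^{-1}(0,0)^{\rm st}/K^{\mathbb{C}}$; $X_0^n$ carries the complex structure induced by the standard complex structure $I$ of $T^*\mathbb{C}^{2n}\cong\mathbb{C}^{4n}$ (coordinates $a_i,b_i,c_i,d_i$). **Quasi-parabolic Higgs bundles.** A rank-$2$ quasi-parabolic bundle over $\Sigma=\mathbb{C}\mathbb{P}^1$ at $D$ is a rank-$2$ holomorphic vector bundle $E$ with complete flags $E_x=E_{x,1}\supsetneq E_{x,2}\supsetneq\{0\}$, $\dim E_{x,2}=1$, for each $x\in D$. A quasi-parabolic Higgs bundle is a pair $(E,\Phi)$ with $\Phi\in H^0(\Sigma,SQParEnd(E)\otimes K_\Sigma(D))$, i.e. $\Phi$ is a meromorphic $End(E)$-valued one-form with at most simple poles along $D$ whose residues satisfy $(\mathrm{Res}_x\Phi)(E_{x,1})\subset E_{x,2}$ and $(\mathrm{Res}_x\Phi)(E_{x,2})=0$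 for all $x\in D$. It is an $SL(2,\mathbb{C})$-Higgs bundle if $\det E$ is trivial and $\Phi$ is traceless. For a line subbundle $L\subset E$ put $S_L=\{x\in D: L_x\cap E_{x,2}\neq\{0\}\}$. The quasi-parabolic slopes are $\text{q-par}\,\mu(E)=\frac12\deg E+\frac12|D|$ and $\text{q-par}\,\mu(L)=\deg L+\frac12|S_L|$. The Higgs bundle $(E,\Phi)$ is stable if $\mathrm{Res}_x\Phi\ne0$ for each $x\in D$ and $\text{q-par}\,\mu(E)>\text{q-par}\,\mu(L)$ for every line subbundle $L$ preserved by $\Phi$. Isomorphisms are bundle isomorphisms preserving the flags and intertwining the Higgs fields. $\mathcal{H}_0^n$ is the set of isomorphism classes of stable rank-$2$ quasi-parabolic $SL(2,\mathbb{C})$-Higgs bundles over $\mathbb{C}\mathbb{P}^1$ at $D$ with $E$ holomorphically trivial. **Complex structure on $\mathcal{H}_0^n$.** For $E=\mathbb{C}\mathbb{P}^1\times\mathbb{C}^2$ the data are lines $X_i=E_{x_i,2}\in\mathbb{C}\mathbb{P}^1$ and residues $N_i=\mathrm{Res}_{x_i}\Phi$ with $\sum_iN_i=0$ (the residues determine $\Phi$). Given a disjoint decomposition $\{1,\dots,n\}=A\cup B$, $j\in A$, $k\in B$, consider classes that have a representative with $X_i=[1:w_i]$ for $i\in A$, $X_i=[z_i:1]$ for $i\in B$, $w_j=0$, $z_k=0$, and $$N_i=\lambda_i\begin{pmatrix}-w_i&1\\-w_i^2&w_i\end{pmatrix}\ (i\in A),\qquad N_i=\lambda_i\begin{pmatrix}-z_i&z_i^2\\-1&z_i\end{pmatrix}\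 (i\in B),$$ $\lambda_i\in\mathbb{C}^*$, $\lambda_j=1$. Such a representative is unique, and the parameters are subject only to $\sum_iN_i=0$; this condition is used to eliminate $\lambda_k$ and the two parameters attached to one further index $i_0$, the remaining $w_i,z_i,\lambda_i$ being local holomorphic coordinates. These coordinates, for all $(A,B,j,k)$, define the complex manifold structure on $\mathcal{H}_0^n$. **The correspondence.** The correspondence considered is the map $\mathcal{I}:X_0^n\to\mathcal{H}_0^n$ sending $[p,q]$ to the class of the trivial bundle $\mathbb{C}\mathbb{P}^1\times\mathbb{C}^2$ with flags $\mathbb{C}^2\supset\langle q_i\rangle\supset\{0\}$ over $x_i$ and with the Higgs field uniquely determined by $\mathrm{Res}_{x_i}\Phi=q_ip_i$. *)

theory Defs
  imports "HOL-Complex_Analysis.Complex_Analysis"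
begin

unbundle no fps_syntax

section \<open>Holomorphic maps in several variables and complex manifolds\<close>

text \<open>Real normed spaces with a complex structure \<open>imul\<close>, that is, multiplication by the imaginary unit.\<close>

class complex_structure = real_normed_vector +
  fixes imul :: "'a \<Rightarrow> 'a"
  assumes imul_add: "imul (x + y) = imul x + imul y"
    and imul_scaleR: "imul (r *\<^sub>R x) = r *\<^sub>R imul x"
    and imul_imul: "imul (imul x) = - x"

instantiation complex :: complex_structure
begin
definition imul_complex :: "complex \<Rightarrow> complex" where
  "imul_complex z = \<i> * z"
instance
  by standard (auto simp: imul_complex_def algebra_simps)
end

instantiation vec :: (complex_structure, finite) complex_structure
begin
definition imul_vec :: "'a ^ 'b \<Rightarrow> 'a ^ 'b" where
  "imul_vec v = (\<chi> i. imul (v $ i))"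
instance
  by standard (auto simp: imul_vec_def vec_eq_iff imul_add imul_scaleR imul_imul)
end

instantiation prod :: (complex_structure, complex_structure) complex_structure
begin
definition imul_prod :: "'a \<times> 'b \<Rightarrow> 'a \<times> 'b" where
  "imul_prod v = (imul (fst v), imul (snd v))"
instance
  by standard (auto simp: imul_prod_def imul_add imul_scaleR imul_imul)
end

text \<open>
  A map on an arbitrary subset \<open>S\<close> of a complex vector space is holomorphic if it is locally the
  restriction of a holomorphic map on an open subset of the ambient space.  If \<open>S\<close> is open in a
  linear subspace, or a complex submanifold, this is the usual notion.
\<close>

definition holomorphic_open ::
    "'a::complex_structure set \<Rightarrow> ('a \<Rightarrow> 'b::complex_structure) \<Rightarrow> bool" where
  "holomorphic_open W F \<longleftrightarrow> open W \<and>
     (\<forall>y\<in>W. \<exists>D. (F has_derivative D) (at y) \<and> (\<forall>v. D (imul v) = imul (D v)))"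

definition holomorphic_map ::
    "'a::complex_structure set \<Rightarrow> ('a \<Rightarrow> 'b::complex_structure) \<Rightarrow> bool" where
  "holomorphic_map S f \<longleftrightarrow>
     (\<forall>y\<in>S. \<exists>W F. y \<in> W \<and> holomorphic_open W F \<and> (\<forall>w\<in>S \<inter> W. F w = f w))"

text \<open>
  The model space \<open>\<complex>\<^sup>d\<close> is realised as a coordinate subspace of \<open>complex ^ 'm\<close> spanned by the
  coordinates in a set \<open>J\<close> of cardinality \<open>d\<close>.
\<close>

definition coord_space :: "'m::finite set \<Rightarrow> (complex ^ 'm) set" where
  "coord_space J = {v. \<forall>i. i \<notin> J \<longrightarrow> v $ i = 0}"

type_synonym ('x, 'm) chart = "'x set \<times> ('x \<Rightarrow> complex ^ 'm)"

definition open_in_model :: "nat \<Rightarrow> (complex ^ 'm::finite) set \<Rightarrow> bool" where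
  "open_in_model d W \<longleftrightarrow> (\<exists>J. card J = d \<and> openin (top_of_set (coord_space J)) W)"

definition complex_atlas ::
    "nat \<Rightarrow> 'x topology \<Rightarrow> ('x, 'm::finite) chart set \<Rightarrow> bool" where
  "complex_atlas d T \<A> \<longleftrightarrow>
     (\<Union>(U, \<phi>)\<in>\<A>. U) = topspace T \<and>
     (\<forall>(U, \<phi>)\<in>\<A>. openin T U \<and> open_in_model d (\<phi> ` U) \<and>
        homeomorphic_map (subtopology T U) (top_of_set (\<phi> ` U)) \<phi>) \<and>
     (\<forall>(U, \<phi>)\<in>\<A>. \<forall>(V, \<psi>)\<in>\<A>.
        holomorphic_map (\<phi> ` (U \<inter> V)) (\<psi> \<circ> inv_into U \<phi>))"

definition complex_manifold ::
    "nat \<Rightarrow> 'x set \<Rightarrow> 'x topology \<Rightarrow> ('x, 'm::finite) chart set \<Rightarrow> bool" where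
  "complex_manifold d M T \<A> \<longleftrightarrow>
     topspace T = M \<and> Hausdorff_space T \<and> second_countable T \<and> complex_atlas d T \<A>"

definition holomorphic_between ::
    "('x, 'm::finite) chart set \<Rightarrow> ('y, 'k::finite) chart set \<Rightarrow> ('x \<Rightarrow> 'y) \<Rightarrow> bool" where
  "holomorphic_between \<A> \<B> F \<longleftrightarrow>
     (\<forall>(U, \<phi>)\<in>\<A>. \<forall>(V, \<psi>)\<in>\<B>.
        holomorphic_map (\<phi> ` {x \<in> U. F x \<in> V}) (\<psi> \<circ> F \<circ> inv_into U \<phi>))"

definition biholomorphism ::
    "'x topology \<Rightarrow> ('x, 'm::finite) chart set \<Rightarrow>
     'y topology \<Rightarrow> ('y, 'k::finite) chart set \<Rightarrow> ('x \<Rightarrow> 'y) \<Rightarrow> bool" where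
  "biholomorphism T \<A> T' \<B> F \<longleftrightarrow>
     homeomorphic_map T T' F \<and> holomorphic_between \<A> \<B> F \<and>
     holomorphic_between \<B> \<A> (inv_into (topspace T) F)"

definition quotient_topology :: "'a topology \<Rightarrow> ('a \<Rightarrow> 'b) \<Rightarrow> 'b topology" where
  "quotient_topology X f =
     topology (\<lambda>U. U \<subseteq> f ` topspace X \<and> openin X {x \<in> topspace X. f x \<in> U})"

lemma openin_quotient_topology:
  "openin (quotient_topology X f) U \<longleftrightarrow>
     U \<subseteq> f ` topspace X \<and> openin X {x \<in> topspace X. f x \<in> U}"
proof -
  have *: "{x \<in> topspace X. f x \<in> S \<inter> T} =
      {x \<in> topspace X. f x \<in> S} \<inter> {x \<in> topspace X. f x \<in> T}" for S T
    by auto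
  have **: "{x \<in> topspace X. f x \<in> \<Union>\<K>} = (\<Union>K\<in>\<K>. {x \<in> topspace X. f x \<in> K})" for \<K>
    by auto
  have "istopology (\<lambda>U. U \<subseteq> f ` topspace X \<and> openin X {x \<in> topspace X. f x \<in> U})"
    unfolding istopology_def * ** by (auto intro!: openin_Int openin_Union)
  then show ?thesis
    by (simp add: quotient_topology_def topology_inverse')
qed


section \<open>Null hyperpolygons\<close>

text \<open>
  Points of \<open>T\<^sup>*\<complex>\<^sup>2\<^sup>n\<close>: the index type \<open>'n\<close> has \<open>n\<close> elements; \<open>p $ i\<close> is read as a row vector and
  \<open>q $ i\<close> as a column vector.  The norm of \<open>complex ^ 2\<close> is the Hermitian one.
\<close>

type_synonym 'n pq = "((complex ^ 2) ^ 'n) \<times> ((complex ^ 2) ^ 'n)"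

definition outer :: "complex ^ 2 \<Rightarrow> complex ^ 2 \<Rightarrow> complex ^ 2 ^ 2" where
  "outer v w = (\<chi> r s. v $ r * w $ s)"

definition conj_vec :: "complex ^ 2 \<Rightarrow> complex ^ 2" where
  "conj_vec v = (\<chi> r. cnj (v $ r))"

definition traceless :: "complex ^ 2 ^ 2 \<Rightarrow> complex ^ 2 ^ 2" where
  "traceless M = M - mat (trace M / 2)"

definition mu_complex_zero :: "('n::finite) pq set" where
  "mu_complex_zero = {(p, q).
     (\<forall>i. scalar_product (p $ i) (q $ i) = 0) \<and>
     (\<Sum>i\<in>UNIV. traceless (outer (q $ i) (p $ i))) = 0}"

definition mu_real_zero :: "('n::finite) pq set" where
  "mu_real_zero = {(p, q).
     (\<forall>i. norm (q $ i) = norm (p $ i)) \<and>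
     (\<Sum>i\<in>UNIV. traceless (outer (q $ i) (conj_vec (q $ i)) - outer (conj_vec (p $ i)) (p $ i))) = 0}"

definition P0 :: "('n::finite) pq set" where
  "P0 = {(p, q) \<in> mu_real_zero \<inter> mu_complex_zero.
     \<forall>i. (norm (p $ i))\<^sup>2 + (norm (q $ i))\<^sup>2 \<noteq> 0}"

definition SL2 :: "(complex ^ 2 ^ 2) set" where
  "SL2 = {A. det A = 1}"

definition SU2 :: "(complex ^ 2 ^ 2) set" where
  "SU2 = {A. A ** (\<chi> r s. cnj (A $ s $ r)) = mat 1 \<and> det A = 1}"

definition pq_act :: "('n::finite) pq \<Rightarrow> complex ^ 2 ^ 2 \<Rightarrow> complex ^ 'n \<Rightarrow> 'n pq" where
  "pq_act x A e =
     ((\<chi> i. inverse (e $ i) *s (fst x $ i v* A)),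
      (\<chi> i. e $ i *s (matrix_inv A *v (snd x $ i))))"

text \<open>
  The element \<open>(-1, -1, \<dots>, -1)\<close> acts trivially, so the orbits of the quotients by \<open>\<int>/2\<int>\<close> are the
  orbits of the product groups.
\<close>

definition K_orbit :: "('n::finite) pq \<Rightarrow> 'n pq set" where
  "K_orbit x = {pq_act x A e | A e. A \<in> SU2 \<and> (\<forall>i. norm (e $ i) = 1)}"

definition KC_orbit :: "('n::finite) pq \<Rightarrow> 'n pq set" where
  "KC_orbit x = {pq_act x A e | A e. A \<in> SL2 \<and> (\<forall>i. e $ i \<noteq> 0)}"

definition mu_complex_stable :: "('n::finite) pq set" where
  "mu_complex_stable = {(p, q) \<in> mu_complex_zero.
     (\<forall>i. p $ i \<noteq> 0 \<and> q $ i \<noteq> 0) \<and> \<not> (\<forall>i j. \<exists>c. q $ j = c *s q $ i)}"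

definition X0 :: "('n::finite) pq set set" where
  "X0 = K_orbit ` P0"

definition X0_top :: "('n::finite) pq set topology" where
  "X0_top = quotient_topology (top_of_set P0) K_orbit"

text \<open>
  The identification of the \<open>K\<^sup>\<complex>\<close>-quotient of the stable locus with \<open>X0\<close> induced by the inclusion
  of \<open>P0\<close>: a stable point is sent to the set of points of \<open>P0\<close> in its \<open>K\<^sup>\<complex>\<close>-orbit, which is a
  single \<open>K\<close>-orbit.
\<close>

definition X0_proj :: "('n::finite) pq \<Rightarrow> 'n pq set" where
  "X0_proj x = KC_orbit x \<inter> P0"

text \<open>
  The complex structure on \<open>X0\<close> is the one of the quotient of \<open>mu_complex_stable\<close>, i.e. the one for
  which \<open>X0_proj\<close> is a holomorphic submersion.  Its holomorphic charts are the open sets \<open>V\<close> with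
  injective \<open>\<phi>\<close>, open image, such that \<open>\<phi> \<circ> X0_proj\<close> is holomorphic and the inverse of \<open>\<phi>\<close> lifts
  locally to holomorphic maps into the stable locus.
\<close>

definition X0_charts :: "(('n::finite) pq set, 'n + 'n) chart set" where
  "X0_charts = {(V, \<phi>).
     openin X0_top V \<and> inj_on \<phi> V \<and> open_in_model (2 * (CARD('n) - 3)) (\<phi> ` V) \<and>
     holomorphic_map {x \<in> mu_complex_stable. X0_proj x \<in> V} (\<phi> \<circ> X0_proj) \<and>
     (\<forall>y \<in> \<phi> ` V. \<exists>W \<sigma>. openin (top_of_set (\<phi> ` V)) W \<and> y \<in> W \<and>
        holomorphic_map W (\<sigma> :: complex ^ ('n + 'n) \<Rightarrow> 'n pq) \<and>
        (\<forall>w\<in>W. \<sigma> w \<in> mu_complex_stable \<and> X0_proj (\<sigma> w) \<in> V \<and> \<phi> (X0_proj (\<sigma> w)) = w))}"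


section \<open>The projective line\<close>

datatype cp1 = Aff complex | Infty

text \<open>
  \<open>loc x\<close> is the inverse of a local coordinate centred at \<open>x\<close>: it is \<open>z - a\<close> at \<open>Aff a\<close>, and
  \<open>1 / z\<close> at \<open>Infty\<close>.
\<close>

fun loc :: "cp1 \<Rightarrow> complex \<Rightarrow> cp1" where
  "loc (Aff a) t = Aff (a + t)"
| "loc Infty t = (if t = 0 then Infty else Aff (1 / t))"

definition open_cp1 :: "cp1 set \<Rightarrow> bool" where
  "open_cp1 U \<longleftrightarrow> (\<forall>x\<in>U. \<forall>\<^sub>F t in nhds 0. loc x t \<in> U)"

definition hol_cp1 :: "cp1 set \<Rightarrow> (cp1 \<Rightarrow> complex) \<Rightarrow> bool" where
  "hol_cp1 U f \<longleftrightarrow> (\<forall>x\<in>U. (f \<circ> loc x) analytic_on {0})"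

definition hol_vec_cp1 :: "cp1 set \<Rightarrow> (cp1 \<Rightarrow> complex ^ 2) \<Rightarrow> bool" where
  "hol_vec_cp1 U f \<longleftrightarrow> (\<forall>i. hol_cp1 U (\<lambda>x. f x $ i))"

definition hol_mat_cp1 :: "cp1 set \<Rightarrow> (cp1 \<Rightarrow> complex ^ 2 ^ 2) \<Rightarrow> bool" where
  "hol_mat_cp1 U f \<longleftrightarrow> (\<forall>i j. hol_cp1 U (\<lambda>x. f x $ i $ j))"

text \<open>
  The cotangent line at \<open>Aff a\<close> is identified with the complex numbers via \<open>dz\<close>, that at \<open>Infty\<close>
  via \<open>dt\<close> with \<open>t = 1 / z\<close>.  If \<open>\<Phi> y\<close> is the coordinate of a one-form at \<open>y\<close> under this
  identification, its coefficient with respect to \<open>dt\<close>, \<open>t\<close> the local coordinate at \<open>x\<close>, is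
  \<open>jac x t * \<Phi> (loc x t)\<close>; note \<open>dz = - dt / t\<^sup>2\<close>.
\<close>

fun jac :: "cp1 \<Rightarrow> complex \<Rightarrow> complex" where
  "jac (Aff a) t = 1"
| "jac Infty t = (if t = 0 then 1 else - 1 / t\<^sup>2)"


section \<open>Holomorphic bundles of rank two on the projective line\<close>

text \<open>
  All fibres are identified, as vector spaces, with \<open>\<complex>\<^sup>2\<close>; these identifications bear no relation to
  each other.  The holomorphic structure is given by a family of holomorphic frames \<open>(U, g)\<close>:
  the columns of \<open>g x\<close> form a basis of the fibre at \<open>x \<in> U\<close>.
\<close>

type_synonym frames = "(cp1 set \<times> (cp1 \<Rightarrow> complex ^ 2 ^ 2)) set"

definition hol_bundle :: "frames \<Rightarrow> bool" where
  "hol_bundle E \<longleftrightarrow>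
     (\<Union>(U, g)\<in>E. U) = UNIV \<and>
     (\<forall>(U, g)\<in>E. open_cp1 U \<and> (\<forall>x\<in>U. invertible (g x))) \<and>
     (\<forall>(U, g)\<in>E. \<forall>(V, h)\<in>E. hol_mat_cp1 (U \<inter> V) (\<lambda>x. matrix_inv (g x) ** h x))"

definition bundle_iso :: "frames \<Rightarrow> frames \<Rightarrow> (cp1 \<Rightarrow> complex ^ 2 ^ 2) \<Rightarrow> bool" where
  "bundle_iso E E' \<psi> \<longleftrightarrow>
     (\<forall>x. invertible (\<psi> x)) \<and>
     (\<forall>(U, g)\<in>E. \<forall>(V, h)\<in>E'. hol_mat_cp1 (U \<inter> V) (\<lambda>x. matrix_inv (h x) ** \<psi> x ** g x))"

definition trivial_bundle :: frames where
  "trivial_bundle = {(UNIV, \<lambda>x. mat 1)}"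

definition hol_trivial :: "frames \<Rightarrow> bool" where
  "hol_trivial E \<longleftrightarrow> (\<exists>\<psi>. bundle_iso trivial_bundle E \<psi>)"

text \<open>Triviality of the determinant: a nowhere vanishing holomorphic section \<open>\<delta>\<close> of \<open>det E\<close>.\<close>

definition det_trivial :: "frames \<Rightarrow> bool" where
  "det_trivial E \<longleftrightarrow>
     (\<exists>\<delta>. (\<forall>x. \<delta> x \<noteq> 0) \<and> (\<forall>(U, g)\<in>E. hol_cp1 U (\<lambda>x. \<delta> x / det (g x))))"

text \<open>
  A line bundle whose fibres are lines in \<open>\<complex>\<^sup>k\<close> is given by the set \<open>F\<close> of its nowhere vanishing
  holomorphic local sections (or enough of them to cover the base).  Its degree is the degree of the
  divisor of a meromorphic section \<open>s\<close>; \<open>h\<close> below is the coefficient of \<open>s\<close> in the frame \<open>t\<close>.  The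
  values of \<open>s\<close> at its poles are irrelevant.
\<close>

definition section_divisor ::
    "(cp1 set \<times> (cp1 \<Rightarrow> complex ^ 'k)) set \<Rightarrow> (cp1 \<Rightarrow> complex ^ 'k) \<Rightarrow> (cp1 \<Rightarrow> int) \<Rightarrow> bool" where
  "section_divisor F s m \<longleftrightarrow> finite {x. m x \<noteq> 0} \<and>
     (\<forall>(U, t)\<in>F. \<exists>h. \<forall>x\<in>U. s x = h x *s t x \<and>
        (h \<circ> loc x) meromorphic_on {0} \<and> (\<forall>\<^sub>F u in at 0. h (loc x u) \<noteq> 0) \<and>
        zorder (h \<circ> loc x) 0 = m x)"

definition line_degree :: "(cp1 set \<times> (cp1 \<Rightarrow> complex ^ 'k)) set \<Rightarrow> int" where
  "line_degree F = (THE d. \<exists>s m. section_divisor F s m \<and> d = (\<Sum>x | m x \<noteq> 0. m x))"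

definition bundle_degree :: "frames \<Rightarrow> int" where
  "bundle_degree E = line_degree ((\<lambda>(U, g). (U, \<lambda>x. vec (det (g x)) :: complex ^ 1)) ` E)"

definition hol_section :: "frames \<Rightarrow> cp1 set \<Rightarrow> (cp1 \<Rightarrow> complex ^ 2) \<Rightarrow> bool" where
  "hol_section E U s \<longleftrightarrow> (\<forall>(V, g)\<in>E. hol_vec_cp1 (U \<inter> V) (\<lambda>x. matrix_inv (g x) *v s x))"

definition sub_frames ::
    "frames \<Rightarrow> (cp1 \<Rightarrow> (complex ^ 2) set) \<Rightarrow> (cp1 set \<times> (cp1 \<Rightarrow> complex ^ 2)) set" where
  "sub_frames E L = {(U, t). open_cp1 U \<and> hol_section E U t \<and> (\<forall>x\<in>U. t x \<in> L x \<and> t x \<noteq> 0)}"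

definition is_line :: "(complex ^ 2) set \<Rightarrow> bool" where
  "is_line W \<longleftrightarrow> vec.subspace W \<and> vec.dim W = 1"

definition line_subbundle :: "frames \<Rightarrow> (cp1 \<Rightarrow> (complex ^ 2) set) \<Rightarrow> bool" where
  "line_subbundle E L \<longleftrightarrow> (\<forall>x. is_line (L x)) \<and> (\<Union>(U, t)\<in>sub_frames E L. U) = UNIV"

definition subbundle_degree :: "frames \<Rightarrow> (cp1 \<Rightarrow> (complex ^ 2) set) \<Rightarrow> int" where
  "subbundle_degree E L = line_degree (sub_frames E L)"


section \<open>Quasi-parabolic Higgs bundles\<close>

text \<open>
  \<open>flag \<H> x\<close> is the line of the flag over \<open>x \<in> D\<close>; \<open>field \<H> x\<close> is the value of the Higgs field at
  \<open>x \<notin> D\<close>.  Values of \<open>flag\<close> outside \<open>D\<close> and of \<open>field\<close> on \<open>D\<close> carry no information, and they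
  are ignored by isomorphisms.
\<close>

record higgs_data =
  frames :: frames
  flag :: "cp1 \<Rightarrow> (complex ^ 2) set"
  field :: "cp1 \<Rightarrow> complex ^ 2 ^ 2"

text \<open>Matrix entries of the Higgs field in a frame \<open>g\<close> and the local coordinate at \<open>x\<close>.\<close>

definition local_entry ::
    "(cp1 \<Rightarrow> complex ^ 2 ^ 2) \<Rightarrow> (cp1 \<Rightarrow> complex ^ 2 ^ 2) \<Rightarrow> cp1 \<Rightarrow> 2 \<Rightarrow> 2 \<Rightarrow> complex \<Rightarrow> complex" where
  "local_entry g \<Phi> x i j = (\<lambda>t.
     jac x t * (matrix_inv (g (loc x t)) ** \<Phi> (loc x t) ** g (loc x t)) $ i $ j)"

text \<open>The residue as an endomorphism of the fibre; it does not depend on the frame for simple poles.\<close>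

definition higgs_res :: "higgs_data \<Rightarrow> cp1 \<Rightarrow> complex ^ 2 ^ 2" where
  "higgs_res \<H> x = (THE N. \<forall>(U, g)\<in>frames \<H>. x \<in> U \<longrightarrow>
     N = g x ** (\<chi> i j. residue (local_entry g (field \<H>) x i j) 0) ** matrix_inv (g x))"

definition log_one_form :: "cp1 set \<Rightarrow> frames \<Rightarrow> (cp1 \<Rightarrow> complex ^ 2 ^ 2) \<Rightarrow> bool" where
  "log_one_form D E \<Phi> \<longleftrightarrow> (\<forall>(U, g)\<in>E. \<forall>x\<in>U. \<forall>i j.
     (x \<notin> D \<longrightarrow> local_entry g \<Phi> x i j analytic_on {0}) \<and>
     (x \<in> D \<longrightarrow> (\<exists>h. h analytic_on {0} \<and> (\<forall>\<^sub>F t in at 0. t * local_entry g \<Phi> x i j t = h t))))"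

definition quasi_parabolic_higgs :: "cp1 set \<Rightarrow> higgs_data \<Rightarrow> bool" where
  "quasi_parabolic_higgs D \<H> \<longleftrightarrow>
     hol_bundle (frames \<H>) \<and> (\<forall>x\<in>D. is_line (flag \<H> x)) \<and>
     log_one_form D (frames \<H>) (field \<H>) \<and>
     (\<forall>x\<in>D. (\<forall>v. higgs_res \<H> x *v v \<in> flag \<H> x) \<and>
             (\<forall>v\<in>flag \<H> x. higgs_res \<H> x *v v = 0))"

definition sl2_higgs :: "cp1 set \<Rightarrow> higgs_data \<Rightarrow> bool" where
  "sl2_higgs D \<H> \<longleftrightarrow>
     quasi_parabolic_higgs D \<H> \<and> det_trivial (frames \<H>) \<and> (\<forall>x. x \<notin> D \<longrightarrow> trace (field \<H> x) = 0)"

definition q_par_slope :: "cp1 set \<Rightarrow> higgs_data \<Rightarrow> real" where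
  "q_par_slope D \<H> = real_of_int (bundle_degree (frames \<H>)) / 2 + real (card D) / 2"

definition q_par_slope_sub :: "cp1 set \<Rightarrow> higgs_data \<Rightarrow> (cp1 \<Rightarrow> (complex ^ 2) set) \<Rightarrow> real" where
  "q_par_slope_sub D \<H> L =
     real_of_int (subbundle_degree (frames \<H>) L) + real (card {x \<in> D. L x \<inter> flag \<H> x \<noteq> {0}}) / 2"

definition preserved :: "cp1 set \<Rightarrow> higgs_data \<Rightarrow> (cp1 \<Rightarrow> (complex ^ 2) set) \<Rightarrow> bool" where
  "preserved D \<H> L \<longleftrightarrow> (\<forall>x. x \<notin> D \<longrightarrow> (\<forall>v\<in>L x. field \<H> x *v v \<in> L x))"

definition stable_higgs :: "cp1 set \<Rightarrow> higgs_data \<Rightarrow> bool" where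
  "stable_higgs D \<H> \<longleftrightarrow>
     (\<forall>x\<in>D. higgs_res \<H> x \<noteq> 0) \<and>
     (\<forall>L. line_subbundle (frames \<H>) L \<and> preserved D \<H> L \<longrightarrow>
          q_par_slope D \<H> > q_par_slope_sub D \<H> L)"

definition higgs_iso :: "cp1 set \<Rightarrow> higgs_data \<Rightarrow> higgs_data \<Rightarrow> bool" where
  "higgs_iso D \<H> \<H>' \<longleftrightarrow> (\<exists>\<psi>. bundle_iso (frames \<H>) (frames \<H>') \<psi> \<and>
     (\<forall>x\<in>D. (\<lambda>v. \<psi> x *v v) ` flag \<H> x = flag \<H>' x) \<and>
     (\<forall>x. x \<notin> D \<longrightarrow> \<psi> x ** field \<H> x = field \<H>' x ** \<psi> x))"

definition stable_trivial :: "cp1 set \<Rightarrow> higgs_data set" where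
  "stable_trivial D = {\<H>. sl2_higgs D \<H> \<and> stable_higgs D \<H> \<and> hol_trivial (frames \<H>)}"

definition H0 :: "cp1 set \<Rightarrow> higgs_data set set" where
  "H0 D = stable_trivial D //
     {(\<H>, \<H>'). \<H> \<in> stable_trivial D \<and> \<H>' \<in> stable_trivial D \<and> higgs_iso D \<H> \<H>'}"


section \<open>The complex structure on the moduli space\<close>

text \<open>
  Given \<open>A\<close> (with \<open>B = - A\<close>), \<open>u i\<close> denotes the parameter \<open>w\<^sub>i\<close> for \<open>i \<in> A\<close> and \<open>z\<^sub>i\<close> for \<open>i \<in> B\<close>.
\<close>

definition nf_dir :: "'n set \<Rightarrow> ('n \<Rightarrow> complex) \<Rightarrow> 'n \<Rightarrow> complex ^ 2" where
  "nf_dir A u i = (if i \<in> A then vector [1, u i] else vector [u i, 1])"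

definition nf_res ::
    "'n set \<Rightarrow> ('n \<Rightarrow> complex) \<Rightarrow> ('n \<Rightarrow> complex) \<Rightarrow> 'n \<Rightarrow> complex ^ 2 ^ 2" where
  "nf_res A u l i =
     (if i \<in> A then mat (l i) ** vector [vector [- u i, 1], vector [- (u i)\<^sup>2, u i]]
      else mat (l i) ** vector [vector [- u i, (u i)\<^sup>2], vector [- 1, u i]])"

definition normal_form ::
    "('n \<Rightarrow> cp1) \<Rightarrow> 'n set \<Rightarrow> 'n \<Rightarrow> 'n \<Rightarrow> higgs_data set \<Rightarrow> ('n \<Rightarrow> complex) \<Rightarrow> ('n \<Rightarrow> complex) \<Rightarrow> bool" where
  "normal_form x A j k c u l \<longleftrightarrow>
     u j = 0 \<and> u k = 0 \<and> l j = 1 \<and> (\<forall>i. l i \<noteq> 0) \<and>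
     (\<exists>\<H>\<in>c. frames \<H> = trivial_bundle \<and>
        (\<forall>i. flag \<H> (x i) = vec.span {nf_dir A u i} \<and> higgs_res \<H> (x i) = nf_res A u l i))"

text \<open>
  With \<open>w\<^sub>j = z\<^sub>k = 0\<close> and \<open>\<lambda>\<^sub>j = 1\<close>, vanishing of the sum of the residues determines \<open>\<lambda>\<^sub>k\<close>, and the
  pair \<open>(\<lambda>\<^sub>i\<^sub>0, \<lambda>\<^sub>i\<^sub>0 w\<^sub>i\<^sub>0)\<close> if \<open>i\<^sub>0 \<in> A\<close>, or the pair \<open>(\<lambda>\<^sub>i\<^sub>0 z\<^sub>i\<^sub>0, \<lambda>\<^sub>i\<^sub>0 z\<^sub>i\<^sub>0\<^sup>2)\<close> if \<open>i\<^sub>0 \<in> B\<close>.  So the parameters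
  of \<open>i\<^sub>0\<close> can be eliminated exactly if \<open>i\<^sub>0 \<in> A\<close> or \<open>z\<^sub>i\<^sub>0 \<noteq> 0\<close>, which is the domain of the chart.
  The remaining parameters \<open>u i\<close> and \<open>l i\<close> are the coordinates \<open>Inl i\<close> and \<open>Inr i\<close>.
\<close>

definition H0_chart_dom ::
    "('n \<Rightarrow> cp1) \<Rightarrow> 'n set \<Rightarrow> 'n \<Rightarrow> 'n \<Rightarrow> 'n \<Rightarrow> higgs_data set set" where
  "H0_chart_dom x A j k i0 =
     {c \<in> H0 (range x). \<exists>u l. normal_form x A j k c u l \<and> (i0 \<in> A \<or> u i0 \<noteq> 0)}"

definition H0_chart_map ::
    "('n::finite \<Rightarrow> cp1) \<Rightarrow> 'n set \<Rightarrow> 'n \<Rightarrow> 'n \<Rightarrow> 'n \<Rightarrow> higgs_data set \<Rightarrow> complex ^ ('n + 'n)" where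
  "H0_chart_map x A j k i0 c =
     (let (u, l) = (THE (u, l). normal_form x A j k c u l)
      in (\<chi> m. case m of Inl i \<Rightarrow> if i \<in> {j, k, i0} then 0 else u i
                       | Inr i \<Rightarrow> if i \<in> {j, k, i0} then 0 else l i))"

definition H0_charts :: "('n::finite \<Rightarrow> cp1) \<Rightarrow> (higgs_data set, 'n + 'n) chart set" where
  "H0_charts x = {(H0_chart_dom x A j k i0, H0_chart_map x A j k i0) | A j k i0.
     j \<in> A \<and> k \<notin> A \<and> i0 \<notin> {j, k}}"

definition H0_top :: "('n::finite \<Rightarrow> cp1) \<Rightarrow> higgs_data set topology" where
  "H0_top x = topology_generated_by
     {{c \<in> V. \<phi> c \<in> W} | V \<phi> W. (V, \<phi>) \<in> H0_charts x \<and> open W}"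


section \<open>The correspondence\<close>

text \<open>
  \<open>c\<close> is the class of the trivial bundle with flags spanned by the \<open>q\<^sub>i\<close> and residues \<open>q\<^sub>i p\<^sub>i\<close>.
\<close>

definition corresponds ::
    "('n::finite \<Rightarrow> cp1) \<Rightarrow> 'n pq \<Rightarrow> higgs_data set \<Rightarrow> bool" where
  "corresponds x y c \<longleftrightarrow> c \<in> H0 (range x) \<and>
     (\<exists>\<H>\<in>c. frames \<H> = trivial_bundle \<and>
        (\<forall>i. flag \<H> (x i) = vec.span {snd y $ i} \<and>
             higgs_res \<H> (x i) = outer (snd y $ i) (fst y $ i)))"

end

theory Submission
  imports Defs
begin

text \<open>
  Both spaces are the set of \<open>K\<^sup>\<complex>\<close>-orbits of stable points of the zero level of the complex moment
  map, and the correspondence is the identity on representatives.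

  On the side of hyperpolygons, \<open>p\<^sub>i q\<^sub>i = 0\<close> forces \<open>p\<^sub>i = t\<^sub>i perp q\<^sub>i\<close> in dimension two, so that the real
  moment map only sees the matrix \<open>Q = \<Sum>\<^sub>i |t\<^sub>i| q\<^sub>i q\<^sub>i\<^sup>*\<close>: up to the choice of the moduli of the \<open>e\<^sub>i\<close>, an
  element \<open>A\<close> of \<open>SL\<^sub>2\<close> carries a stable point to the zero level if and only if \<open>A\<^sup>-\<^sup>1 Q A\<^sup>-\<^sup>*\<close> is scalar.
  For a stable point \<open>Q\<close> is positive definite; the Cholesky factorisation yields such an \<open>A\<close>,
  continuously in the point (\<open>balanced_in\<close>, \<open>continuous_on_balanced\<close>), and \<open>A\<close> is unique up to \<open>SU(2)\<close>
  (\<open>KC_orbit_in_P0\<close>).  Hence \<open>X0\<close> also carries the quotient topology of the stable locus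
  (\<open>openin_X0_top\<close>).  It is Hausdorff because \<open>K\<close> acts by isometries with compact orbits.

  On the side of Higgs bundles, Liouville's theorem shows that a Higgs field on the trivial bundle is
  the sum of its polar parts, that its residues add up to zero, and that isomorphisms are constant
  matrices (\<open>log_form_determined_by_residues\<close>, \<open>hol_cp1_UNIV_constant\<close>).  The data are therefore the
  flag lines, spanned by vectors \<open>q\<^sub>i\<close>, and residues, which are nilpotent with kernel and image this
  line, hence of the form \<open>q\<^sub>i p\<^sub>i\<close>.  A line subbundle of the trivial bundle has degree at most zero, and
  degree zero only if it is constant (\<open>trivial_subbundle_degree\<close>).  A subbundle of negative degree
  never destabilises, and a constant line does so if and only if it contains all the \<open>q\<^sub>i\<close>.  So the
  two notions of stability agree (\<open>higgs_of_in_stable_trivial\<close>, \<open>stable_higgs_representative\<close>), and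
  \<open>H0\<close> is the set of \<open>K\<^sup>\<complex>\<close>-orbits (\<open>corresponds_iff\<close>, \<open>H0_eq_image\<close>, \<open>higgs_class_eq_iff\<close>).

  For the complex structures, the normal form parameters are \<open>K\<^sup>\<complex>\<close>-invariant rational functions of
  \<open>(p, q)\<close> (\<open>normal_form_iff\<close>), and conversely the independent ones determine a point of the stable locus
  by rational functions (\<open>chart_lift_in\<close>).  Thus the charts of \<open>H0\<close> become charts of \<open>X0\<close>
  (\<open>pulled_back_chart\<close>).  They cover \<open>X0\<close> (\<open>ex_chart_dom\<close>), so that the manifold structure of \<open>X0\<close> is
  transported to \<open>H0\<close> (\<open>transported_manifold\<close>).
\<close>

unbundle no Formal_Power_Series.fps_syntax

section \<open>Holomorphic maps between complex vector spaces\<close>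

definition cdiff_at :: "('a::complex_structure \<Rightarrow> 'b::complex_structure) \<Rightarrow> 'a \<Rightarrow> bool" where
  "cdiff_at f y \<longleftrightarrow> (\<exists>D. (f has_derivative D) (at y) \<and> (\<forall>v. D (imul v) = imul (D v)))"

lemma holomorphic_open_iff: "holomorphic_open W F \<longleftrightarrow> open W \<and> (\<forall>y\<in>W. cdiff_at F y)"
  by (simp add: holomorphic_open_def cdiff_at_def)

lemma imul_zero [simp]: "imul (0::'a::complex_structure) = 0"
  using imul_scaleR[of 0 "0::'a"] by simp

lemma cdiff_at_const: "cdiff_at (\<lambda>x. c) y"
  unfolding cdiff_at_def by (rule exI[of _ "\<lambda>v. 0"]) auto

lemma cdiff_at_id: "cdiff_at (\<lambda>x. x) y"
  unfolding cdiff_at_def by (rule exI[of _ "\<lambda>v. v"]) auto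

lemma cdiff_at_compose:
  assumes "cdiff_at f y" "cdiff_at g (f y)"
  shows "cdiff_at (\<lambda>x. g (f x)) y"
proof -
  obtain D E where "(f has_derivative D) (at y)" "\<forall>v. D (imul v) = imul (D v)"
    "(g has_derivative E) (at (f y))" "\<forall>v. E (imul v) = imul (E v)"
    using assms by (auto simp: cdiff_at_def)
  then show ?thesis
    unfolding cdiff_at_def
    by (intro exI[of _ "\<lambda>v. E (D v)"]) (auto intro: has_derivative_compose)
qed

lemma cdiff_at_bounded_linear:
  assumes "bounded_linear T" "\<And>v. T (imul v) = imul (T v)" "cdiff_at f y"
  shows "cdiff_at (\<lambda>x. T (f x)) y"
proof (rule cdiff_at_compose[OF assms(3)])
  show "cdiff_at T (f y)"
    unfolding cdiff_at_def using assms by (auto intro!: exI[of _ T] bounded_linear_imp_has_derivative)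
qed

lemma cdiff_at_nth: "cdiff_at f y \<Longrightarrow> cdiff_at (\<lambda>x. f x $ i) y"
  by (rule cdiff_at_bounded_linear[OF bounded_linear_vec_nth]) (auto simp: imul_vec_def)

lemma cdiff_at_fst: "cdiff_at f y \<Longrightarrow> cdiff_at (\<lambda>x. fst (f x)) y"
  by (rule cdiff_at_bounded_linear[OF bounded_linear_fst]) (auto simp: imul_prod_def)

lemma cdiff_at_snd: "cdiff_at f y \<Longrightarrow> cdiff_at (\<lambda>x. snd (f x)) y"
  by (rule cdiff_at_bounded_linear[OF bounded_linear_snd]) (auto simp: imul_prod_def)

lemma cdiff_at_Pair:
  assumes "cdiff_at f y" "cdiff_at g y"
  shows "cdiff_at (\<lambda>x. (f x, g x)) y"
proof -
  obtain D E where "(f has_derivative D) (at y)" "\<forall>v. D (imul v) = imul (D v)"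
    "(g has_derivative E) (at y)" "\<forall>v. E (imul v) = imul (E v)"
    using assms by (auto simp: cdiff_at_def)
  then show ?thesis
    unfolding cdiff_at_def
    by (intro exI[of _ "\<lambda>v. (D v, E v)"]) (auto intro: has_derivative_Pair simp: imul_prod_def)
qed

lemma cdiff_at_add:
  assumes "cdiff_at f y" "cdiff_at g y"
  shows "cdiff_at (\<lambda>x. f x + g x) y"
proof -
  obtain D E where "(f has_derivative D) (at y)" "\<forall>v. D (imul v) = imul (D v)"
    "(g has_derivative E) (at y)" "\<forall>v. E (imul v) = imul (E v)"
    using assms by (auto simp: cdiff_at_def)
  then show ?thesis
    unfolding cdiff_at_def
    by (intro exI[of _ "\<lambda>v. D v + E v"]) (auto intro: has_derivative_add simp: imul_add)
qed

lemma cdiff_at_sum: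
  assumes "\<And>i. i \<in> I \<Longrightarrow> cdiff_at (f i) y"
  shows "cdiff_at (\<lambda>x. \<Sum>i\<in>I. f i x) y"
  using assms by (induction I rule: infinite_finite_induct)
    (auto intro!: cdiff_at_const cdiff_at_add)

lemma cdiff_at_mult:
  fixes f g :: "'a::complex_structure \<Rightarrow> complex"
  assumes "cdiff_at f y" "cdiff_at g y"
  shows "cdiff_at (\<lambda>x. f x * g x) y"
proof -
  obtain D E where *: "(f has_derivative D) (at y)" "\<forall>v. D (imul v) = imul (D v)"
    "(g has_derivative E) (at y)" "\<forall>v. E (imul v) = imul (E v)"
    using assms by (auto simp: cdiff_at_def)
  show ?thesis
    unfolding cdiff_at_def using has_derivative_mult[OF *(1,3)] *(2,4)
    by (intro exI[of _ "\<lambda>h. f y * E h + D h * g y"]) (auto simp: imul_complex_def algebra_simps)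
qed

lemma cdiff_at_uminus:
  fixes f :: "'a::complex_structure \<Rightarrow> complex"
  shows "cdiff_at f y \<Longrightarrow> cdiff_at (\<lambda>x. - f x) y"
  using cdiff_at_mult[OF cdiff_at_const[of "-1"], of f y] by simp

lemma cdiff_at_diff:
  fixes f g :: "'a::complex_structure \<Rightarrow> complex"
  shows "cdiff_at f y \<Longrightarrow> cdiff_at g y \<Longrightarrow> cdiff_at (\<lambda>x. f x - g x) y"
  using cdiff_at_add[of f y "\<lambda>x. - g x"] cdiff_at_uminus[of g y] by simp

lemma cdiff_at_inverse:
  fixes f :: "'a::complex_structure \<Rightarrow> complex"
  assumes "cdiff_at f y" "f y \<noteq> 0"
  shows "cdiff_at (\<lambda>x. inverse (f x)) y"
proof (rule cdiff_at_compose[OF assms(1)])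
  show "cdiff_at inverse (f y)"
    unfolding cdiff_at_def using has_derivative_inverse'[OF assms(2), of UNIV]
    by (intro exI[of _ "\<lambda>h. - (inverse (f y) * h * inverse (f y))"]) (auto simp: imul_complex_def)
qed

lemma cdiff_at_divide:
  fixes f g :: "'a::complex_structure \<Rightarrow> complex"
  assumes "cdiff_at f y" "cdiff_at g y" "g y \<noteq> 0"
  shows "cdiff_at (\<lambda>x. f x / g x) y"
  using cdiff_at_mult[OF assms(1) cdiff_at_inverse[OF assms(2,3)]] by (simp add: divide_inverse)

lemma cdiff_at_power:
  fixes f :: "'a::complex_structure \<Rightarrow> complex"
  assumes "cdiff_at f y"
  shows "cdiff_at (\<lambda>x. f x ^ n) y"
  by (induction n) (auto intro: cdiff_at_const cdiff_at_mult assms)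

lemma cdiff_at_vec_lambda:
  fixes f :: "'a::complex_structure \<Rightarrow> 'i::finite \<Rightarrow> 'b::complex_structure"
  assumes "\<And>i. cdiff_at (\<lambda>x. f x i) y"
  shows "cdiff_at (\<lambda>x. \<chi> i. f x i) y"
proof -
  obtain D where D: "\<And>i. ((\<lambda>x. f x i) has_derivative D i) (at y)"
    "\<And>i v. D i (imul v) = imul (D i v)"
    using assms unfolding cdiff_at_def by metis
  have bl: "bounded_linear (\<lambda>b. axis i b :: 'b ^ 'i)" for i :: 'i
  proof (rule bounded_linear_intro[where K = 1])
    show "norm (axis i x :: 'b ^ 'i) \<le> norm x * 1" for x :: 'b
      by (simp add: norm_vec_def L2_set_def axis_def if_distrib[of norm] if_distrib[of "\<lambda>z. z\<^sup>2"] cong: if_cong)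
  qed (auto simp: axis_def vec_eq_iff)
  have eq: "(\<chi> i. g i) = (\<Sum>i\<in>UNIV. axis i (g i) :: 'b ^ 'i)" for g :: "'i \<Rightarrow> 'b"
    by (simp add: vec_eq_iff axis_def)
  have "((\<lambda>x. \<chi> i. f x i) has_derivative (\<lambda>v. \<chi> i. D i v)) (at y)"
    unfolding eq
    by (intro has_derivative_sum bounded_linear.has_derivative[OF bl] D)
  then show ?thesis
    unfolding cdiff_at_def by (intro exI[of _ "\<lambda>v. \<chi> i. D i v"]) (auto simp: imul_vec_def D)
qed

lemmas cdiff_at_intros = cdiff_at_const cdiff_at_id cdiff_at_nth cdiff_at_fst cdiff_at_snd
  cdiff_at_Pair cdiff_at_add cdiff_at_sum cdiff_at_mult cdiff_at_uminus cdiff_at_diff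
  cdiff_at_inverse cdiff_at_divide cdiff_at_power cdiff_at_vec_lambda

lemma cdiff_at_imp_isCont: "cdiff_at f y \<Longrightarrow> isCont f y"
  unfolding cdiff_at_def using has_derivative_continuous by blast

lemma holomorphic_open_imp_continuous_on: "holomorphic_open W F \<Longrightarrow> continuous_on W F"
  by (auto simp: holomorphic_open_iff cdiff_at_imp_isCont intro!: continuous_at_imp_continuous_on)

lemma holomorphic_open_imp_map:
  assumes "holomorphic_open W F" "S \<subseteq> W" "\<And>w. w \<in> S \<Longrightarrow> F w = f w"
  shows "holomorphic_map S f"
  unfolding holomorphic_map_def using assms by (intro ballI exI[of _ W] exI[of _ F]) auto

lemma holomorphic_map_subset: "holomorphic_map S f \<Longrightarrow> T \<subseteq> S \<Longrightarrow> holomorphic_map T f"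
  unfolding holomorphic_map_def
proof
  fix y assume *: "\<forall>y\<in>S. \<exists>W F. y \<in> W \<and> holomorphic_open W F \<and> (\<forall>w\<in>S \<inter> W. F w = f w)"
    and "T \<subseteq> S" "y \<in> T"
  then obtain W F where "y \<in> W" "holomorphic_open W F" "\<forall>w\<in>S \<inter> W. F w = f w"
    by blast
  then show "\<exists>W F. y \<in> W \<and> holomorphic_open W F \<and> (\<forall>w\<in>T \<inter> W. F w = f w)"
    using \<open>T \<subseteq> S\<close> by (intro exI[of _ W] exI[of _ F]) auto
qed

lemma holomorphic_map_cong:
  "holomorphic_map S f \<Longrightarrow> (\<And>x. x \<in> S \<Longrightarrow> f x = g x) \<Longrightarrow> holomorphic_map S g"
  unfolding holomorphic_map_def by (metis IntD1)

text \<open>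
  A local extension around \<open>y\<close> is cut down to an open set of the ambient space that meets \<open>S\<close> inside \<open>W\<close>.
\<close>

lemma holomorphic_map_locally:
  assumes "\<And>y. y \<in> S \<Longrightarrow> \<exists>W. y \<in> W \<and> openin (top_of_set S) W \<and> holomorphic_map W f"
  shows "holomorphic_map S f"
  unfolding holomorphic_map_def
proof
  fix y assume "y \<in> S"
  then obtain W where W: "y \<in> W" "openin (top_of_set S) W" "holomorphic_map W f"
    using assms by blast
  then obtain O' where O': "open O'" "W = S \<inter> O'" by (auto simp: openin_open)
  obtain V F where V: "y \<in> V" "holomorphic_open V F" "\<forall>w\<in>W \<inter> V. F w = f w"
    using W unfolding holomorphic_map_def by blast
  have "holomorphic_open (V \<inter> O') F" using V(2) O'(1) by (auto simp: holomorphic_open_iff)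
  moreover have "y \<in> V \<inter> O'" "\<forall>w\<in>S \<inter> (V \<inter> O'). F w = f w" using V W O' by auto
  ultimately show "\<exists>W F. y \<in> W \<and> holomorphic_open W F \<and> (\<forall>w\<in>S \<inter> W. F w = f w)"
    by (intro exI[of _ "V \<inter> O'"] exI[of _ F]) simp
qed

lemma holomorphic_map_imp_continuous_on:
  assumes "holomorphic_map S f"
  shows "continuous_on S f"
  unfolding continuous_on_eq_continuous_within
proof
  fix y assume "y \<in> S"
  then obtain W F where W: "y \<in> W" "holomorphic_open W F" "\<forall>w\<in>S \<inter> W. F w = f w"
    using assms unfolding holomorphic_map_def by blast
  have "isCont F y" using W by (auto simp: holomorphic_open_iff cdiff_at_imp_isCont)
  then have "continuous (at y within S) F" by (rule continuous_at_imp_continuous_at_within)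
  moreover have "\<forall>\<^sub>F x in at y within S. F x = f x"
    using W by (auto simp: eventually_at_topological holomorphic_open_def)
  moreover have "F y = f y" using W \<open>y \<in> S\<close> by auto
  ultimately show "continuous (at y within S) f"
    unfolding continuous_within using filterlim_cong[OF refl refl, of F f "at y within S"] by auto
qed

lemma holomorphic_map_compose:
  assumes "holomorphic_map S f" "holomorphic_map T g" "f ` S \<subseteq> T"
  shows "holomorphic_map S (g \<circ> f)"
  unfolding holomorphic_map_def
proof
  fix y assume y: "y \<in> S"
  then obtain V F where V: "y \<in> V" "holomorphic_open V F" "\<forall>w\<in>S \<inter> V. F w = f w"
    using assms(1) unfolding holomorphic_map_def by blast
  have "f y \<in> T" using assms(3) y by auto
  then obtain W G where W: "f y \<in> W" "holomorphic_open W G" "\<forall>w\<in>T \<inter> W. G w = g w"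
    using assms(2) unfolding holomorphic_map_def by blast
  let ?U = "V \<inter> F -` W"
  have "open ?U"
    using holomorphic_open_imp_continuous_on[OF V(2)] V(2) W(2)
    by (simp add: continuous_on_open_vimage holomorphic_open_def Int_commute)
  then have "holomorphic_open ?U (\<lambda>x. G (F x))"
    using V(2) W(2) by (auto simp: holomorphic_open_iff intro!: cdiff_at_compose[of F _ G])
  moreover have "y \<in> ?U" using V W y by auto
  moreover have "\<forall>w\<in>S \<inter> ?U. G (F w) = (g \<circ> f) w"
    using V(3) W(3) assms(3) by auto
  ultimately show "\<exists>W F. y \<in> W \<and> holomorphic_open W F \<and> (\<forall>w\<in>S \<inter> W. F w = (g \<circ> f) w)"
    by (intro exI[of _ ?U] exI[of _ "\<lambda>x. G (F x)"]) simp
qed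

section \<open>Holomorphic and meromorphic functions on the projective line\<close>

lemma analytic_at_compose_shift:
  "(\<lambda>t. f (a + t)) analytic_on {0::complex} \<longleftrightarrow> f analytic_on {a}"
proof
  assume "(\<lambda>t. f (a + t)) analytic_on {0}"
  then have "((\<lambda>t. f (a + t)) \<circ> (\<lambda>z. z - a)) analytic_on {a}"
    by (intro analytic_on_compose) (auto intro!: analytic_intros)
  then show "f analytic_on {a}" by (simp add: o_def)
next
  assume "f analytic_on {a}"
  then have "(f \<circ> (\<lambda>t. a + t)) analytic_on {0}"
    by (intro analytic_on_compose) (auto intro!: analytic_intros)
  then show "(\<lambda>t. f (a + t)) analytic_on {0}" by (simp add: o_def)
qed

lemma meromorphic_at_compose_shift:
  assumes "(\<lambda>t. f (a + t)) meromorphic_on {0::complex}"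
  shows "f meromorphic_on {a}"
  using assms unfolding meromorphic_on_def by simp

lemma eventually_loc_Aff:
  "(\<forall>\<^sub>F t in at 0. P (loc (Aff a) t)) \<longleftrightarrow> (\<forall>\<^sub>F z in at a. P (Aff z))"
  by (simp add: at_to_0'[of a] eventually_filtermap add.commute)

text \<open>
  Liouville's theorem: the restriction to the affine line is entire and has the limit \<open>f Infty\<close> at
  infinity.
\<close>

theorem hol_cp1_UNIV_constant:
  assumes "hol_cp1 UNIV f"
  shows "f x = f Infty"
proof -
  have "(\<lambda>z. f (Aff z)) analytic_on {a}" for a
  proof -
    have "(f \<circ> loc (Aff a)) analytic_on {0}" using assms by (auto simp: hol_cp1_def)
    then show ?thesis
      using analytic_at_compose_shift[of "\<lambda>z. f (Aff z)" a] by (simp add: o_def)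
  qed
  then have "(\<lambda>z. f (Aff z)) holomorphic_on UNIV"
    using analytic_on_analytic_at analytic_imp_holomorphic by blast
  moreover have "((\<lambda>z. f (Aff z)) \<longlongrightarrow> f Infty) at_infinity"
  proof -
    have "(f \<circ> loc Infty) analytic_on {0}" using assms by (auto simp: hol_cp1_def)
    then have "((f \<circ> loc Infty) \<longlongrightarrow> f Infty) (at 0)"
      using analytic_at_imp_isCont[of "f \<circ> loc Infty" 0] by (simp add: isCont_def)
    moreover have "\<forall>\<^sub>F t in at 0. (f \<circ> loc Infty) t = ((\<lambda>z. f (Aff z)) \<circ> inverse) t"
      by (auto simp: eventually_at_filter inverse_eq_divide)
    ultimately show ?thesis
      unfolding lim_at_infinity_0 using filterlim_cong[OF refl refl] by fast
  qed
  ultimately have "f (Aff z) = f Infty" for z by (rule Liouville_weak)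
  then show ?thesis by (cases x) auto
qed

text \<open>
  Order zero excludes a pole and an isolated zero, so that the singularity is removable with a nonzero
  value.
\<close>

lemma zorder_0_remove_sings:
  assumes "f meromorphic_on {z}" "\<forall>\<^sub>F w in at z. f w \<noteq> 0" "zorder f z = 0"
  shows "remove_sings f analytic_on {z}" "remove_sings f z \<noteq> 0" "f \<midarrow>z\<rightarrow> remove_sings f z"
proof -
  have nz: "frequently (\<lambda>w. f w \<noteq> 0) (at z)"
    using assms(2) eventually_frequently at_neq_bot by blast
  have "\<not> is_pole f z"
    using isolated_pole_imp_neg_zorder[of f z] assms by (auto simp: meromorphic_at_iff)
  then obtain c where c: "f \<midarrow>z\<rightarrow> c"
    using assms(1) by (auto simp: meromorphic_at_iff not_essential_def)
  have "\<not> isolated_zero f z"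
    using zorder_isolated_zero_pos'[of f z] assms by (auto simp: meromorphic_at_iff)
  with c assms(2) have "c \<noteq> 0" by (auto simp: isolated_zero_def)
  with c show "remove_sings f z \<noteq> 0" "f \<midarrow>z\<rightarrow> remove_sings f z"
    using remove_sings_eqI[OF c] by auto
  show "remove_sings f analytic_on {z}"
    using assms(1) c remove_sings_analytic_at by (auto simp: meromorphic_at_iff)
qed

lemma zorder_pos_tendsto_0:
  assumes "f meromorphic_on {z}" "\<forall>\<^sub>F w in at z. f w \<noteq> 0" "zorder f z > 0"
  shows "f \<midarrow>z\<rightarrow> 0"
  using zorder_pos_imp_isolated_zero[OF assms] by (simp add: isolated_zero_def)

lemma zorder_neg_tendsto_0:
  assumes "f meromorphic_on {z}" "\<forall>\<^sub>F w in at z. f w \<noteq> 0" "zorder f z < 0"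
  shows "(\<lambda>w. inverse (f w)) \<midarrow>z\<rightarrow> 0"
  using zorder_neg_imp_is_pole[OF assms]
  by (auto simp: is_pole_def intro: filterlim_compose[OF tendsto_inverse_0])

lemma power_int_sum_exponents:
  assumes "(t :: 'a::field) \<noteq> 0"
  shows "t powi (\<Sum>a\<in>S. f a) = (\<Prod>a\<in>S. t powi f a)"
  by (induction S rule: infinite_finite_induct) (use assms in \<open>auto simp: power_int_add\<close>)

text \<open>
  A principal divisor has degree zero.  Dividing \<open>h\<close> by the rational function \<open>r\<close> with the same zeros
  and poles in the affine line leaves an entire function \<open>K\<close> without zeros.  Its order \<open>M\<close> at infinity
  is the sum of all orders of \<open>h\<close>.  If \<open>M > 0\<close> then \<open>K\<close> tends to zero at infinity, if \<open>M < 0\<close> then its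
  reciprocal does; both contradict Liouville's theorem.
\<close>

theorem sum_zorder_cp1:
  fixes h :: "cp1 \<Rightarrow> complex"
  assumes fin: "finite {x. m x \<noteq> 0}"
    and mero: "\<And>x. (h \<circ> loc x) meromorphic_on {0}"
    and nz: "\<And>x. \<forall>\<^sub>F t in at 0. h (loc x t) \<noteq> 0"
    and ord: "\<And>x. zorder (h \<circ> loc x) 0 = m x"
  shows "(\<Sum>x | m x \<noteq> 0. m x) = 0"
proof -
  define g where "g = (\<lambda>z. h (Aff z))"
  define S where "S = {a. m (Aff a) \<noteq> 0}"
  define r where "r = (\<lambda>z. \<Prod>a\<in>S. (z - a) powi m (Aff a))"
  define k where "k = (\<lambda>z. g z / r z)"
  have [simp]: "finite S"
    unfolding S_def by (rule finite_imageD[of Aff]) (auto intro: finite_subset[OF _ fin] inj_onI)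
  have g1: "g meromorphic_on {a}" for a
    using mero[of "Aff a"] meromorphic_at_compose_shift[of g a] by (simp add: g_def o_def)
  have g2: "\<forall>\<^sub>F z in at a. g z \<noteq> 0" for a
    using nz[of "Aff a"] eventually_loc_Aff[of "\<lambda>x. h x \<noteq> 0" a] by (simp add: g_def)
  have g3: "zorder g a = m (Aff a)" for a
    using ord[of "Aff a"] unfolding zorder_shift[of g a] by (simp add: g_def o_def add.commute)
  have rnz: "\<forall>\<^sub>F z in at a. (\<Prod>b\<in>S. (z - b) powi m (Aff b)) \<noteq> 0" for a
  proof -
    have "\<forall>\<^sub>F z in at a. \<forall>b\<in>S. z \<noteq> b"
      by (intro eventually_ball_finite) (auto intro: eventually_neq_at_within)
    then show ?thesis by eventually_elim auto
  qed
  have r1: "r meromorphic_on {a}" for a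
    unfolding r_def by (intro meromorphic_intros)
  have r2: "\<forall>\<^sub>F z in at a. r z \<noteq> 0" for a
    unfolding r_def by (rule rnz)
  have r3: "zorder r a = m (Aff a)" for a
  proof -
    have ord_factor: "zorder (\<lambda>z. (z - b) powi m (Aff b)) a = (if a = b then m (Aff b) else 0)" for b
    proof (cases "a = b")
      case True
      then show ?thesis by (intro zorder_eqI[of UNIV _ "\<lambda>_. 1"]) auto
    next
      case False
      then show ?thesis
        by (simp, intro zorder_eqI[of "- {b}" _ "\<lambda>z. (z - b) powi m (Aff b)"])
          (auto intro!: holomorphic_intros)
    qed
    have "zorder r a = (\<Sum>b\<in>S. zorder (\<lambda>z. (z - b) powi m (Aff b)) a)"
      unfolding r_def by (intro zorder_prod rnz) (auto intro!: meromorphic_intros)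
    also have "\<dots> = m (Aff a)" by (auto simp: ord_factor) (auto simp: S_def)
    finally show ?thesis .
  qed
  have freq: "(\<forall>\<^sub>F z in at a. f z \<noteq> (0::complex)) \<Longrightarrow> frequently (\<lambda>z. f z \<noteq> 0) (at a)" for f and a :: complex
    using eventually_frequently at_neq_bot by blast
  have k1: "k meromorphic_on {a}" for a
    unfolding k_def by (intro meromorphic_intros g1 r1)
  have k2: "\<forall>\<^sub>F z in at a. k z \<noteq> 0" for a
    using g2[of a] rnz[of a] unfolding k_def r_def by eventually_elim auto
  have k3: "zorder k a = 0" for a
    unfolding k_def
    by (subst zorder_divide[OF g1 freq[OF g2] r1 freq[OF r2]]) (simp add: g3 r3)
  define K where "K = remove_sings k"
  have K: "K holomorphic_on UNIV" "\<And>a. K a \<noteq> 0"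
  proof -
    have "K analytic_on UNIV"
      unfolding K_def analytic_on_analytic_at[of _ UNIV] using zorder_0_remove_sings(1)[OF k1 k2 k3] by blast
    then show "K holomorphic_on UNIV" by (rule analytic_imp_holomorphic)
    show "K a \<noteq> 0" for a
      unfolding K_def by (rule zorder_0_remove_sings(2)[OF k1 k2 k3])
  qed
  define M where "M = m Infty + (\<Sum>a\<in>S. m (Aff a))"
  \<comment> \<open>In the coordinate \<open>t = 1 / z\<close>, the functions \<open>k\<close> and \<open>r\<close> become \<open>\<kappa>\<close> and \<open>\<rho>\<close>.\<close>
  define \<kappa> where "\<kappa> = (\<lambda>t. k (inverse t))"
  define \<rho> where "\<rho> = (\<lambda>t. (\<Prod>a\<in>S. (1 - a * t) powi m (Aff a)) * t powi (- (\<Sum>a\<in>S. m (Aff a))))"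
  have kap_eq: "\<forall>\<^sub>F t in at 0. \<kappa> t = (h \<circ> loc Infty) t / \<rho> t"
  proof -
    have "\<forall>\<^sub>F t in at (0::complex). t \<noteq> 0" by (rule eventually_neq_at_within)
    then show ?thesis
    proof eventually_elim
      case (elim t)
      have "r (inverse t) = (\<Prod>a\<in>S. (1 - a * t) powi m (Aff a) * t powi (- m (Aff a)))"
        unfolding r_def
      proof (intro prod.cong refl)
        fix a
        have "inverse t - a = (1 - a * t) * inverse t" using elim by (simp add: field_simps)
        then show "(inverse t - a) powi m (Aff a) = (1 - a * t) powi m (Aff a) * t powi (- m (Aff a))"
          by (simp add: power_int_mult_distrib power_int_minus power_int_inverse)
      qed
      also have "\<dots> = \<rho> t"
        unfolding \<rho>_def prod.distrib sum_negf[symmetric] using elim by (simp add: power_int_sum_exponents)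
      finally show ?case using elim by (simp add: \<kappa>_def k_def g_def inverse_eq_divide)
    qed
  qed
  have rho_nz: "\<forall>\<^sub>F t in at 0. (\<Prod>a\<in>S. (1 - a * t) powi m (Aff a)) \<noteq> 0"
  proof -
    have "\<forall>\<^sub>F t in at (0::complex). \<forall>a\<in>S. 1 - a * t \<noteq> 0"
    proof (intro eventually_ball_finite ballI)
      fix a
      have "((\<lambda>t. 1 - a * t) \<longlongrightarrow> 1 - a * 0) (at (0::complex))" by (intro tendsto_intros)
      then show "\<forall>\<^sub>F t in at 0. 1 - a * t \<noteq> 0" by (intro tendsto_imp_eventually_ne) auto
    qed simp
    then show ?thesis by eventually_elim auto
  qed
  have rho: "\<rho> meromorphic_on {0}" "\<forall>\<^sub>F t in at 0. \<rho> t \<noteq> 0" "zorder \<rho> 0 = - (\<Sum>a\<in>S. m (Aff a))"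
  proof -
    show "\<rho> meromorphic_on {0}" unfolding \<rho>_def by (intro meromorphic_intros)
    show "\<forall>\<^sub>F t in at 0. \<rho> t \<noteq> 0"
      using rho_nz eventually_neq_at_within[of 0] unfolding \<rho>_def by eventually_elim auto
    let ?p = "\<lambda>t. \<Prod>a\<in>S. (1 - a * t) powi m (Aff a)"
    have "?p analytic_on {0}"
      by (intro analytic_intros) auto
    then obtain U where "open U" "0 \<in> U" "?p holomorphic_on U"
      using analytic_at by auto
    then show "zorder \<rho> 0 = - (\<Sum>a\<in>S. m (Aff a))"
      by (intro zorder_eqI[of U _ ?p]) (auto simp: \<rho>_def)
  qed
  have kap: "\<kappa> meromorphic_on {0}" "\<forall>\<^sub>F t in at 0. \<kappa> t \<noteq> 0" "zorder \<kappa> 0 = M"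
  proof -
    have "(\<lambda>t. (h \<circ> loc Infty) t / \<rho> t) meromorphic_on {0}"
      by (intro meromorphic_intros mero rho)
    then show "\<kappa> meromorphic_on {0}"
      using meromorphic_on_cong[of "{0}" \<kappa>] kap_eq by fastforce
    show "\<forall>\<^sub>F t in at 0. \<kappa> t \<noteq> 0"
      using kap_eq nz[of Infty] rho(2) by eventually_elim auto
    have "zorder \<kappa> 0 = zorder (\<lambda>t. (h \<circ> loc Infty) t / \<rho> t) 0"
      using kap_eq by (rule zorder_cong) auto
    also have "\<dots> = M"
      using freq[OF nz[of Infty]]
      by (subst zorder_divide[OF mero _ rho(1) freq[OF rho(2)]]) (auto simp: M_def rho(3) ord simp del: loc.simps)
    finally show "zorder \<kappa> 0 = M" .
  qed
  have K_inf: "\<forall>\<^sub>F t in at 0. \<kappa> t = (K \<circ> inverse) t"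
  proof -
    obtain e where e: "e > 0" "\<kappa> analytic_on ball 0 e - {0}"
      using kap(1) by (auto simp: meromorphic_at_iff isolated_singularity_at_def)
    have "\<forall>\<^sub>F t in at 0. t \<in> ball 0 e - {0::complex}"
      using e(1) by (intro eventually_at_in_open) auto
    then show ?thesis
    proof eventually_elim
      case (elim t)
      then have "\<kappa> analytic_on {inverse (inverse t)}" using analytic_on_subset[OF e(2), of "{t}"] by auto
      then have "(\<kappa> \<circ> inverse) analytic_on {inverse t}"
        using elim by (intro analytic_on_compose[of inverse "{inverse t}" \<kappa>])
          (auto intro!: analytic_on_inverse analytic_on_ident)
      then have "k analytic_on {inverse t}" by (simp add: \<kappa>_def o_def)
      then show ?case by (simp add: K_def \<kappa>_def)
    qed
  qed
  have "M = 0"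
  proof (rule ccontr)
    assume "M \<noteq> 0"
    then consider "M > 0" | "M < 0" by linarith
    then show False
    proof cases
      case 1
      then have "\<kappa> \<midarrow>0\<rightarrow> 0" using zorder_pos_tendsto_0[OF kap(1,2)] kap(3) by simp
      then have "((K \<circ> inverse) \<longlongrightarrow> 0) (at 0)"
        using filterlim_cong[OF refl refl K_inf] by blast
      then have "(K \<longlongrightarrow> 0) at_infinity" by (simp add: lim_at_infinity_0)
      then have "K 0 = 0" by (rule Liouville_weak_0[OF K(1)])
      then show False using K(2) by simp
    next
      case 2
      then have "(\<lambda>t. inverse (\<kappa> t)) \<midarrow>0\<rightarrow> 0" using zorder_neg_tendsto_0[OF kap(1,2)] kap(3) by simp
      moreover have "\<forall>\<^sub>F t in at 0. inverse (\<kappa> t) = ((\<lambda>z. inverse (K z)) \<circ> inverse) t"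
        using K_inf by eventually_elim simp
      ultimately have "(((\<lambda>z. inverse (K z)) \<circ> inverse) \<longlongrightarrow> 0) (at 0)"
        using filterlim_cong[OF refl refl] by fast
      then have "((\<lambda>z. inverse (K z)) \<longlongrightarrow> 0) at_infinity" by (simp add: lim_at_infinity_0)
      then have "inverse (K 0) = 0"
        by (intro Liouville_weak_0) (use K in \<open>auto intro!: holomorphic_intros\<close>)
      then show False using K(2) by simp
    qed
  qed
  moreover have "(\<Sum>x | m x \<noteq> 0. m x) = M"
  proof -
    have "(\<Sum>x | m x \<noteq> 0. m x) = (\<Sum>x\<in>insert Infty (Aff ` S). m x)"
    proof (rule sum.mono_neutral_left)
      show "{x. m x \<noteq> 0} \<subseteq> insert Infty (Aff ` S)"
      proof
        fix x assume "x \<in> {x. m x \<noteq> 0}"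
        then show "x \<in> insert Infty (Aff ` S)" by (cases x) (auto simp: S_def)
      qed
    qed auto
    also have "\<dots> = M"
      by (subst sum.insert) (auto simp: M_def sum.reindex inj_on_def)
    finally show ?thesis .
  qed
  ultimately show ?thesis by simp
qed

section \<open>Logarithmic one-forms on the projective line\<close>

lemma residue_simple_pole_analytic:
  assumes "h analytic_on {0}" "\<forall>\<^sub>F t in at 0. t * \<phi> t = h t"
  shows "residue \<phi> 0 = h 0"
proof -
  obtain U where U: "open U" "0 \<in> U" "h holomorphic_on U" using assms(1) analytic_at by auto
  have "residue \<phi> 0 = residue (\<lambda>t. h t / (t - 0)) 0"
  proof (rule residue_cong)
    show "\<forall>\<^sub>F t in at 0. \<phi> t = h t / (t - 0)"
      using assms(2) eventually_neq_at_within[of 0] by eventually_elim (auto simp: field_simps)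
  qed simp
  also have "\<dots> = h 0" using U by (rule residue_simple)
  finally show ?thesis .
qed

text \<open>
  The first claim says that the form is the sum of its polar parts, the second is the residue theorem.
  Removing the polar parts from the coefficient leaves an entire function \<open>K\<close>.  As \<open>dz = - dt / t\<^sup>2\<close>, a
  form with at most a simple pole at infinity has a coefficient \<open>g\<close> such that \<open>z * g z\<close> converges, to
  minus the residue.  So \<open>K\<close> tends to zero and vanishes, and comparison of the limits of
  \<open>z * g z\<close> gives the sum of the residues.
\<close>

lemma log_form_on_cp1:
  fixes f :: "cp1 \<Rightarrow> complex"
  assumes fin: "finite D"
    and hol: "\<And>x. x \<notin> D \<Longrightarrow> (\<lambda>t. jac x t * f (loc x t)) analytic_on {0}"
    and pole: "\<And>x. x \<in> D \<Longrightarrow>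
      \<exists>h. h analytic_on {0} \<and> (\<forall>\<^sub>F t in at 0. t * (jac x t * f (loc x t)) = h t)"
  defines "r \<equiv> \<lambda>x. residue (\<lambda>t. jac x t * f (loc x t)) 0"
  shows "Aff z \<notin> D \<Longrightarrow> f (Aff z) = (\<Sum>a | Aff a \<in> D. r (Aff a) / (z - a))"
    and "(\<Sum>x\<in>D. r x) = 0"
proof -
  define S where "S = {a. Aff a \<in> D}"
  have [simp]: "finite S"
    unfolding S_def by (rule finite_imageD[of Aff]) (auto intro: finite_subset[OF _ fin] inj_onI)
  define g where "g = (\<lambda>z. f (Aff z))"
  define P where "P = (\<lambda>z. \<Sum>a\<in>S. r (Aff a) / (z - a))"
  define k where "k = (\<lambda>z. g z - P z)"
  have g_an: "g analytic_on {a}" if "a \<notin> S" for a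
    using hol[of "Aff a"] that analytic_at_compose_shift[of g a] by (simp add: S_def g_def)
  have P_an: "P analytic_on {a}" if "a \<notin> S" for a
    unfolding P_def using that by (intro analytic_intros) auto
  have k_an: "k analytic_on {a}" if "a \<notin> S" for a
    unfolding k_def using that by (intro analytic_intros g_an P_an)
  have k_pole: "remove_sings k analytic_on {a}" if a: "a \<in> S" for a
  proof -
    obtain h where h: "h analytic_on {0}" "\<forall>\<^sub>F t in at 0. t * (jac (Aff a) t * f (loc (Aff a) t)) = h t"
      using pole[of "Aff a"] a by (auto simp: S_def)
    have h0: "r (Aff a) = h 0"
      unfolding r_def by (rule residue_simple_pole_analytic[OF h])
    define h' where "h' = (\<lambda>z. h (z - a))"
    have h'an: "h' analytic_on {a}"
      using h(1) analytic_at_compose_shift[of h' a] by (simp add: h'_def)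
    have geq: "\<forall>\<^sub>F z in at a. (z - a) * g z = h' z"
      using h(2) unfolding h'_def by (simp add: at_to_0'[of a] eventually_filtermap g_def add.commute)
    define R where "R = (\<lambda>z. \<Sum>b\<in>S - {a}. r (Aff b) / (z - b))"
    have R_an: "R analytic_on {a}"
      unfolding R_def by (intro analytic_intros) auto
    have P_split: "P z = r (Aff a) / (z - a) + R z" for z
      unfolding P_def R_def using a by (subst sum.remove[of _ a]) auto
    have k_eq: "\<forall>\<^sub>F z in at a. k z = (h' z - h' a) / (z - a) - R z"
      using geq eventually_neq_at_within[of a a]
    proof eventually_elim
      case (elim z)
      then have "g z = h' z / (z - a)" by (simp add: field_simps)
      then show ?case by (simp add: k_def P_split h0 h'_def diff_divide_distrib)
    qed
    have "(\<lambda>z. (h' z - h' a) / (z - a) - R z) meromorphic_on {a}"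
      by (intro meromorphic_intros analytic_on_imp_meromorphic_on h'an R_an)
    then have mero: "k meromorphic_on {a}"
      using meromorphic_on_cong[of "{a}" k] k_eq by fastforce
    have "((\<lambda>z. (h' z - h' a) / (z - a)) \<longlongrightarrow> deriv h' a) (at a)"
      using analytic_on_imp_differentiable_at[OF h'an] 
      by (simp add: field_differentiable_derivI flip: DERIV_def has_field_derivative_iff)
    then have "((\<lambda>z. (h' z - h' a) / (z - a) - R z) \<longlongrightarrow> deriv h' a - R a) (at a)"
      using analytic_at_imp_isCont[OF R_an] by (intro tendsto_diff) (auto simp: isCont_def)
    then have "(k \<longlongrightarrow> deriv h' a - R a) (at a)"
      using filterlim_cong[OF refl refl k_eq] by blast
    then show ?thesis
      using mero remove_sings_analytic_at by (auto simp: meromorphic_at_iff)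
  qed
  define K where "K = remove_sings k"
  have K_eq: "K a = k a" if "a \<notin> S" for a
    unfolding K_def using k_an[OF that] by simp
  have "K analytic_on {a}" for a
  proof (cases "a \<in> S")
    case False
    then have "\<forall>\<^sub>F z in nhds a. K z = k z"
      unfolding K_def using k_an by (intro eventually_remove_sings_eq_nhds)
    then show ?thesis using analytic_at_cong[of K k a] k_an[OF False] by simp
  qed (use k_pole in \<open>simp add: K_def\<close>)
  then have K_hol: "K holomorphic_on UNIV"
    using analytic_on_analytic_at[of K UNIV] analytic_imp_holomorphic by blast
  define c where "c = (if Infty \<in> D then r Infty else 0)"
  have c_lim: "((\<lambda>t. t * (jac Infty t * f (loc Infty t))) \<longlongrightarrow> c) (at 0)"
  proof (cases "Infty \<in> D")
    case True
    then obtain h where h: "h analytic_on {0}" "\<forall>\<^sub>F t in at 0. t * (jac Infty t * f (loc Infty t)) = h t"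
      using pole by blast
    have "r Infty = h 0"
      unfolding r_def by (rule residue_simple_pole_analytic[OF h])
    moreover have "(h \<longlongrightarrow> h 0) (at 0)" using analytic_at_imp_isCont[OF h(1)] by (simp add: isCont_def)
    ultimately show ?thesis using filterlim_cong[OF refl refl h(2)] True by (auto simp: c_def)
  next
    case False
    have "isCont (\<lambda>t. jac Infty t * f (loc Infty t)) 0"
      by (rule analytic_at_imp_isCont[OF hol[OF False]])
    then have "((\<lambda>t. t * (jac Infty t * f (loc Infty t))) \<longlongrightarrow> 0 * (jac Infty 0 * f (loc Infty 0))) (at 0)"
      unfolding isCont_def by (rule tendsto_mult[OF tendsto_ident_at])
    then show ?thesis using False by (simp add: c_def)
  qed
  have g_inf: "((\<lambda>z. z * g z) \<longlongrightarrow> - c) at_infinity"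
  proof -
    have "\<forall>\<^sub>F t in at 0. - (t * (jac Infty t * f (loc Infty t))) = ((\<lambda>z. z * g z) \<circ> inverse) t"
      using eventually_neq_at_within[of 0]
      by eventually_elim (simp add: g_def inverse_eq_divide power2_eq_square)
    then show ?thesis
      unfolding lim_at_infinity_0 by (rule Lim_transform_eventually[OF tendsto_minus[OF c_lim]])
  qed
  have g_inf0: "(g \<longlongrightarrow> 0) at_infinity"
  proof -
    have "((\<lambda>z. inverse z * (z * g z)) \<longlongrightarrow> 0 * (- c)) at_infinity"
      by (intro tendsto_mult tendsto_inverse_0 g_inf)
    moreover have "\<forall>\<^sub>F z in at_infinity. inverse z * (z * g z) = g z"
      using eventually_not_equal_at_infinity[of 0] by eventually_elim simp
    ultimately have "(g \<longlongrightarrow> 0 * (- c)) at_infinity" by (rule Lim_transform_eventually)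
    then show ?thesis by simp
  qed
  have P_inf: "((\<lambda>z. z * P z) \<longlongrightarrow> (\<Sum>a\<in>S. r (Aff a))) at_infinity"
  proof -
    have "((\<lambda>z. z * (r (Aff a) / (z - a))) \<longlongrightarrow> r (Aff a)) at_infinity" for a
    proof -
      have "((\<lambda>t. r (Aff a) / (1 - a * t)) \<longlongrightarrow> r (Aff a) / (1 - a * 0)) (at 0)"
        by (intro tendsto_intros) auto
      moreover have "\<forall>\<^sub>F t in at 0. r (Aff a) / (1 - a * t) = ((\<lambda>z. z * (r (Aff a) / (z - a))) \<circ> inverse) t"
        using eventually_neq_at_within[of 0] by eventually_elim (auto simp: divide_simps)
      ultimately have "(((\<lambda>z. z * (r (Aff a) / (z - a))) \<circ> inverse) \<longlongrightarrow> r (Aff a) / (1 - a * 0)) (at 0)"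
        by (rule Lim_transform_eventually)
      then show ?thesis unfolding lim_at_infinity_0 by simp
    qed
    then show ?thesis
      unfolding P_def sum_distrib_left by (intro tendsto_sum)
  qed
  have P_inf0: "(P \<longlongrightarrow> 0) at_infinity"
  proof -
    have "((\<lambda>z. inverse z * (z * P z)) \<longlongrightarrow> 0 * (\<Sum>a\<in>S. r (Aff a))) at_infinity"
      by (intro tendsto_mult tendsto_inverse_0 P_inf)
    moreover have "\<forall>\<^sub>F z in at_infinity. inverse z * (z * P z) = P z"
      using eventually_not_equal_at_infinity[of 0] by eventually_elim simp
    ultimately have "(P \<longlongrightarrow> 0 * (\<Sum>a\<in>S. r (Aff a))) at_infinity" by (rule Lim_transform_eventually)
    then show ?thesis by simp
  qed
  have off_S: "\<forall>\<^sub>F z in at_infinity. z \<notin> S"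
  proof -
    have "\<forall>\<^sub>F z in at_infinity. \<forall>a\<in>S. z \<noteq> a"
      by (intro eventually_ball_finite ballI eventually_not_equal_at_infinity) simp
    then show ?thesis by eventually_elim auto
  qed
  have "(K \<longlongrightarrow> 0) at_infinity"
  proof -
    have "(k \<longlongrightarrow> 0) at_infinity"
      unfolding k_def using tendsto_diff[OF g_inf0 P_inf0] by simp
    moreover have "\<forall>\<^sub>F z in at_infinity. k z = K z"
      using off_S by eventually_elim (simp add: K_eq)
    ultimately show ?thesis by (rule Lim_transform_eventually)
  qed
  then have K0: "K z = 0" for z by (rule Liouville_weak_0[OF K_hol])
  have gP: "g z = P z" if "z \<notin> S" for z
    using K0[of z] K_eq[OF that] by (simp add: k_def)
  then show "f (Aff z) = (\<Sum>a | Aff a \<in> D. r (Aff a) / (z - a))" if "Aff z \<notin> D"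
    using that by (simp add: g_def P_def S_def)
  have "\<forall>\<^sub>F z in at_infinity. z * g z = z * P z"
    using off_S by eventually_elim (simp add: gP)
  then have "((\<lambda>z. z * P z) \<longlongrightarrow> - c) at_infinity"
    by (rule Lim_transform_eventually[OF g_inf])
  then have "- c = (\<Sum>a\<in>S. r (Aff a))"
    using P_inf tendsto_unique[OF trivial_limit_at_infinity] by blast
  moreover have "(\<Sum>x\<in>D. r x) = (\<Sum>a\<in>S. r (Aff a)) + c"
  proof -
    have "D - {Infty} = Aff ` S"
    proof -
      have "x \<in> Aff ` S" if "x \<in> D" "x \<noteq> Infty" for x
        using that by (cases x) (auto simp: S_def)
      then show ?thesis by (auto simp: S_def)
    qed
    then have "(\<Sum>x\<in>D - {Infty}. r x) = (\<Sum>a\<in>S. r (Aff a))"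
      by (simp add: sum.reindex inj_on_def)
    then show ?thesis
      using fin by (cases "Infty \<in> D") (auto simp: c_def sum.remove)
  qed
  ultimately show "(\<Sum>x\<in>D. r x) = 0" by (metis add.commute add.right_inverse minus_minus)
qed

text \<open>
  The form \<open>dz / (z - a)\<close>, in the coordinate \<open>dt\<close> at \<open>Infty\<close>.  There it has a pole, but a combination
  \<open>\<Sum>\<^sub>i r\<^sub>i dz / (z - a\<^sub>i)\<close> with \<open>\<Sum>\<^sub>i r\<^sub>i = 0\<close> is holomorphic at \<open>Infty\<close> with the value \<open>- \<Sum>\<^sub>i r\<^sub>i a\<^sub>i\<close>.  For a
  marked point at \<open>Infty\<close> the coefficient is zero, since the residue there is determined by the others.
\<close>

definition log_basis :: "cp1 \<Rightarrow> cp1 \<Rightarrow> complex" where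
  "log_basis x y = (case x of Infty \<Rightarrow> 0
     | Aff a \<Rightarrow> (case y of Aff z \<Rightarrow> 1 / (z - a) | Infty \<Rightarrow> - a))"

lemma log_basis_simps [simp]:
  "log_basis Infty y = 0" "log_basis (Aff a) (Aff z) = 1 / (z - a)" "log_basis (Aff a) Infty = - a"
  by (simp_all add: log_basis_def)

lemma log_basis_analytic:
  assumes "x \<noteq> Aff b"
  shows "(\<lambda>t. log_basis x (Aff (b + t))) analytic_on {0}"
proof (cases x)
  case (Aff a)
  then show ?thesis using assms by (auto intro!: analytic_intros)
qed auto

text \<open>
  Near \<open>Infty\<close> one has \<open>- 1 / t\<^sup>2 * 1 / (1 / t - a) = - a / (1 - a t) - 1 / t\<close>.  The terms \<open>1 / t\<close> add
  up to the residue at \<open>Infty\<close>, if this is a marked point, and cancel otherwise.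
\<close>

lemma log_form_with_residues:
  fixes x :: "'n::finite \<Rightarrow> cp1"
  assumes x: "inj x" and r: "(\<Sum>i\<in>UNIV. r i) = 0"
  defines "f \<equiv> \<lambda>y. \<Sum>i\<in>UNIV. log_basis (x i) y * r i"
  shows "y \<notin> range x \<Longrightarrow> (\<lambda>t. jac y t * f (loc y t)) analytic_on {0}"
    and "\<exists>h. h analytic_on {0} \<and> h 0 = r k \<and> (\<forall>\<^sub>F t in at 0. t * (jac (x k) t * f (loc (x k) t)) = h t)"
proof -
  define G where "G = (\<lambda>t. \<Sum>i\<in>UNIV. (case x i of Infty \<Rightarrow> 0 | Aff a \<Rightarrow> - a / (1 - a * t)) * r i)"
  have G_an: "G analytic_on {0}"
    unfolding G_def
  proof (intro analytic_intros)
    fix i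
    show "(\<lambda>t. case x i of Aff a \<Rightarrow> - a / (1 - a * t) | Infty \<Rightarrow> 0) analytic_on {0}"
      by (cases "x i") (auto intro!: analytic_intros)
  qed
  have G_eq: "\<forall>\<^sub>F t in at 0. jac Infty t * f (loc Infty t) = G t + (\<Sum>i | x i = Infty. r i) / t"
  proof -
    have "\<forall>\<^sub>F t in at (0::complex). 1 - a * t \<noteq> 0" for a
    proof -
      have "((\<lambda>t. 1 - a * t) \<longlongrightarrow> 1 - a * 0) (at (0::complex))" by (intro tendsto_intros)
      then show ?thesis by (intro tendsto_imp_eventually_ne) auto
    qed
    then have "\<forall>\<^sub>F t in at (0::complex). \<forall>i\<in>(UNIV::'n set). \<forall>a\<in>{a. x i = Aff a}. 1 - a * t \<noteq> 0"
    proof (intro eventually_ball_finite ballI)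
      show "finite {a. x i = Aff a}" for i
        by (cases "x i") auto
    qed auto
    then show ?thesis
      using eventually_neq_at_within[of 0]
    proof eventually_elim
      case (elim t)
      have summand: "- (1 / t\<^sup>2) * log_basis (x i) (Aff (1 / t)) * r i =
          (case x i of Infty \<Rightarrow> 0 | Aff a \<Rightarrow> - a / (1 - a * t)) * r i
          + (if x i = Infty then r i / t else 0) - r i / t" for i
      proof (cases "x i")
        case (Aff a)
        then have "1 - a * t \<noteq> 0" using elim by auto
        moreover from this have "1 / t - a \<noteq> 0" using elim by (auto simp: field_simps)
        ultimately have "- (1 / t\<^sup>2) * (1 / (1 / t - a)) = - a / (1 - a * t) - 1 / t"
          using elim by (simp add: field_simps power2_eq_square)
        then have "- (1 / t\<^sup>2) * (1 / (1 / t - a)) * r i = (- a / (1 - a * t) - 1 / t) * r i"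
          by (rule arg_cong)
        then show ?thesis using Aff by (simp add: left_diff_distrib)
      qed simp
      have "jac Infty t * f (loc Infty t) = (\<Sum>i\<in>UNIV. - (1 / t\<^sup>2) * log_basis (x i) (Aff (1 / t)) * r i)"
        using elim by (simp add: f_def sum_distrib_left sum_negf mult.assoc)
      also have "\<dots> = G t + (\<Sum>i\<in>UNIV. if x i = Infty then r i / t else 0) - (\<Sum>i\<in>UNIV. r i / t)"
        unfolding summand sum.distrib sum_subtractf G_def ..
      also have "(\<Sum>i\<in>UNIV. r i / t) = 0"
        using r by (simp flip: sum_divide_distrib)
      also have "(\<Sum>i\<in>UNIV. if x i = Infty then r i / t else 0) = (\<Sum>i | x i = Infty. r i) / t"
        by (simp add: sum.If_cases sum_divide_distrib)
      finally show ?case by simp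
    qed
  qed
  show "(\<lambda>t. jac y t * f (loc y t)) analytic_on {0}" if y: "y \<notin> range x"
  proof (cases y)
    case (Aff b)
    have "(\<lambda>t. \<Sum>i\<in>UNIV. log_basis (x i) (Aff (b + t)) * r i) analytic_on {0}"
      using y Aff by (intro analytic_intros log_basis_analytic) (metis rangeI)
    then show ?thesis using Aff by (simp add: f_def)
  next
    case Infty
    have "{i. x i = Infty} = {}" using y Infty by (metis (mono_tags, lifting) Collect_empty_eq rangeI)
    then have "\<forall>\<^sub>F t in at 0. jac Infty t * f (loc Infty t) = G t"
      using G_eq by simp
    moreover have "jac Infty 0 * f (loc Infty 0) = G 0"
      unfolding f_def G_def by (simp, intro sum.cong refl) (auto split: cp1.splits)
    ultimately have "\<forall>\<^sub>F t in nhds 0. jac Infty t * f (loc Infty t) = G t"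
      by (auto simp: eventually_at_filter elim!: eventually_mono)
    then show ?thesis using G_an analytic_at_cong Infty by fast
  qed
  show "\<exists>h. h analytic_on {0} \<and> h 0 = r k \<and> (\<forall>\<^sub>F t in at 0. t * (jac (x k) t * f (loc (x k) t)) = h t)"
  proof (cases "x k")
    case (Aff b)
    let ?h = "\<lambda>t. r k + t * (\<Sum>i\<in>UNIV - {k}. log_basis (x i) (Aff (b + t)) * r i)"
    have "?h analytic_on {0}"
      using x Aff by (intro analytic_intros log_basis_analytic) (metis DiffE insertI1 injD)
    moreover have "\<forall>\<^sub>F t in at 0. t * (jac (x k) t * f (loc (x k) t)) = ?h t"
      using eventually_neq_at_within[of 0]
    proof eventually_elim
      case (elim t)
      have "f (Aff (b + t)) = r k / t + (\<Sum>i\<in>UNIV - {k}. log_basis (x i) (Aff (b + t)) * r i)"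
        unfolding f_def using Aff by (subst sum.remove[of _ k]) auto
      then show ?case using Aff elim by (simp add: distrib_left)
    qed
    ultimately show ?thesis by (intro exI[of _ ?h]) simp
  next
    case Infty
    have set: "{i. x i = Infty} = {k}" using x Infty by (auto simp: inj_def)
    let ?h = "\<lambda>t. r k + t * G t"
    have "?h analytic_on {0}" by (intro analytic_intros G_an)
    moreover have "\<forall>\<^sub>F t in at 0. t * (jac (x k) t * f (loc (x k) t)) = ?h t"
      using G_eq eventually_neq_at_within[of 0]
    proof eventually_elim
      case (elim t)
      then show ?case using Infty by (simp only: set) (simp add: distrib_left)
    qed
    ultimately show ?thesis by (intro exI[of _ ?h]) simp
  qed
qed

section \<open>Lines in the plane\<close>

definition det2 :: "complex ^ 2 \<Rightarrow> complex ^ 2 \<Rightarrow> complex" where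
  "det2 v w = v $ 1 * w $ 2 - v $ 2 * w $ 1"

lemma det2_self [simp]: "det2 v v = 0" and det2_zero [simp]: "det2 v 0 = 0" "det2 0 v = 0"
  by (simp_all add: det2_def)

lemma det2_smult [simp]: "det2 (a *s v) w = a * det2 v w" "det2 v (a *s w) = a * det2 v w"
  by (simp_all add: det2_def algebra_simps)

lemma det2_swap: "det2 v w = - det2 w v"
  by (simp add: det2_def)

lemma span_single: "vec.span {v} = {c *s v | c. True}"
  by (auto simp: vec.span_singleton)

lemma is_line_span: "v \<noteq> 0 \<Longrightarrow> is_line (vec.span {v :: complex ^ 2})"
  unfolding is_line_def using vec.dim_eq_card_independent[of "{v}"] by (simp add: vec.dim_span)

lemma is_lineE:
  assumes "is_line W"
  obtains v where "v \<noteq> 0" "W = vec.span {v}"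
proof -
  obtain B where B: "B \<subseteq> W" "vec.independent B" "W \<subseteq> vec.span B" "card B = 1"
    using assms vec.basis_exists[of W] by (auto simp: is_line_def)
  then obtain v where "B = {v}" using card_1_singletonE by blast
  then show thesis
    using that[of v] B assms vec.span_minimal[of B W]
    by (auto simp: is_line_def dest: vec.dependent_zero)
qed

lemma span_single_eq:
  assumes "w \<in> vec.span {v}" "w \<noteq> (0 :: complex ^ 2)"
  shows "vec.span {w} = vec.span {v}"
proof -
  obtain c where c: "w = c *s v" using assms by (auto simp: span_single)
  with assms have "c \<noteq> 0" by auto
  then have "v = inverse c *s w" by (simp add: c vec_eq_iff)
  then have "v \<in> vec.span {w}" using span_single by blast
  with assms(1) show ?thesis
    by (intro antisym vec.span_minimal) auto
qed

lemma is_line_eq_span: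
  assumes "is_line W" "v \<in> W" "v \<noteq> 0"
  shows "W = vec.span {v}"
  using assms span_single_eq by (metis is_lineE)

lemma in_span_iff_det2:
  assumes "v \<noteq> 0"
  shows "w \<in> vec.span {v} \<longleftrightarrow> det2 w v = 0"
proof
  assume 0: "det2 w v = 0"
  obtain i where i: "v $ i \<noteq> 0" using assms by (auto simp: vec_eq_iff)
  have "w = (w $ i / v $ i) *s v"
    using 0 i exhaust_2[of i] by (auto simp: vec_eq_iff forall_2 det2_def field_simps)
  then show "w \<in> vec.span {v}" by (auto simp: span_single)
qed (auto simp: span_single)

lemma span_inter_span:
  assumes "v \<noteq> 0" "w \<noteq> 0" "det2 v w \<noteq> 0"
  shows "vec.span {v} \<inter> vec.span {w} = {0}"
proof -
  have "u = 0" if "u \<in> vec.span {v}" "u \<in> vec.span {w}" for u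
    using that assms unfolding in_span_iff_det2[OF assms(2)] by (auto simp: span_single)
  then show ?thesis by (auto intro: vec.span_zero)
qed


section \<open>Degrees of line bundles\<close>

lemma loc_0 [simp]: "loc x 0 = x"
  by (cases x) auto

lemma open_cp1_eventually: "open_cp1 U \<Longrightarrow> x \<in> U \<Longrightarrow> \<forall>\<^sub>F t in nhds 0. loc x t \<in> U"
  by (simp add: open_cp1_def)

text \<open>
  The degree is well defined: the quotient \<open>f\<close> of two meromorphic sections is a meromorphic function on
  the projective line, whose divisor has degree zero.
\<close>

lemma line_degree_eqI:
  fixes F :: "(cp1 set \<times> (cp1 \<Rightarrow> complex ^ 'k)) set"
  assumes sec: "section_divisor F s m"
    and cover: "\<And>x. \<exists>U t. (U, t) \<in> F \<and> x \<in> U"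
    and F: "\<And>U t. (U, t) \<in> F \<Longrightarrow> open_cp1 U" "\<And>U t x. (U, t) \<in> F \<Longrightarrow> x \<in> U \<Longrightarrow> t x \<noteq> 0"
  shows "line_degree F = (\<Sum>x | m x \<noteq> 0. m x)"
  unfolding line_degree_def
proof (rule the_equality)
  show "\<exists>s' m'. section_divisor F s' m' \<and> (\<Sum>x | m x \<noteq> 0. m x) = (\<Sum>x | m' x \<noteq> 0. m' x)"
    using sec by blast
next
  fix d assume "\<exists>s m. section_divisor F s m \<and> d = (\<Sum>x | m x \<noteq> 0. m x)"
  then obtain s' m' where sec': "section_divisor F s' m'" and d: "d = (\<Sum>x | m' x \<noteq> 0. m' x)"
    by blast
  \<comment> \<open>Any nonzero component of \<open>s y\<close> gives the ratio; a choice is made to have one global function.\<close>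
  define f where "f = (\<lambda>y. if s y = 0 then 0 else
    s' y $ (SOME i. s y $ i \<noteq> 0) / s y $ (SOME i. s y $ i \<noteq> 0))"
  have f_eq: "f y = b / a" if "s y = a *s v" "s' y = b *s v" "v \<noteq> 0" for y a b v
  proof (cases "s y = 0")
    case True
    then have "a = 0" using that by simp
    then show ?thesis using True by (simp add: f_def)
  next
    case False
    then have ex: "\<exists>i. s y $ i \<noteq> 0" by (auto simp: vec_eq_iff)
    define i where "i = (SOME i. s y $ i \<noteq> 0)"
    have "s y $ i \<noteq> 0" unfolding i_def by (rule someI_ex[OF ex])
    moreover have "f y = s' y $ i / s y $ i" using False by (simp add: f_def i_def)
    ultimately show ?thesis using that by simp
  qed
  let ?m = "\<lambda>x. m' x - m x"
  have fin: "finite {x. m x \<noteq> 0}" "finite {x. m' x \<noteq> 0}"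
    using sec sec' by (auto simp: section_divisor_def)
  have loc: "(f \<circ> loc x) meromorphic_on {0} \<and> (\<forall>\<^sub>F t in at 0. f (loc x t) \<noteq> 0) \<and>
      zorder (f \<circ> loc x) 0 = ?m x" for x
  proof -
    obtain U t where U: "(U, t) \<in> F" "x \<in> U" using cover by blast
    obtain h where h: "\<And>y. y \<in> U \<Longrightarrow> s y = h y *s t y" "(h \<circ> loc x) meromorphic_on {0}"
      "\<forall>\<^sub>F u in at 0. (h \<circ> loc x) u \<noteq> 0" "zorder (h \<circ> loc x) 0 = m x"
      using sec U unfolding section_divisor_def by fastforce
    obtain h' where h': "\<And>y. y \<in> U \<Longrightarrow> s' y = h' y *s t y" "(h' \<circ> loc x) meromorphic_on {0}"
      "\<forall>\<^sub>F u in at 0. (h' \<circ> loc x) u \<noteq> 0" "zorder (h' \<circ> loc x) 0 = m' x"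
      using sec' U unfolding section_divisor_def by fastforce
    have "f y = h' y / h y" if "y \<in> U" for y
      using f_eq[OF h(1) h'(1)] F(2)[OF U(1)] that by blast
    then have ev: "\<forall>\<^sub>F u in nhds 0. (f \<circ> loc x) u = (h' \<circ> loc x) u / (h \<circ> loc x) u"
      using open_cp1_eventually[OF F(1)[OF U(1)] U(2)] by (auto elim!: eventually_mono)
    then have ev': "\<forall>\<^sub>F u in at 0. (f \<circ> loc x) u = (h' \<circ> loc x) u / (h \<circ> loc x) u"
      by (auto simp: eventually_at_filter elim: eventually_mono)
    have "(\<lambda>u. (h' \<circ> loc x) u / (h \<circ> loc x) u) meromorphic_on {0}"
      by (intro meromorphic_intros h h')
    moreover have "(f \<circ> loc x) meromorphic_on {0} \<longleftrightarrow> (\<lambda>u. (h' \<circ> loc x) u / (h \<circ> loc x) u) meromorphic_on {0}"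
      by (rule meromorphic_on_cong) (use ev' in auto)
    moreover have "\<forall>\<^sub>F u in at 0. (f \<circ> loc x) u \<noteq> 0"
      using ev' h(3) h'(3) by eventually_elim simp
    moreover have "zorder (f \<circ> loc x) 0 = zorder (\<lambda>u. (h' \<circ> loc x) u / (h \<circ> loc x) u) 0"
      by (rule zorder_cong[OF ev' refl])
    moreover have "\<dots> = m' x - m x"
      unfolding zorder_divide[OF h'(2) eventually_frequently[OF at_neq_bot h'(3)]
          h(2) eventually_frequently[OF at_neq_bot h(3)]] h(4) h'(4) ..
    ultimately show ?thesis by simp
  qed
  have "(\<Sum>x | ?m x \<noteq> 0. ?m x) = 0"
  proof (rule sum_zorder_cp1[of _ f])
    show "finite {x. ?m x \<noteq> 0}" by (rule finite_subset[of _ "{x. m x \<noteq> 0} \<union> {x. m' x \<noteq> 0}"]) (use fin in auto)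
  qed (use loc in auto)
  also have "(\<Sum>x | ?m x \<noteq> 0. ?m x) = (\<Sum>x\<in>{x. m x \<noteq> 0} \<union> {x. m' x \<noteq> 0}. ?m x)"
    by (rule sum.mono_neutral_left) (use fin in auto)
  also have "\<dots> = (\<Sum>x\<in>{x. m x \<noteq> 0} \<union> {x. m' x \<noteq> 0}. m' x) - (\<Sum>x\<in>{x. m x \<noteq> 0} \<union> {x. m' x \<noteq> 0}. m x)"
    by (rule sum_subtractf)
  also have "(\<Sum>x\<in>{x. m x \<noteq> 0} \<union> {x. m' x \<noteq> 0}. m' x) = d"
    unfolding d by (rule sum.mono_neutral_right) (use fin in auto)
  also have "(\<Sum>x\<in>{x. m x \<noteq> 0} \<union> {x. m' x \<noteq> 0}. m x) = (\<Sum>x | m x \<noteq> 0. m x)"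
    by (rule sum.mono_neutral_right) (use fin in auto)
  finally show "d = (\<Sum>x | m x \<noteq> 0. m x)" by simp
qed

lemma line_degree_0I:
  fixes F :: "(cp1 set \<times> (cp1 \<Rightarrow> complex ^ 'k)) set"
  assumes sec: "\<And>U t. (U, t) \<in> F \<Longrightarrow>
      \<exists>h. \<forall>x\<in>U. s x = h x *s t x \<and> (h \<circ> loc x) analytic_on {0} \<and> h x \<noteq> 0"
    and cover: "\<And>x. \<exists>U t. (U, t) \<in> F \<and> x \<in> U"
    and F: "\<And>U t. (U, t) \<in> F \<Longrightarrow> open_cp1 U" "\<And>U t x. (U, t) \<in> F \<Longrightarrow> x \<in> U \<Longrightarrow> t x \<noteq> 0"
  shows "line_degree F = 0"
proof -
  have "(h \<circ> loc x) meromorphic_on {0} \<and> (\<forall>\<^sub>F u in at 0. h (loc x u) \<noteq> 0) \<and> zorder (h \<circ> loc x) 0 = 0"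
    if "(h \<circ> loc x) analytic_on {0}" "h x \<noteq> 0" for h :: "cp1 \<Rightarrow> complex" and x
  proof -
    have "((h \<circ> loc x) \<longlongrightarrow> h x) (at 0)"
      using analytic_at_imp_isCont[OF that(1)] by (simp add: isCont_def)
    then have "\<forall>\<^sub>F u in at 0. (h \<circ> loc x) u \<noteq> 0"
      using that(2) by (rule tendsto_imp_eventually_ne)
    then show ?thesis
      using that by (auto intro!: analytic_on_imp_meromorphic_on zorder_eq_0I)
  qed
  then have an0: "(h \<circ> loc x) meromorphic_on {0}" "\<forall>\<^sub>F u in at 0. h (loc x u) \<noteq> 0" "zorder (h \<circ> loc x) 0 = 0"
    if "(h \<circ> loc x) analytic_on {0}" "h x \<noteq> 0" for h :: "cp1 \<Rightarrow> complex" and x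
    using that by blast+
  have "section_divisor F s (\<lambda>x. 0)"
    unfolding section_divisor_def
  proof (intro conjI ballI, simp, clarify)
    fix U t assume "(U, t) \<in> F"
    from sec[OF this] obtain h where
      "\<And>x. x \<in> U \<Longrightarrow> s x = h x *s t x \<and> (h \<circ> loc x) analytic_on {0} \<and> h x \<noteq> 0" by blast
    then show "\<exists>h. \<forall>x\<in>U. s x = h x *s t x \<and> (h \<circ> loc x) meromorphic_on {0} \<and>
        (\<forall>\<^sub>F u in at 0. h (loc x u) \<noteq> 0) \<and> zorder (h \<circ> loc x) 0 = 0"
      using an0[of h] by (intro exI[of _ h]) auto
  qed
  have "line_degree F = (\<Sum>x\<in>{x::cp1. (0::int) \<noteq> 0}. 0)"
    by (rule line_degree_eqI[OF \<open>section_divisor F s (\<lambda>x. 0)\<close>]) (use cover F in auto)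
  then show ?thesis by simp
qed

text \<open>
  This compares two holomorphic frames of the same line bundle: any component in which \<open>b\<close> does not
  vanish expresses the factor as a quotient.
\<close>

lemma analytic_proportion:
  fixes a b :: "complex \<Rightarrow> complex ^ 'k"
  assumes "\<And>i. (\<lambda>u. a u $ i) analytic_on {0}" "\<And>i. (\<lambda>u. b u $ i) analytic_on {0}"
    and "\<forall>\<^sub>F u in nhds 0. a u = c u *s b u" "a 0 \<noteq> 0"
  shows "c analytic_on {0}" "c 0 \<noteq> 0"
proof -
  have eq0: "a 0 = c 0 *s b 0" using eventually_nhds_x_imp_x[OF assms(3)] .
  with assms(4) show "c 0 \<noteq> 0" by auto
  from eq0 assms(4) have "b 0 \<noteq> 0" by auto
  then obtain i where i: "b 0 $ i \<noteq> 0" by (auto simp: vec_eq_iff)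
  have "(\<lambda>u. a u $ i / b u $ i) analytic_on {0}"
    using i by (intro analytic_intros assms) auto
  moreover have "\<forall>\<^sub>F u in nhds 0. a u $ i / b u $ i = c u"
  proof -
    have "\<forall>\<^sub>F u in nhds 0. b u $ i \<noteq> 0"
      using analytic_at_imp_isCont[OF assms(2)[of i]] i
      by (intro tendsto_imp_eventually_ne[of _ "b 0 $ i"]) (auto simp: isCont_def tendsto_nhds_iff)
    then show ?thesis using assms(3) by eventually_elim simp
  qed
  ultimately show "c analytic_on {0}" using analytic_at_cong by fast
qed

lemma open_Collect_eventually_nhds: "open {a :: 'a::topological_space. \<forall>\<^sub>F z in nhds a. P z}"
proof (subst open_subopen, intro ballI)
  fix a assume "a \<in> {a. \<forall>\<^sub>F z in nhds a. P z}"
  then obtain S where "open S" "a \<in> S" "\<forall>x\<in>S. P x" by (auto simp: eventually_nhds)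
  then show "\<exists>S. open S \<and> a \<in> S \<and> S \<subseteq> {a. \<forall>\<^sub>F z in nhds a. P z}"
    by (intro exI[of _ S]) (auto simp: eventually_nhds)
qed

text \<open>
  The points of the affine line near which all points belong to \<open>Z\<close> form an open and closed set \<open>T\<close>,
  which is empty or everything by connectedness.  If it is empty, \<open>Z\<close> has no accumulation point, and
  none at \<open>Infty\<close> either, so that its affine part is bounded, hence finite.
\<close>

lemma cp1_identity_principle:
  assumes D: "\<And>x. (\<forall>\<^sub>F u in nhds 0. loc x u \<in> Z) \<or> (\<forall>\<^sub>F u in at 0. loc x u \<notin> Z)"
  shows "Z = UNIV \<or> finite Z"
proof -
  define P where "P = (\<lambda>z. Aff z \<in> Z)"
  have DP: "(\<forall>\<^sub>F z in nhds a. P z) \<or> (\<forall>\<^sub>F z in at a. \<not> P z)" for a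
    using D[of "Aff a"] by (simp add: P_def nhds_to_0'[of a] at_to_0'[of a] eventually_filtermap add.commute)
  define T where "T = {a. \<forall>\<^sub>F z in nhds a. P z}"
  have "open T"
    unfolding T_def by (rule open_Collect_eventually_nhds)
  moreover have "open (- T)"
  proof (subst open_subopen, intro ballI)
    fix a assume "a \<in> - T"
    then have "\<forall>\<^sub>F z in at a. \<not> P z" using DP by (auto simp: T_def)
    then obtain S where S: "open S" "a \<in> S" "\<And>z. z \<in> S \<Longrightarrow> z \<noteq> a \<Longrightarrow> \<not> P z"
      by (auto simp: eventually_at_topological)
    have "z \<notin> T" if "z \<in> S" for z
    proof (cases "z = a")
      case False
      then show ?thesis using S(3)[of z] that by (auto simp: T_def dest: eventually_nhds_x_imp_x)
    qed (use \<open>a \<in> - T\<close> in auto)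
    then show "\<exists>S. open S \<and> a \<in> S \<and> S \<subseteq> - T" using S by blast
  qed
  ultimately have "T = {} \<or> T = UNIV"
    using connected_UNIV connected_clopen[of "UNIV :: complex set"] by (auto simp: closed_open)
  then show ?thesis
  proof
    assume T: "T = UNIV"
    then have all: "P z" for z by (auto simp: T_def dest: eventually_nhds_x_imp_x)
    have "Infty \<in> Z"
    proof (rule ccontr)
      assume "Infty \<notin> Z"
      then have "\<not> (\<forall>\<^sub>F u in nhds 0. loc Infty u \<in> Z)"
        by (auto dest: eventually_nhds_x_imp_x)
      then have "\<forall>\<^sub>F u in at 0. loc Infty u \<notin> Z" using D by blast
      then have "\<forall>\<^sub>F u in at (0::complex). False"
        using eventually_neq_at_within[of 0] by eventually_elim (use all in \<open>auto simp: P_def\<close>)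
      then show False by simp
    qed
    then have "x \<in> Z" for x using all by (cases x) (auto simp: P_def)
    then show ?thesis by blast
  next
    assume T: "T = {}"
    then have iso: "\<forall>\<^sub>F z in at a. \<not> P z" for a using DP[of a] by (auto simp: T_def)
    have "\<forall>\<^sub>F u in at 0. loc Infty u \<notin> Z"
    proof (rule ccontr)
      assume "\<not> ?thesis"
      then have "\<forall>\<^sub>F u in nhds 0. loc Infty u \<in> Z" using D by blast
      then obtain S where S: "open S" "0 \<in> S" "\<And>u. u \<in> S \<Longrightarrow> loc Infty u \<in> Z"
        by (auto simp: eventually_nhds)
      have "\<forall>\<^sub>F u in at 0. u \<in> S" using S by (auto simp: eventually_at_topological)
      then have "\<forall>\<^sub>F u in at (0::complex). u \<in> S \<and> u \<noteq> 0"
        using eventually_neq_at_within[of 0] by eventually_elim auto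
      then obtain u where u: "u \<in> S" "u \<noteq> 0"
        using eventually_happens[of _ "at (0::complex)"] by auto
      have "(inverse \<longlongrightarrow> inverse (inverse u)) (nhds (inverse u))"
        using u by (intro tendsto_inverse filterlim_ident) auto
      then have "\<forall>\<^sub>F z in nhds (inverse u). inverse z \<in> S"
        using S(1) u(1) by (simp add: topological_tendstoD)
      moreover have "\<forall>\<^sub>F z in nhds (inverse u). z \<noteq> 0"
        using u(2) t1_space_nhds[of "inverse u" 0] by (auto simp: eventually_nhds_conv_at)
      ultimately have "\<forall>\<^sub>F z in nhds (inverse u). P z"
      proof eventually_elim
        case (elim z)
        then show ?case using S(3)[of "inverse z"] by (simp add: P_def inverse_eq_divide)
      qed
      then have "inverse u \<in> T" by (simp add: T_def)
      with T show False by simp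
    qed
    then obtain e where e: "e > 0" "\<And>u. u \<noteq> 0 \<Longrightarrow> norm u < e \<Longrightarrow> loc Infty u \<notin> Z"
      by (auto simp: eventually_at dist_norm)
    have "norm z \<le> inverse e" if "P z" for z
    proof (rule ccontr)
      assume "\<not> norm z \<le> inverse e"
      then have z: "norm z > inverse e" "z \<noteq> 0" using e(1) by auto
      then have "norm (inverse z) < e"
        using less_imp_inverse_less[OF z(1)] e(1) by (simp add: norm_inverse)
      then show False using e(2)[of "inverse z"] z that by (simp add: P_def inverse_eq_divide)
    qed
    then have "bounded {z. P z}" by (auto simp: bounded_iff)
    have "finite {z. P z}"
    proof (rule ccontr)
      assume "infinite {z. P z}"
      then obtain a where "a islimpt {z. P z}"
        using \<open>bounded {z. P z}\<close> bounded_infinite_imp_islimpt by blast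
      then show False using iso[of a] by (auto simp: islimpt_iff_eventually)
    qed
    moreover have "Z \<subseteq> insert Infty (Aff ` {z. P z})"
    proof
      fix x assume "x \<in> Z" then show "x \<in> insert Infty (Aff ` {z. P z})"
        by (cases x) (auto simp: P_def)
    qed
    ultimately show ?thesis by (metis finite.insertI finite_imageI finite_subset)
  qed
qed


section \<open>Line subbundles of the trivial bundle\<close>

lemma matrix_inv_mat_1 [simp]: "matrix_inv (mat 1 :: complex ^ 2 ^ 2) = mat 1"
proof -
  have "matrix_inv (mat 1) ** mat 1 = (mat 1 :: complex ^ 2 ^ 2)"
    unfolding matrix_inv_def by (rule someI2[of _ "mat 1"]) auto
  then show ?thesis by simp
qed

lemma hol_section_trivial: "hol_section trivial_bundle U s \<longleftrightarrow> hol_vec_cp1 U s"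
  by (simp add: hol_section_def trivial_bundle_def)

text \<open>
  Choose a vector \<open>w\<close> outside the fibre \<open>L Infty\<close> and let \<open>s\<close> be the meromorphic section of \<open>L\<close> with
  \<open>det2 w s = 1\<close>.  It has no zeros, and its poles are the points where the fibre contains \<open>w\<close>, which are
  finitely many by the identity principle.  So the degree is minus the number of poles, counted
  with multiplicity.  If there is none, \<open>s\<close> is a holomorphic map to \<open>\<complex>\<^sup>2\<close> on the projective line, hence constant.
\<close>

lemma trivial_subbundle_degree:
  assumes L: "line_subbundle trivial_bundle L"
  shows "subbundle_degree trivial_bundle L \<le> 0"
    and "subbundle_degree trivial_bundle L = 0 \<Longrightarrow> \<exists>v. v \<noteq> 0 \<and> (\<forall>x. L x = vec.span {v})"
proof -
  let ?F = "sub_frames trivial_bundle L"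
  have line: "is_line (L x)" for x using L by (simp add: line_subbundle_def)
  have ex: "\<exists>U t. (U, t) \<in> ?F \<and> x \<in> U" for x
    using L unfolding line_subbundle_def by fastforce
  have F: "open_cp1 U" "\<And>x i. x \<in> U \<Longrightarrow> (\<lambda>u. t (loc x u) $ i) analytic_on {0}"
    "\<And>x. x \<in> U \<Longrightarrow> t x \<noteq> 0" "\<And>x. x \<in> U \<Longrightarrow> t x \<in> L x"
    if "(U, t) \<in> ?F" for U and t :: "cp1 \<Rightarrow> complex ^ 2"
    using that by (auto simp: sub_frames_def hol_section_trivial hol_vec_cp1_def hol_cp1_def o_def)
  have span: "L x = vec.span {t x}" if "(U, t) \<in> ?F" "x \<in> U" for U t x
    using is_line_eq_span[OF line] F(3,4)[OF that(1)] that(2) by blast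
  obtain w where w: "w \<notin> L Infty"
  proof -
    obtain v where v: "v \<noteq> 0" "L Infty = vec.span {v}" using line is_lineE by blast
    obtain i where i: "v $ i \<noteq> 0" using v(1) by (auto simp: vec_eq_iff)
    have "det2 (axis 1 1) v \<noteq> 0 \<or> det2 (axis 2 1) v \<noteq> 0"
      using i exhaust_2[of i] by (auto simp: det2_def axis_def)
    then show thesis using that v in_span_iff_det2[OF v(1)] by blast
  qed
  have w0: "w \<noteq> 0" using w line[of Infty] by (auto simp: is_line_def vec.subspace_0)
  define Z where "Z = {x. w \<in> L x}"
  have Z_iff: "x \<in> Z \<longleftrightarrow> det2 w (t x) = 0" if "(U, t) \<in> ?F" "x \<in> U" for U t x
    using in_span_iff_det2[OF F(3)[OF that]] span[OF that] by (simp add: Z_def)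
  have an: "(\<lambda>u. det2 w (t (loc x u))) analytic_on {0}" if "(U, t) \<in> ?F" "x \<in> U" for U t x
    unfolding det2_def by (intro analytic_intros F(2)[OF that])
  have D: "(\<forall>\<^sub>F u in nhds 0. loc x u \<in> Z) \<or> (\<forall>\<^sub>F u in at 0. loc x u \<notin> Z)" for x
  proof -
    obtain U t where U: "(U, t) \<in> ?F" "x \<in> U" using ex by blast
    have inU: "\<forall>\<^sub>F u in nhds 0. loc x u \<in> U" by (rule open_cp1_eventually[OF F(1)[OF U(1)] U(2)])
    show ?thesis
    proof (cases "\<forall>\<^sub>F u in at 0. det2 w (t (loc x u)) \<noteq> 0")
      case True
      moreover have "\<forall>\<^sub>F u in at 0. loc x u \<in> U" using inU by (simp add: eventually_nhds_conv_at)
      ultimately have "\<forall>\<^sub>F u in at 0. loc x u \<notin> Z"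
        by eventually_elim (simp add: Z_iff[OF U(1)])
      then show ?thesis by blast
    next
      case False
      then have "\<forall>\<^sub>F u in at 0. det2 w (t (loc x u)) = 0"
        using an[OF U] not_essential_frequently_0_imp_eventually_0[of "\<lambda>u. det2 w (t (loc x u))" 0]
        by (simp add: frequently_def analytic_on_imp_meromorphic_on isolated_singularity_at_analytic not_essential_analytic)
      then have "\<forall>\<^sub>F u in nhds 0. det2 w (t (loc x u)) = 0"
        using tendsto_unique[of "at 0" "\<lambda>u. det2 w (t (loc x u))" 0 "det2 w (t (loc x 0))"]
          analytic_at_imp_isCont[OF an[OF U]]
        by (auto simp: eventually_nhds_conv_at isCont_def intro: tendsto_eventually)
      then have "\<forall>\<^sub>F u in nhds 0. loc x u \<in> Z"
        using inU by eventually_elim (simp add: Z_iff[OF U(1)])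
      then show ?thesis by blast
    qed
  qed
  have "finite Z"
    using cp1_identity_principle[of Z, OF D] w by (auto simp: Z_def)
  have punct: "\<forall>\<^sub>F u in at 0. loc x u \<notin> Z" for x
  proof (rule ccontr)
    assume "\<not> ?thesis"
    then have ev: "\<forall>\<^sub>F u in nhds 0. loc x u \<in> Z" using D by blast
    then obtain e where e: "e > 0" "\<And>u. norm u < e \<Longrightarrow> loc x u \<in> Z"
      by (auto simp: eventually_nhds_metric dist_norm)
    have "inj (loc x)"
      by (cases x) (auto simp: inj_on_def split: if_splits)
    then have "inj_on (loc x) (ball 0 e)" using inj_on_subset by blast
    moreover have "loc x ` ball 0 e \<subseteq> Z" using e(2) by auto
    ultimately have "finite (ball (0::complex) e)"
      using \<open>finite Z\<close> finite_subset finite_imageD by blast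
    then show False
      using e(1) islimpt_UNIV[of "0::complex"] by (auto simp: islimpt_eq_infinite_ball)
  qed
  have "\<exists>Ut. Ut \<in> ?F \<and> x \<in> fst Ut" for x using ex[of x] by force
  then obtain Ut where Ut: "\<And>x. Ut x \<in> ?F" "\<And>x. x \<in> fst (Ut x)" by metis
  define V where "V = (\<lambda>x. fst (Ut x))"
  define \<tau> where "\<tau> = (\<lambda>x. snd (Ut x))"
  have V: "(V x, \<tau> x) \<in> ?F" "x \<in> V x" for x
    using Ut by (simp_all add: V_def \<tau>_def)
  have nz: "\<forall>\<^sub>F u in at 0. det2 w (t (loc x u)) \<noteq> 0" if "(U, t) \<in> ?F" "x \<in> U" for U t x
  proof -
    have "\<forall>\<^sub>F u in at 0. loc x u \<in> U"
      using open_cp1_eventually[OF F(1)[OF that(1)] that(2)] by (simp add: eventually_nhds_conv_at)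
    with punct[of x] show ?thesis
      by eventually_elim (simp add: Z_iff[OF that(1)])
  qed
  define ord where "ord = (\<lambda>x. zorder (\<lambda>u. det2 w (\<tau> x (loc x u))) 0)"
  \<comment> \<open>Two frames differ by a nowhere vanishing holomorphic factor \<open>c\<close>.\<close>
  have ord_eq: "zorder (\<lambda>u. det2 w (t (loc x u))) 0 = ord x" if U: "(U, t) \<in> ?F" "x \<in> U" for U t x
  proof -
    define c where "c = (\<lambda>u. SOME a. t (loc x u) = a *s \<tau> x (loc x u))"
    have "\<forall>\<^sub>F u in nhds 0. t (loc x u) = c u *s \<tau> x (loc x u)"
      using open_cp1_eventually[OF F(1)[OF U(1)] U(2)] open_cp1_eventually[OF F(1)[OF V(1)[of x]] V(2)[of x]]
    proof eventually_elim
      case (elim u)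
      then have "t (loc x u) \<in> vec.span {\<tau> x (loc x u)}"
        using F(4)[OF U(1)] span[OF V(1)] by blast
      then have "\<exists>a. t (loc x u) = a *s \<tau> x (loc x u)" by (auto simp: span_single)
      then show ?case unfolding c_def by (rule someI_ex)
    qed
    moreover from this have c: "c analytic_on {0}" "c 0 \<noteq> 0"
      using analytic_proportion[of "\<lambda>u. t (loc x u)" "\<lambda>u. \<tau> x (loc x u)" c]
        F(2)[OF U] F(2)[OF V(1)[of x] V(2)[of x]] F(3)[OF U]
      by auto
    ultimately have "\<forall>\<^sub>F u in at 0. det2 w (t (loc x u)) = c u * det2 w (\<tau> x (loc x u))"
      by (auto simp: eventually_at_filter elim!: eventually_mono)
    then have "zorder (\<lambda>u. det2 w (t (loc x u))) 0 = zorder (\<lambda>u. c u * det2 w (\<tau> x (loc x u))) 0"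
      by (rule zorder_cong) simp
    also have "\<dots> = zorder c 0 + ord x"
    proof -
      have "\<forall>\<^sub>F u in at 0. c u \<noteq> 0"
        using analytic_at_imp_isCont[OF c(1)] c(2)
        by (intro tendsto_imp_eventually_ne[of _ "c 0"]) (auto simp: isCont_def)
      then have "\<forall>\<^sub>F u in at 0. c u * det2 w (\<tau> x (loc x u)) \<noteq> 0"
        using nz[OF V] by eventually_elim simp
      then show ?thesis
        unfolding ord_def by (intro zorder_times_analytic c an[OF V])
    qed
    also have "zorder c 0 = 0" using c by (rule zorder_eq_0I)
    finally show ?thesis by simp
  qed
  have ord_nonneg: "ord x \<ge> 0" for x
    unfolding ord_def by (intro zorder_ge_0 an[OF V] eventually_frequently nz[OF V]) simp
  have ord_0_iff: "ord x = 0 \<longleftrightarrow> x \<notin> Z" for x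
    unfolding ord_def Z_iff[OF V]
    using zorder_eq_0_iff[OF an[OF V] eventually_frequently[OF at_neq_bot nz[OF V]]] by simp
  define s where "s = (\<lambda>x. if x \<in> Z then 0 else SOME v. v \<in> L x \<and> det2 w v = 1)"
  have s_eq: "s x = inverse (det2 w (t x)) *s t x" if U: "(U, t) \<in> ?F" "x \<in> U" for U t x
  proof (cases "x \<in> Z")
    case True
    then show ?thesis using Z_iff[OF U] by (simp add: s_def)
  next
    case False
    have "(SOME v. v \<in> L x \<and> det2 w v = 1) = inverse (det2 w (t x)) *s t x"
    proof (rule some_equality)
      show "inverse (det2 w (t x)) *s t x \<in> L x \<and> det2 w (inverse (det2 w (t x)) *s t x) = 1"
        using False Z_iff[OF U] span[OF U] by (auto simp: span_single)
    next
      fix v assume "v \<in> L x \<and> det2 w v = 1"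
      then have v: "v \<in> vec.span {t x}" "det2 w v = 1" using span[OF U] by auto
      then obtain c where c: "v = c *s t x" unfolding span_single by blast
      with v(2) have "c * det2 w (t x) = 1" by simp
      with c show "v = inverse (det2 w (t x)) *s t x"
        using False Z_iff[OF U] by (simp add: field_simps)
    qed
    then show ?thesis using False by (simp add: s_def)
  qed
  have "section_divisor ?F s (\<lambda>x. - ord x)"
    unfolding section_divisor_def
  proof (intro conjI ballI, goal_cases)
    case 1
    show ?case using \<open>finite Z\<close> by (simp add: ord_0_iff)
  next
    case (2 Ut)
    obtain U t where [simp]: "Ut = (U, t)" by (cases Ut)
    have U: "(U, t) \<in> ?F" using 2 by simp
    have "s x = inverse (det2 w (t x)) *s t x \<and>
      ((\<lambda>x. inverse (det2 w (t x))) \<circ> loc x) meromorphic_on {0} \<and>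
      (\<forall>\<^sub>F u in at 0. inverse (det2 w (t (loc x u))) \<noteq> 0) \<and>
      zorder ((\<lambda>x. inverse (det2 w (t x))) \<circ> loc x) 0 = - ord x" if x: "x \<in> U" for x
    proof -
      have m: "(\<lambda>u. det2 w (t (loc x u))) meromorphic_on {0}"
        by (intro analytic_on_imp_meromorphic_on an[OF U x])
      have "zorder (\<lambda>u. det2 w (t (loc x u)) powi (- 1)) 0 = - 1 * ord x"
        unfolding ord_eq[OF U x, symmetric]
        by (intro zorder_power_int m eventually_frequently nz[OF U x]) simp
      then show ?thesis
        using s_eq[OF U x] m nz[OF U x] by (auto simp: o_def power_int_minus intro!: meromorphic_intros)
    qed
    then show ?case
      by (auto intro!: exI[of _ "\<lambda>x. inverse (det2 w (t x))"])
  qed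
  then have deg: "subbundle_degree trivial_bundle L = (\<Sum>x | - ord x \<noteq> 0. - ord x)"
    unfolding subbundle_degree_def by (rule line_degree_eqI) (use ex F in auto)
  then show "subbundle_degree trivial_bundle L \<le> 0"
    by (auto intro!: sum_nonpos ord_nonneg)
  assume "subbundle_degree trivial_bundle L = 0"
  then have "(\<Sum>x | ord x \<noteq> 0. ord x) = 0" using deg by (simp add: sum_negf)
  then have "\<forall>x\<in>{x. ord x \<noteq> 0}. ord x = 0"
    using \<open>finite Z\<close> by (subst (asm) sum_nonneg_eq_0_iff) (auto simp: ord_nonneg ord_0_iff)
  then have noZ: "x \<notin> Z" for x using ord_0_iff by blast
  have "hol_cp1 UNIV (\<lambda>x. s x $ i)" for i
    unfolding hol_cp1_def
  proof
    fix x
    have "(\<lambda>u. inverse (det2 w (\<tau> x (loc x u))) * \<tau> x (loc x u) $ i) analytic_on {0}"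
      using noZ[of x] Z_iff[OF V] by (intro analytic_intros an[OF V] F(2)[OF V]) auto
    moreover have "\<forall>\<^sub>F u in nhds 0. inverse (det2 w (\<tau> x (loc x u))) * \<tau> x (loc x u) $ i = ((\<lambda>x. s x $ i) \<circ> loc x) u"
      using open_cp1_eventually[OF F(1)[OF V(1)[of x]] V(2)[of x]] by eventually_elim (simp add: s_eq[OF V(1)])
    ultimately show "((\<lambda>x. s x $ i) \<circ> loc x) analytic_on {0}"
      using analytic_at_cong by fast
  qed
  from hol_cp1_UNIV_constant[OF this] have const: "s x = s Infty" for x
    by (simp add: vec_eq_iff)
  have "s x \<noteq> 0" "s x \<in> L x" for x
    using s_eq[OF V] noZ[of x] Z_iff[OF V] F(3)[OF V] span[OF V] by (auto simp: span_single)
  then have "s Infty \<noteq> 0 \<and> (\<forall>x. L x = vec.span {s Infty})"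
    using is_line_eq_span[OF line] const by metis
  then show "\<exists>v. v \<noteq> 0 \<and> (\<forall>x. L x = vec.span {v})" by blast
qed

section \<open>Matrices of holomorphic functions\<close>

lemma matrix_inv_mult:
  fixes A :: "complex ^ 2 ^ 2"
  assumes "invertible A"
  shows "A ** matrix_inv A = mat 1" "matrix_inv A ** A = mat 1"
proof -
  have "\<exists>B. A ** B = mat 1 \<and> B ** A = mat 1" using assms by (simp add: invertible_def)
  from someI_ex[OF this] show "A ** matrix_inv A = mat 1" "matrix_inv A ** A = mat 1"
    unfolding matrix_inv_def by auto
qed

lemma matrix_inv_eqI:
  fixes A :: "complex ^ 2 ^ 2"
  assumes "A ** B = mat 1"
  shows "matrix_inv A = B"
proof -
  have "invertible A" using assms matrix_left_right_inverse by (auto simp: invertible_def)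
  then have "matrix_inv A ** (A ** B) = B"
    by (simp add: matrix_mul_assoc matrix_inv_mult)
  then show ?thesis by (simp add: assms)
qed

lemma invertible_matrix_inv [simp]:
  fixes A :: "complex ^ 2 ^ 2"
  shows "invertible A \<Longrightarrow> invertible (matrix_inv A)"
  using matrix_inv_mult invertible_def by blast

lemma matrix_inv_matrix_inv [simp]:
  fixes A :: "complex ^ 2 ^ 2"
  shows "invertible A \<Longrightarrow> matrix_inv (matrix_inv A) = A"
  by (rule matrix_inv_eqI) (simp add: matrix_inv_mult)

lemma matrix_inv_prod:
  fixes A B :: "complex ^ 2 ^ 2"
  assumes "invertible A" "invertible B"
  shows "matrix_inv (A ** B) = matrix_inv B ** matrix_inv A"
proof (rule matrix_inv_eqI)
  have "A ** B ** (matrix_inv B ** matrix_inv A) = A ** (B ** matrix_inv B) ** matrix_inv A"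
    by (simp add: matrix_mul_assoc)
  then show "A ** B ** (matrix_inv B ** matrix_inv A) = mat 1"
    by (simp add: assms matrix_inv_mult)
qed

lemma matrix_inv_cancel:
  fixes A :: "complex ^ 2 ^ 2"
  assumes "invertible A"
  shows "A ** (matrix_inv A ** B) = B" "matrix_inv A ** (A ** B) = B"
    "B ** A ** matrix_inv A = B" "B ** matrix_inv A ** A = B"
    "A *v (matrix_inv A *v v) = v" "matrix_inv A *v (A *v v) = v"
  using assms
  by (simp_all add: matrix_mul_assoc matrix_inv_mult matrix_vector_mul_assoc flip: matrix_mul_assoc[of B])

lemma matrix_inv_2:
  fixes A :: "complex ^ 2 ^ 2"
  assumes "det A \<noteq> 0"
  shows "matrix_inv A = (\<chi> i j. (if i = 1 then (if j = 1 then A $ 2 $ 2 else - A $ 1 $ 2)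
    else (if j = 1 then - A $ 2 $ 1 else A $ 1 $ 1)) / det A)"
proof (rule matrix_inv_eqI)
  have "A $ 1 $ 1 * A $ 2 $ 2 - A $ 1 $ 2 * A $ 2 $ 1 = det A" by (simp add: det_2)
  then show "A ** (\<chi> i j. (if i = 1 then (if j = 1 then A $ 2 $ 2 else - A $ 1 $ 2)
      else (if j = 1 then - A $ 2 $ 1 else A $ 1 $ 1)) / det A) = mat 1"
    using assms by (simp add: vec_eq_iff forall_2 matrix_matrix_mult_def sum_2 mat_def field_simps)
qed

definition mat_analytic :: "(complex \<Rightarrow> complex ^ 2 ^ 2) \<Rightarrow> bool" where
  "mat_analytic M \<longleftrightarrow> (\<forall>i j. (\<lambda>u. M u $ i $ j) analytic_on {0})"

lemma hol_mat_cp1_iff: "hol_mat_cp1 U f \<longleftrightarrow> (\<forall>x\<in>U. mat_analytic (\<lambda>u. f (loc x u)))"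
  by (auto simp: hol_mat_cp1_def hol_cp1_def mat_analytic_def o_def)

lemma mat_analytic_const [simp]: "mat_analytic (\<lambda>u. M)"
  by (simp add: mat_analytic_def)

lemma mat_analytic_mult:
  "mat_analytic M \<Longrightarrow> mat_analytic N \<Longrightarrow> mat_analytic (\<lambda>u. M u ** N u)"
  unfolding mat_analytic_def matrix_matrix_mult_def by (auto intro!: analytic_intros)

lemma mat_analytic_cong:
  assumes "mat_analytic M" "\<forall>\<^sub>F u in nhds 0. M u = N u"
  shows "mat_analytic N"
  unfolding mat_analytic_def
proof (intro allI)
  fix i j
  have "\<forall>\<^sub>F u in nhds 0. M u $ i $ j = N u $ i $ j"
    using assms(2) by eventually_elim simp
  then show "(\<lambda>u. N u $ i $ j) analytic_on {0}"
    using assms(1) analytic_at_cong[of "\<lambda>u. M u $ i $ j" "\<lambda>u. N u $ i $ j" 0 0]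
    by (simp add: mat_analytic_def)
qed

lemma mat_analytic_det: "mat_analytic M \<Longrightarrow> (\<lambda>u. det (M u)) analytic_on {0}"
  unfolding det_2 mat_analytic_def by (auto intro!: analytic_intros)

lemma eventually_det_nz:
  assumes "mat_analytic M" "invertible (M 0)"
  shows "\<forall>\<^sub>F u in nhds 0. det (M u) \<noteq> 0"
  using analytic_at_imp_isCont[OF mat_analytic_det[OF assms(1)]] assms(2)
  by (intro tendsto_imp_eventually_ne[of _ "det (M 0)"])
    (auto simp: isCont_def tendsto_nhds_iff invertible_det_nz)

lemma mat_analytic_inv:
  assumes "mat_analytic M" "invertible (M 0)"
  shows "mat_analytic (\<lambda>u. matrix_inv (M u))"
proof (rule mat_analytic_cong)
  let ?N = "\<lambda>u. (\<chi> i j. (if i = 1 then (if j = 1 then M u $ 2 $ 2 else - M u $ 1 $ 2)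
    else (if j = 1 then - M u $ 2 $ 1 else M u $ 1 $ 1)) / det (M u)) :: complex ^ 2 ^ 2"
  have "(\<lambda>u. M u $ i $ j / det (M u)) analytic_on {0}" for i j
    using assms by (intro analytic_intros mat_analytic_det) (auto simp: mat_analytic_def invertible_det_nz)
  moreover have "(\<lambda>u. - (M u $ i $ j / det (M u))) analytic_on {0}" for i j
    by (rule analytic_on_neg) fact
  ultimately show "mat_analytic ?N"
    unfolding mat_analytic_def forall_2 by simp
  show "\<forall>\<^sub>F u in nhds 0. ?N u = matrix_inv (M u)"
    using eventually_det_nz[OF assms] by eventually_elim (simp add: matrix_inv_2)
qed

lemma mat_analytic_mult_vec:
  fixes M :: "complex \<Rightarrow> complex ^ 2 ^ 2" and v :: "complex \<Rightarrow> complex ^ 2"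
  assumes "mat_analytic M" "\<And>i. (\<lambda>u. v u $ i) analytic_on {0}"
  shows "(\<lambda>u. (M u *v v u) $ i) analytic_on {0}"
  using assms unfolding mat_analytic_def matrix_vector_mult_def by (auto intro!: analytic_intros)

lemma scaled_mat_analytic:
  fixes M :: "complex \<Rightarrow> complex ^ 2 ^ 2"
  assumes "\<And>i j. \<exists>h. h analytic_on {0} \<and> (\<forall>\<^sub>F t in at 0. t * M t $ i $ j = h t)"
  obtains h where "mat_analytic h" "\<forall>\<^sub>F t in at 0. \<forall>i j. t * M t $ i $ j = h t $ i $ j"
    "\<And>i j. residue (\<lambda>t. M t $ i $ j) 0 = h 0 $ i $ (j :: 2) "
proof -
  obtain h where h: "\<And>i j. h i j analytic_on {0}" "\<And>i j. \<forall>\<^sub>F t in at 0. t * M t $ i $ j = h i j t"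
    using assms by metis
  let ?h = "\<lambda>t. (\<chi> i j. h i j t) :: complex ^ 2 ^ 2"
  have "\<forall>\<^sub>F t in at 0. \<forall>i\<in>UNIV. \<forall>j\<in>UNIV. t * M t $ i $ j = h i j t"
    by (intro eventually_ball_finite ballI h finite)
  then have "\<forall>\<^sub>F t in at 0. \<forall>i j. t * M t $ i $ j = ?h t $ i $ j" by simp
  then show thesis
    using that[of ?h] h residue_simple_pole_analytic[OF h] by (simp add: mat_analytic_def)
qed


section \<open>Higgs fields on a trivialised bundle\<close>

lemma bundle_isoD:
  assumes "bundle_iso trivial_bundle E \<psi>"
  shows "invertible (\<psi> y)"
    and "(U, g) \<in> E \<Longrightarrow> y \<in> U \<Longrightarrow> mat_analytic (\<lambda>u. matrix_inv (g (loc y u)) ** \<psi> (loc y u))"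
  using assms by (auto simp: bundle_iso_def trivial_bundle_def hol_mat_cp1_iff)

lemma hol_bundleD:
  assumes "hol_bundle E"
  shows "\<exists>U g. (U, g) \<in> E \<and> y \<in> U"
    and "(U, g) \<in> E \<Longrightarrow> open_cp1 U" "(U, g) \<in> E \<Longrightarrow> y \<in> U \<Longrightarrow> invertible (g y)"
    and "(U, g) \<in> E \<Longrightarrow> (V, h) \<in> E \<Longrightarrow> y \<in> U \<Longrightarrow> y \<in> V \<Longrightarrow>
      mat_analytic (\<lambda>u. matrix_inv (g (loc y u)) ** h (loc y u))"
proof -
  have "y \<in> (\<Union>(U, g)\<in>E. U)" using assms by (simp add: hol_bundle_def)
  then show "\<exists>U g. (U, g) \<in> E \<and> y \<in> U" by auto
  show "(U, g) \<in> E \<Longrightarrow> open_cp1 U" "(U, g) \<in> E \<Longrightarrow> y \<in> U \<Longrightarrow> invertible (g y)"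
    using assms by (auto simp: hol_bundle_def)
  have *: "\<forall>Ug\<in>E. \<forall>Vh\<in>E. case Ug of (U, g) \<Rightarrow> case Vh of (V, h) \<Rightarrow>
      hol_mat_cp1 (U \<inter> V) (\<lambda>x. matrix_inv (g x) ** h x)"
    using assms by (auto simp: hol_bundle_def split_beta)
  show "(U, g) \<in> E \<Longrightarrow> (V, h) \<in> E \<Longrightarrow> y \<in> U \<Longrightarrow> y \<in> V \<Longrightarrow>
      mat_analytic (\<lambda>u. matrix_inv (g (loc y u)) ** h (loc y u))"
    using *[rule_format, of "(U, g)" "(V, h)"] by (simp add: hol_mat_cp1_iff)
qed

lemma hol_bundle_trivial: "hol_bundle trivial_bundle"
  by (auto simp: hol_bundle_def trivial_bundle_def open_cp1_def hol_mat_cp1_iff invertible_def)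

lemma bundle_iso_trivial: "invertible P \<Longrightarrow> bundle_iso trivial_bundle trivial_bundle (\<lambda>y. P)"
  by (auto simp: bundle_iso_def trivial_bundle_def hol_mat_cp1_iff)

lemma local_entry_trivial:
  "local_entry (\<lambda>y. mat 1) \<Phi> x i j = (\<lambda>t. jac x t * \<Phi> (loc x t) $ i $ j)"
  by (simp add: local_entry_def)

definition trivial_res :: "(cp1 \<Rightarrow> complex ^ 2 ^ 2) \<Rightarrow> cp1 \<Rightarrow> complex ^ 2 ^ 2" where
  "trivial_res \<Phi> x = (\<chi> i j. residue (\<lambda>t. jac x t * \<Phi> (loc x t) $ i $ j) 0)"

lemma eventually_nhds_imp_at: "eventually P (nhds a) \<Longrightarrow> eventually P (at a)"
  by (simp add: eventually_nhds_conv_at)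

lemma higgs_res_unique:
  assumes "\<And>U g. (U, g) \<in> frames \<H> \<Longrightarrow> x \<in> U \<Longrightarrow>
      N = g x ** (\<chi> i j. residue (local_entry g (field \<H>) x i j) 0) ** matrix_inv (g x)"
    and "\<exists>U g. (U, g) \<in> frames \<H> \<and> x \<in> U"
  shows "higgs_res \<H> x = N"
  unfolding higgs_res_def
proof (rule the_equality)
  show "\<forall>(U, g)\<in>frames \<H>. x \<in> U \<longrightarrow>
      N = g x ** (\<chi> i j. residue (local_entry g (field \<H>) x i j) 0) ** matrix_inv (g x)"
    using assms(1) by blast
  fix N' assume "\<forall>(U, g)\<in>frames \<H>. x \<in> U \<longrightarrow>
      N' = g x ** (\<chi> i j. residue (local_entry g (field \<H>) x i j) 0) ** matrix_inv (g x)"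
  then show "N' = N" using assms by fastforce
qed

lemma higgs_res_trivial:
  assumes "frames \<H> = trivial_bundle"
  shows "higgs_res \<H> x = trivial_res (field \<H>) x"
  by (rule higgs_res_unique) (auto simp: assms trivial_bundle_def local_entry_trivial trivial_res_def)

text \<open>
  A holomorphic trivialisation \<open>\<psi>\<close> turns the Higgs field into a logarithmic form on the trivial bundle
  with conjugate residues.  In a frame \<open>g\<close> near \<open>x\<close> one has \<open>\<psi> = g G\<close> with \<open>G\<close> holomorphic and
  invertible, and the pulled back form is the conjugate by \<open>G\<close> of the local expression.  At a simple
  pole the residue is conjugated by the value of \<open>G\<close>.
\<close>

lemma trivialized_field:
  assumes E: "hol_bundle E" and \<psi>: "bundle_iso trivial_bundle E \<psi>" and \<Phi>: "log_one_form D E \<Phi>"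
  defines "\<Phi>' \<equiv> \<lambda>y. matrix_inv (\<psi> y) ** \<Phi> y ** \<psi> y"
  shows "log_one_form D trivial_bundle \<Phi>'"
    and "x \<in> D \<Longrightarrow> (U, g) \<in> E \<Longrightarrow> x \<in> U \<Longrightarrow>
      g x ** (\<chi> i j. residue (local_entry g \<Phi> x i j) 0) ** matrix_inv (g x) =
      \<psi> x ** trivial_res \<Phi>' x ** matrix_inv (\<psi> x)"
proof -
  have key: "\<exists>G Gi. mat_analytic G \<and> mat_analytic Gi \<and> \<psi> x = g x ** G 0 \<and> invertible (G 0) \<and>
      Gi 0 = matrix_inv (G 0) \<and>
      (\<forall>\<^sub>F u in nhds 0. (\<chi> i j. jac x u * \<Phi>' (loc x u) $ i $ j) =
          Gi u ** (\<chi> i j. local_entry g \<Phi> x i j u) ** G u)"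
    if U: "(U, g) \<in> E" "x \<in> U" for U g x
  proof (intro exI conjI)
    let ?G = "\<lambda>u. matrix_inv (g (loc x u)) ** \<psi> (loc x u)"
    have inv: "invertible (g y)" if "y \<in> U" for y
      using hol_bundleD(3)[OF E U(1) that] .
    show G: "mat_analytic ?G" by (rule bundle_isoD(2)[OF \<psi> U])
    show invG: "invertible (?G 0)"
      by (simp add: invertible_mult inv U bundle_isoD(1)[OF \<psi>])
    show "mat_analytic (\<lambda>u. matrix_inv (?G u))" by (rule mat_analytic_inv[OF G invG])
    show "\<psi> x = g x ** ?G 0" by (simp add: matrix_inv_cancel inv U)
    show "matrix_inv (?G 0) = matrix_inv (?G 0)" ..
    show "\<forall>\<^sub>F u in nhds 0. (\<chi> i j. jac x u * \<Phi>' (loc x u) $ i $ j) =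
          matrix_inv (?G u) ** (\<chi> i j. local_entry g \<Phi> x i j u) ** ?G u"
      using open_cp1_eventually[OF hol_bundleD(2)[OF E U(1)] U(2)]
    proof eventually_elim
      case (elim u)
      let ?y = "loc x u"
      have scale: "(\<chi> i j. jac x u * M $ i $ j) = mat (jac x u) ** M" for M :: "complex ^ 2 ^ 2"
        by (simp add: vec_eq_iff forall_2 matrix_matrix_mult_def sum_2 mat_def)
      have comm: "mat (jac x u) ** M = M ** mat (jac x u)" for M :: "complex ^ 2 ^ 2"
        by (simp add: vec_eq_iff forall_2 matrix_matrix_mult_def sum_2 mat_def)
      note i = inv[OF elim] bundle_isoD(1)[OF \<psi>]
      have "matrix_inv (?G u) ** (mat (jac x u) ** (matrix_inv (g ?y) ** \<Phi> ?y ** g ?y)) ** ?G u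
        = mat (jac x u) ** (matrix_inv (?G u) ** (matrix_inv (g ?y) ** \<Phi> ?y ** g ?y) ** ?G u)"
        using comm[of "matrix_inv (?G u)"] by (simp add: matrix_mul_assoc)
      also have "matrix_inv (?G u) ** (matrix_inv (g ?y) ** \<Phi> ?y ** g ?y) ** ?G u =
         matrix_inv (\<psi> ?y) ** (g ?y ** (matrix_inv (g ?y) ** (\<Phi> ?y ** (g ?y ** (matrix_inv (g ?y) ** \<psi> ?y)))))"
        by (simp add: matrix_inv_prod i matrix_mul_assoc)
      also have "\<dots> = \<Phi>' ?y"
        by (simp add: \<Phi>'_def matrix_inv_cancel i matrix_mul_assoc)
      finally show ?case by (simp add: local_entry_def scale)
    qed
  qed
  have pole: "(\<forall>i j. \<exists>h. h analytic_on {0} \<and> (\<forall>\<^sub>F t in at 0. t * (jac x t * \<Phi>' (loc x t) $ i $ j) = h t)) \<and>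
      g x ** (\<chi> i j. residue (local_entry g \<Phi> x i j) 0) ** matrix_inv (g x) =
      \<psi> x ** trivial_res \<Phi>' x ** matrix_inv (\<psi> x)"
    if x: "x \<in> D" and U: "(U, g) \<in> E" "x \<in> U" for U g x
  proof -
    obtain G Gi where G: "mat_analytic G" "mat_analytic Gi" "\<psi> x = g x ** G 0" "invertible (G 0)"
      "Gi 0 = matrix_inv (G 0)" "\<forall>\<^sub>F u in nhds 0. (\<chi> i j. jac x u * \<Phi>' (loc x u) $ i $ j) =
          Gi u ** (\<chi> i j. local_entry g \<Phi> x i j u) ** G u"
      using key[OF U] by blast
    have "\<exists>h. h analytic_on {0} \<and> (\<forall>\<^sub>F t in at 0. t * (\<chi> i j. local_entry g \<Phi> x i j t) $ i $ j = h t)" for i j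
      using \<Phi> x U by (fastforce simp: log_one_form_def)
    then obtain h where h: "mat_analytic h"
      "\<forall>\<^sub>F t in at 0. \<forall>i j. t * (\<chi> i j. local_entry g \<Phi> x i j t) $ i $ j = h t $ i $ j"
      "\<And>i j. residue (\<lambda>t. (\<chi> i j. local_entry g \<Phi> x i j t) $ i $ j) 0 = h 0 $ i $ (j :: 2)"
      by (rule scaled_mat_analytic) blast
    have Res: "(\<chi> i j. residue (local_entry g \<Phi> x i j) 0) = h 0"
      using h(3) by (simp add: vec_eq_iff)
    define k where "k = (\<lambda>u. Gi u ** h u ** G u)"
    have k: "mat_analytic k" unfolding k_def by (intro mat_analytic_mult G h)
    have k_eq: "\<forall>\<^sub>F t in at 0. \<forall>i j. t * (jac x t * \<Phi>' (loc x t) $ i $ j) = k t $ i $ j"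
      using eventually_nhds_imp_at[OF G(6)] h(2)
    proof eventually_elim
      case (elim t)
      have ht: "h t = mat t ** (\<chi> i j. local_entry g \<Phi> x i j t)"
        using elim(2) by (simp add: vec_eq_iff forall_2 matrix_matrix_mult_def sum_2 mat_def)
      have comm: "mat t ** M = M ** mat t" for M :: "complex ^ 2 ^ 2"
        by (simp add: vec_eq_iff forall_2 matrix_matrix_mult_def sum_2 mat_def)
      have "k t = mat t ** (Gi t ** (\<chi> i j. local_entry g \<Phi> x i j t) ** G t)"
        unfolding k_def ht using comm[of "Gi t"] by (simp add: matrix_mul_assoc)
      also have "\<dots> = mat t ** (\<chi> i j. jac x t * \<Phi>' (loc x t) $ i $ j)" by (simp only: elim(1))
      finally show ?case
        by (simp add: vec_eq_iff forall_2 matrix_matrix_mult_def sum_2 mat_def)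
    qed
    have k_eq': "\<forall>\<^sub>F t in at 0. t * (jac x t * \<Phi>' (loc x t) $ i $ j) = k t $ i $ j" for i j
      using k_eq by eventually_elim simp
    have k_an: "(\<lambda>t. k t $ i $ j) analytic_on {0}" for i j
      using k by (simp add: mat_analytic_def)
    have "trivial_res \<Phi>' x = k 0"
      using residue_simple_pole_analytic[OF k_an k_eq'] by (simp add: trivial_res_def vec_eq_iff)
    then have "\<psi> x ** trivial_res \<Phi>' x ** matrix_inv (\<psi> x) =
        g x ** (G 0 ** (matrix_inv (G 0) ** (h 0 ** (G 0 ** (matrix_inv (G 0) ** matrix_inv (g x))))))"
      using hol_bundleD(3)[OF E U] G by (simp add: k_def matrix_inv_prod matrix_mul_assoc)
    also have "\<dots> = g x ** h 0 ** matrix_inv (g x)"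
      by (simp add: matrix_inv_cancel G(4) matrix_mul_assoc)
    finally have res: "g x ** h 0 ** matrix_inv (g x) = \<psi> x ** trivial_res \<Phi>' x ** matrix_inv (\<psi> x)"
      by (rule sym)
    have "\<exists>h. h analytic_on {0} \<and> (\<forall>\<^sub>F t in at 0. t * (jac x t * \<Phi>' (loc x t) $ i $ j) = h t)" for i j
      by (rule exI[of _ "\<lambda>t. k t $ i $ j"], rule conjI[OF k_an k_eq'])
    then show ?thesis unfolding Res by (intro conjI allI res)
  qed
  then show "x \<in> D \<Longrightarrow> (U, g) \<in> E \<Longrightarrow> x \<in> U \<Longrightarrow>
      g x ** (\<chi> i j. residue (local_entry g \<Phi> x i j) 0) ** matrix_inv (g x) =
      \<psi> x ** trivial_res \<Phi>' x ** matrix_inv (\<psi> x)" by blast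
  have hol: "(\<lambda>t. jac x t * \<Phi>' (loc x t) $ i $ j) analytic_on {0}" if x: "x \<notin> D" for x i j
  proof -
    obtain U g where U: "(U, g) \<in> E" "x \<in> U" using hol_bundleD(1)[OF E] by blast
    obtain G Gi where G: "mat_analytic G" "mat_analytic Gi" "\<forall>\<^sub>F u in nhds 0. (\<chi> i j. jac x u * \<Phi>' (loc x u) $ i $ j) =
          Gi u ** (\<chi> i j. local_entry g \<Phi> x i j u) ** G u"
      using key[OF U] by blast
    have "mat_analytic (\<lambda>u. (\<chi> i j. local_entry g \<Phi> x i j u))"
      using \<Phi> x U by (fastforce simp: log_one_form_def mat_analytic_def)
    then have "mat_analytic (\<lambda>u. Gi u ** (\<chi> i j. local_entry g \<Phi> x i j u) ** G u)"
      by (intro mat_analytic_mult G)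
    then have "mat_analytic (\<lambda>u. (\<chi> i j. jac x u * \<Phi>' (loc x u) $ i $ j))"
      by (rule mat_analytic_cong) (rule eventually_mono[OF G(3)], rule sym)
    then show ?thesis by (simp add: mat_analytic_def)
  qed
  show "log_one_form D trivial_bundle \<Phi>'"
    unfolding log_one_form_def trivial_bundle_def
  proof (clarsimp simp: local_entry_trivial, intro conjI impI)
    fix x i j assume "x \<in> D"
    moreover obtain U g where "(U, g) \<in> E" "x \<in> U" using hol_bundleD(1)[OF E] by blast
    ultimately show "\<exists>h. h analytic_on {0} \<and> (\<forall>\<^sub>F t in at 0. t * (jac x t * \<Phi>' (loc x t) $ i $ j) = h t)"
      using pole by blast
  qed (use hol in blast)
qed

section \<open>Degrees in a trivialised bundle\<close>

lemma image_span_single: "(\<lambda>w. A *v w) ` vec.span {v} = vec.span {(A :: complex ^ 2 ^ 2) *v v}"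
  unfolding span_single by (force simp: vector_scalar_commute image_iff)

lemma invertible_mult_vec_eq_0:
  "invertible (A :: complex ^ 2 ^ 2) \<Longrightarrow> A *v v = 0 \<longleftrightarrow> v = 0"
  using matrix_inv_cancel(6)[of A v] by auto

text \<open>
  The function \<open>det \<psi>\<close> is a nowhere vanishing holomorphic section of the determinant bundle.
\<close>

lemma trivialized_bundle_degree:
  assumes E: "hol_bundle E" and \<psi>: "bundle_iso trivial_bundle E \<psi>"
  shows "bundle_degree E = 0"
  unfolding bundle_degree_def
proof (rule line_degree_0I[where s = "\<lambda>y. vec (det (\<psi> y))"])
  fix x
  obtain U g where "(U, g) \<in> E" "x \<in> U" using hol_bundleD(1)[OF E] by blast
  then show "\<exists>U t. (U, t) \<in> (\<lambda>(U, g). (U, \<lambda>x. vec (det (g x)) :: complex ^ 1)) ` E \<and> x \<in> U"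
    by force
next
  fix U t assume "(U, t) \<in> (\<lambda>(U, g). (U, \<lambda>x. vec (det (g x)) :: complex ^ 1)) ` E"
  then obtain g where g: "(U, g) \<in> E" "t = (\<lambda>x. vec (det (g x)))" by auto
  show "open_cp1 U" by (rule hol_bundleD(2)[OF E g(1)])
  have inv: "det (g y) \<noteq> 0" if "y \<in> U" for y
    using hol_bundleD(3)[OF E g(1) that] by (simp add: invertible_det_nz)
  then show "t x \<noteq> 0" if "x \<in> U" for x using that by (simp add: g(2) vec_eq_iff)
  let ?h = "\<lambda>y. det (matrix_inv (g y) ** \<psi> y)"
  have "vec (det (\<psi> x)) = ?h x *s t x \<and> (?h \<circ> loc x) analytic_on {0} \<and> ?h x \<noteq> 0" if x: "x \<in> U" for x
  proof (intro conjI)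
    have "det (g x) * ?h x = det (\<psi> x)"
      using hol_bundleD(3)[OF E g(1) x] by (simp add: matrix_inv_cancel flip: det_mul)
    then show "vec (det (\<psi> x)) = ?h x *s t x"
      by (simp add: g(2) vec_eq_iff mult.commute)
    show "?h x \<noteq> 0"
      using hol_bundleD(3)[OF E g(1) x] bundle_isoD(1)[OF \<psi>]
      by (metis invertible_det_nz invertible_matrix_inv invertible_mult)
    show "(?h \<circ> loc x) analytic_on {0}"
      unfolding o_def by (rule mat_analytic_det[OF bundle_isoD(2)[OF \<psi> g(1) x]])
  qed
  then show "\<exists>h. \<forall>x\<in>U. vec (det (\<psi> x)) = h x *s t x \<and> (h \<circ> loc x) analytic_on {0} \<and> h x \<noteq> 0"
    by (intro exI[of _ ?h]) blast
qed

text \<open>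
  The section \<open>\<psi> v\<close> is holomorphic and vanishes nowhere.
\<close>

lemma constant_subbundle:
  assumes E: "hol_bundle E" and \<psi>: "bundle_iso trivial_bundle E \<psi>" and v: "v \<noteq> 0"
  defines "L \<equiv> \<lambda>y. vec.span {\<psi> y *v v}"
  shows "line_subbundle E L" "subbundle_degree E L = 0"
proof -
  have nz: "\<psi> y *v v \<noteq> 0" for y
    using invertible_mult_vec_eq_0[OF bundle_isoD(1)[OF \<psi>]] v by blast
  have sec: "(\<lambda>u. (matrix_inv (g (loc x u)) *v (\<psi> (loc x u) *v v)) $ i) analytic_on {0}"
    if "(U, g) \<in> E" "x \<in> U" for U g x i
  proof -
    have "(\<lambda>u. ((matrix_inv (g (loc x u)) ** \<psi> (loc x u)) *v v) $ i) analytic_on {0}"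
      by (intro mat_analytic_mult_vec bundle_isoD(2)[OF \<psi> that]) auto
    then show ?thesis by (simp add: matrix_vector_mul_assoc)
  qed
  have in_F: "(UNIV, \<lambda>y. \<psi> y *v v) \<in> sub_frames E L"
    unfolding sub_frames_def hol_section_def hol_vec_cp1_def hol_cp1_def o_def
    using nz sec by (auto simp: open_cp1_def L_def vec.span_base)
  then show "line_subbundle E L"
    unfolding line_subbundle_def L_def using is_line_span[OF nz] by (auto simp: L_def)
  show "subbundle_degree E L = 0"
    unfolding subbundle_degree_def
  proof (rule line_degree_0I[where s = "\<lambda>y. \<psi> y *v v"])
    show "\<exists>U t. (U, t) \<in> sub_frames E L \<and> x \<in> U" for x using in_F by blast
    fix U t assume Ut: "(U, t) \<in> sub_frames E L"
    then show "open_cp1 U" "\<And>x. x \<in> U \<Longrightarrow> t x \<noteq> 0" by (auto simp: sub_frames_def)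
    define h where "h = (\<lambda>y. SOME a. \<psi> y *v v = a *s t y)"
    have h: "\<psi> y *v v = h y *s t y" if "y \<in> U" for y
    proof -
      have "t y \<in> vec.span {\<psi> y *v v}" "t y \<noteq> 0"
        using Ut that by (auto simp: sub_frames_def L_def)
      then have "\<psi> y *v v \<in> vec.span {t y}"
        using span_single_eq[of "t y"] by (simp add: vec.span_base)
      then have "\<exists>a. \<psi> y *v v = a *s t y" by (auto simp: span_single)
      then show ?thesis unfolding h_def by (rule someI_ex)
    qed
    have "\<psi> x *v v = h x *s t x \<and> (h \<circ> loc x) analytic_on {0} \<and> h x \<noteq> 0" if x: "x \<in> U" for x
    proof -
      obtain V g where g: "(V, g) \<in> E" "x \<in> V" using hol_bundleD(1)[OF E] by blast
      let ?a = "\<lambda>u. matrix_inv (g (loc x u)) *v (\<psi> (loc x u) *v v)"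
      let ?b = "\<lambda>u. matrix_inv (g (loc x u)) *v t (loc x u)"
      have "(\<lambda>u. ?b u $ i) analytic_on {0}" for i
        using Ut g x by (auto simp: sub_frames_def hol_section_def hol_vec_cp1_def hol_cp1_def o_def)
      moreover have "\<forall>\<^sub>F u in nhds 0. ?a u = (h \<circ> loc x) u *s ?b u"
        using open_cp1_eventually[OF \<open>open_cp1 U\<close> x] by eventually_elim (simp add: h vector_scalar_commute)
      moreover have "?a 0 \<noteq> 0"
        using hol_bundleD(3)[OF E g] nz by (simp add: invertible_mult_vec_eq_0)
      ultimately have "(h \<circ> loc x) analytic_on {0}" "(h \<circ> loc x) 0 \<noteq> 0"
        using analytic_proportion[of ?a ?b "h \<circ> loc x"] sec[OF g] by blast+
      then show ?thesis using h[OF x] by simp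
    qed
    then show "\<exists>h. \<forall>x\<in>U. \<psi> x *v v = h x *s t x \<and> (h \<circ> loc x) analytic_on {0} \<and> h x \<noteq> 0"
      by (intro exI[of _ h]) blast
  qed
qed

text \<open>
  Each point of \<open>D\<close> has at most one preimage under the injective map \<open>loc y\<close>.
\<close>

lemma eventually_loc_notin:
  assumes "finite D"
  shows "\<forall>\<^sub>F t in at 0. loc y t \<notin> D"
proof -
  have "\<forall>\<^sub>F t in at 0. loc y t \<noteq> d" for d
  proof (cases "\<exists>s. loc y s = d")
    case True
    then obtain s where s: "loc y s = d" by blast
    have ne: "loc y t \<noteq> d" if "t \<noteq> s" for t
      using s that by (cases y) (auto split: if_splits)
    show ?thesis
      by (rule eventually_mono[OF eventually_neq_at_within[of s]]) (rule ne)
  qed auto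
  then have "\<forall>\<^sub>F t in at 0. \<forall>d\<in>D. loc y t \<noteq> d"
    using assms by (intro eventually_ball_finite) auto
  then show ?thesis by eventually_elim auto
qed

section \<open>Higgs bundles of points in the zero level\<close>

text \<open>
  At an unmarked point \<open>Infty\<close> both sides are continuous in the coordinate \<open>t\<close>, so that the equality
  follows from the one at the affine points.
\<close>

lemma log_form_determined_by_residues:
  fixes x :: "'n::finite \<Rightarrow> cp1"
  assumes x: "inj x"
    and hol: "\<And>y. y \<notin> range x \<Longrightarrow> (\<lambda>t. jac y t * f (loc y t)) analytic_on {0}"
    and pole: "\<And>y. y \<in> range x \<Longrightarrow>
      \<exists>h. h analytic_on {0} \<and> (\<forall>\<^sub>F t in at 0. t * (jac y t * f (loc y t)) = h t)"
  defines "r \<equiv> \<lambda>i. residue (\<lambda>t. jac (x i) t * f (loc (x i) t)) 0"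
  shows "(\<Sum>i\<in>UNIV. r i) = 0"
    and "y \<notin> range x \<Longrightarrow> f y = (\<Sum>i\<in>UNIV. log_basis (x i) y * r i)"
proof -
  define R where "R = (\<lambda>y. residue (\<lambda>t. jac y t * f (loc y t)) 0)"
  note lf = log_form_on_cp1[where D = "range x" and f = f, OF finite_imageI[OF finite_class.finite_UNIV] hol pole]
  show sum0: "(\<Sum>i\<in>UNIV. r i) = 0"
    using lf(2) x by (simp add: sum.reindex r_def R_def)
  define f' where "f' = (\<lambda>y. \<Sum>i\<in>UNIV. log_basis (x i) y * r i)"
  have aff: "f (Aff z) = f' (Aff z)" if "Aff z \<notin> range x" for z
  proof -
    have "f (Aff z) = (\<Sum>a | Aff a \<in> range x. R (Aff a) / (z - a))"
      unfolding R_def by (rule lf(1)) (use that in auto)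
    also have "\<dots> = (\<Sum>y\<in>Aff ` {a. Aff a \<in> range x}. log_basis y (Aff z) * R y)"
      by (simp add: sum.reindex inj_on_def)
    also have "\<dots> = (\<Sum>y\<in>range x. log_basis y (Aff z) * R y)"
    proof (rule sum.mono_neutral_left)
      have "y = Infty" if "y \<in> range x - Aff ` {a. Aff a \<in> range x}" for y
        using that by (cases y) auto
      then show "\<forall>y\<in>range x - Aff ` {a. Aff a \<in> range x}. log_basis y (Aff z) * R y = 0"
        by fastforce
    qed auto
    also have "\<dots> = f' (Aff z)"
      using x by (simp add: sum.reindex f'_def r_def R_def)
    finally show ?thesis .
  qed
  have inf: "f Infty = f' Infty" if "Infty \<notin> range x"
  proof -
    have "isCont (\<lambda>t. jac Infty t * f (loc Infty t)) 0" "isCont (\<lambda>t. jac Infty t * f' (loc Infty t)) 0"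
      using hol[OF that] log_form_with_residues(1)[OF x sum0 that]
      by (auto simp: f'_def intro!: analytic_at_imp_isCont)
    then have "((\<lambda>t. jac Infty t * f (loc Infty t)) \<longlongrightarrow> f Infty) (at 0)"
      "((\<lambda>t. jac Infty t * f' (loc Infty t)) \<longlongrightarrow> f' Infty) (at 0)"
      by (simp_all add: isCont_def)
    moreover have "\<forall>\<^sub>F t in at 0. jac Infty t * f' (loc Infty t) = jac Infty t * f (loc Infty t)"
      using eventually_loc_notin[of "range x" Infty, simplified] eventually_neq_at_within[of 0]
      by eventually_elim (simp add: aff)
    ultimately show ?thesis
      using tendsto_unique[OF at_neq_bot _ Lim_transform_eventually] by blast
  qed
  show "f y = (\<Sum>i\<in>UNIV. log_basis (x i) y * r i)" if "y \<notin> range x"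
    using that aff inf by (cases y) (auto simp: f'_def)
qed


lemma outer_mult_vec: "outer v w *v u = scalar_product w u *s v"
  by (simp add: outer_def matrix_vector_mult_def scalar_product_def vec_eq_iff sum_2 algebra_simps)

lemma trace_outer: "trace (outer v w) = scalar_product w v"
  by (simp add: trace_def outer_def scalar_product_def mult.commute)

lemma outer_eq_0_iff: "outer v w = 0 \<longleftrightarrow> v = 0 \<or> w = 0"
  by (auto simp: outer_def vec_eq_iff)

lemma matrix_mult_outer: "A ** outer v w = outer (A *v v) w" "outer v w ** A = outer v (w v* A)"
  by (simp_all add: outer_def matrix_matrix_mult_def matrix_vector_mult_def vector_matrix_mult_def
      vec_eq_iff sum_2 algebra_simps)

lemma outer_smult: "outer (c *s v) w = outer v (c *s w)"
  by (simp add: outer_def vec_eq_iff)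

lemma outer_cancel: "outer v w = outer v w' \<Longrightarrow> v \<noteq> 0 \<Longrightarrow> w = w'"
  by (auto simp: outer_def vec_eq_iff)

text \<open>
  The columns of \<open>N\<close> are multiples of \<open>q\<close>.
\<close>

lemma outer_exists:
  assumes "\<And>v. N *v v \<in> vec.span {q}" "q \<noteq> 0"
  shows "\<exists>p. N = outer q p"
proof -
  have "\<forall>j. \<exists>c. N *v axis j 1 = c *s q"
    using assms(1) by (auto simp: span_single)
  then obtain c where "\<And>j. N *v axis j 1 = c j *s q" by metis
  then have "(N *v axis j 1) $ i = c j * q $ i" for i j
    by simp
  moreover have "(N *v axis j 1) $ i = N $ i $ j" for i j
    using exhaust_2[of j] by (auto simp: matrix_vector_mult_def axis_def sum_2)
  ultimately have "N $ i $ j = c j * q $ i" for i j by metis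
  then have "N = outer q (\<chi> j. c j)" by (simp add: outer_def vec_eq_iff mult.commute)
  then show ?thesis by blast
qed

text \<open>
  The trace of \<open>q\<^sub>i p\<^sub>i\<close> is \<open>p\<^sub>i q\<^sub>i\<close>, so that under the first condition no trace has to be removed.
\<close>

lemma mu_complex_zero_iff:
  "(p, q) \<in> mu_complex_zero \<longleftrightarrow>
     (\<forall>i. scalar_product (p $ i) (q $ i) = 0) \<and> (\<Sum>i\<in>UNIV. outer (q $ i) (p $ i)) = 0"
proof -
  have "traceless (outer (q $ i) (p $ i)) = outer (q $ i) (p $ i)" if "scalar_product (p $ i) (q $ i) = 0" for i
    using that by (simp add: traceless_def trace_outer mat_def vec_eq_iff)
  then show ?thesis unfolding mu_complex_zero_def by auto
qed

text \<open>
  The Higgs bundle of the correspondence.  Off the marked points \<open>inv x\<close> is an arbitrary index, which is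
  harmless because flags carry no information there.
\<close>

definition higgs_of :: "('n::finite \<Rightarrow> cp1) \<Rightarrow> 'n pq \<Rightarrow> higgs_data" where
  "higgs_of x y = \<lparr>frames = trivial_bundle, flag = (\<lambda>z. vec.span {snd y $ (inv x z)}),
     field = (\<lambda>z. \<chi> r s. \<Sum>i\<in>UNIV. log_basis (x i) z * outer (snd y $ i) (fst y $ i) $ r $ s)\<rparr>"

lemma higgs_of_simps [simp]:
  "frames (higgs_of x y) = trivial_bundle"
  "field (higgs_of x y) z = (\<chi> r s. \<Sum>i\<in>UNIV. log_basis (x i) z * outer (snd y $ i) (fst y $ i) $ r $ s)"
  "inj x \<Longrightarrow> flag (higgs_of x y) (x i) = vec.span {snd y $ i}"
  by (simp_all add: higgs_of_def)

lemma higgs_res_higgs_of: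
  fixes x :: "'n::finite \<Rightarrow> cp1"
  assumes x: "inj x" and y: "y \<in> mu_complex_zero"
  shows "higgs_res (higgs_of x y) (x k) = outer (snd y $ k) (fst y $ k)"
    and "log_one_form (range x) trivial_bundle (field (higgs_of x y))"
proof -
  let ?N = "\<lambda>i. outer (snd y $ i) (fst y $ i)"
  have sum0: "(\<Sum>i\<in>UNIV. ?N i $ r $ s) = 0" for r s
  proof -
    have "(\<Sum>i\<in>UNIV. ?N i) = 0" using y mu_complex_zero_iff[of "fst y" "snd y"] by simp
    then have "(\<Sum>i\<in>UNIV. ?N i) $ r $ s = 0" by simp
    then show ?thesis by simp
  qed
  note lf = log_form_with_residues[OF x sum0]
  show "log_one_form (range x) trivial_bundle (field (higgs_of x y))"
    unfolding log_one_form_def trivial_bundle_def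
    using lf(1) lf(2) by (clarsimp simp: local_entry_trivial) blast
  have "residue (\<lambda>t. jac (x k) t * field (higgs_of x y) (loc (x k) t) $ r $ s) 0 = ?N k $ r $ s" for r s
  proof -
    obtain h where h: "h analytic_on {0}" "h 0 = ?N k $ r $ s"
      "\<forall>\<^sub>F t in at 0. t * (jac (x k) t * (\<Sum>i\<in>UNIV. log_basis (x i) (loc (x k) t) * ?N i $ r $ s)) = h t"
      using lf(2) by blast
    then show ?thesis using residue_simple_pole_analytic[OF h(1,3)] by simp
  qed
  then show "higgs_res (higgs_of x y) (x k) = outer (snd y $ k) (fst y $ k)"
    by (simp add: higgs_res_trivial trivial_res_def vec_eq_iff)
qed

section \<open>Stable points and stable Higgs bundles\<close>

lemma mu_complex_stableD:
  fixes y :: "'n::finite pq"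
  assumes "y \<in> mu_complex_stable"
  shows "y \<in> mu_complex_zero" "snd y $ i \<noteq> 0" "fst y $ i \<noteq> 0"
    "scalar_product (fst y $ i) (snd y $ i) = 0" "(\<Sum>i\<in>UNIV. outer (snd y $ i) (fst y $ i)) = 0"
    "\<not> (\<forall>i j. \<exists>c. snd y $ j = c *s snd y $ i)"
proof -
  show "y \<in> mu_complex_zero" using assms by (auto simp: mu_complex_stable_def)
  then show "scalar_product (fst y $ i) (snd y $ i) = 0" "(\<Sum>i\<in>UNIV. outer (snd y $ i) (fst y $ i)) = 0"
    using mu_complex_zero_iff[of "fst y" "snd y"] by auto
  show "\<not> (\<forall>i j. \<exists>c. snd y $ j = c *s snd y $ i)"
    using assms by (cases y) (simp add: mu_complex_stable_def)
qed (use assms in \<open>auto simp: mu_complex_stable_def\<close>)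

lemma scalar_product_smult: "scalar_product w (c *s u) = c * scalar_product w (u :: complex ^ 2)"
  by (simp add: scalar_product_def sum_2 algebra_simps)

text \<open>
  For nonzero vectors, being pairwise proportional is the same as lying on a common line.
\<close>

lemma not_all_proportional:
  fixes q :: "(complex ^ 2) ^ 'n::finite"
  assumes "\<not> (\<forall>i j. \<exists>c. q $ j = c *s q $ i)" "\<And>i. q $ i \<noteq> 0"
  shows "\<exists>i. q $ i \<notin> vec.span {v}"
proof (rule ccontr)
  assume "\<nexists>i. q $ i \<notin> vec.span {v}"
  then have "vec.span {q $ i} = vec.span {v}" for i
    using span_single_eq assms(2) by blast
  then have "q $ j \<in> vec.span {q $ i}" for i j
    using vec.span_base[of "q $ j" "{q $ j}"] by auto
  then show False using assms(1) by (auto simp: span_single)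
qed

text \<open>
  A line subbundle of degree at most \<open>- 1\<close> has slope at most \<open>- 1 + n / 2\<close>.  A line subbundle of degree
  zero is constant; as the \<open>q\<^sub>i\<close> do not lie on a common line, it misses one of the flags and has slope
  less than \<open>n / 2\<close>.
\<close>

lemma higgs_of_in_stable_trivial:
  fixes x :: "'n::finite \<Rightarrow> cp1"
  assumes x: "inj x" and y: "y \<in> mu_complex_stable"
  shows "higgs_of x y \<in> stable_trivial (range x)"
proof -
  let ?H = "higgs_of x y"
  note st = mu_complex_stableD[OF y]
  have res: "higgs_res ?H (x i) = outer (snd y $ i) (fst y $ i)" for i
    by (rule higgs_res_higgs_of(1)[OF x st(1)])
  have id: "bundle_iso trivial_bundle trivial_bundle (\<lambda>y. mat 1)"
    by (rule bundle_iso_trivial) (auto simp: invertible_def)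
  have "quasi_parabolic_higgs (range x) ?H"
    unfolding quasi_parabolic_higgs_def
  proof (intro conjI ballI allI)
    show "hol_bundle (frames ?H)" by (simp add: hol_bundle_trivial)
    show "log_one_form (range x) (frames ?H) (field ?H)" using higgs_res_higgs_of(2)[OF x st(1)] by simp
    fix z assume "z \<in> range x"
    then obtain i where [simp]: "z = x i" by blast
    show "is_line (flag ?H z)" using x is_line_span[OF st(2)] by simp
    show "higgs_res ?H z *v v \<in> flag ?H z" for v
      using x by (auto simp: res outer_mult_vec span_single)
    show "higgs_res ?H z *v v = 0" if "v \<in> flag ?H z" for v
      using that x by (auto simp: res outer_mult_vec span_single scalar_product_smult st(4))
  qed
  moreover have "det_trivial trivial_bundle"
    unfolding det_trivial_def by (rule exI[of _ "\<lambda>_. 1"]) (auto simp: trivial_bundle_def hol_cp1_def o_def)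
  moreover have "trace (field ?H z) = 0" for z
  proof -
    have "trace (field ?H z) = (\<Sum>i\<in>UNIV. log_basis (x i) z * trace (outer (snd y $ i) (fst y $ i)))"
      by (simp add: trace_def sum_2 sum.distrib distrib_left)
    then show ?thesis by (simp add: trace_outer st)
  qed
  moreover have "stable_higgs (range x) ?H"
    unfolding stable_higgs_def
  proof (intro conjI ballI allI impI)
    show "higgs_res ?H z \<noteq> 0" if "z \<in> range x" for z
      using that st(2,3) by (auto simp: res outer_eq_0_iff)
    fix L assume "line_subbundle (frames ?H) L \<and> preserved (range x) ?H L"
    then have L: "line_subbundle trivial_bundle L" by simp
    let ?S = "{z \<in> range x. L z \<inter> flag ?H z \<noteq> {0}}"
    have card_le: "card ?S \<le> card (range x)" by (intro card_mono) auto
    have "real_of_int (subbundle_degree trivial_bundle L) + real (card ?S) / 2 < real (card (range x)) / 2"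
    proof (cases "subbundle_degree trivial_bundle L = 0")
      case True
      then obtain v where v: "v \<noteq> 0" "\<And>z. L z = vec.span {v}"
        using trivial_subbundle_degree(2)[OF L] by blast
      obtain i where "snd y $ i \<notin> vec.span {v}"
        using not_all_proportional[OF st(6) st(2)] by blast
      then have "det2 v (snd y $ i) \<noteq> 0"
        unfolding in_span_iff_det2[OF v(1)] det2_swap[of v] by simp
      then have "L (x i) \<inter> flag ?H (x i) = {0}"
        using span_inter_span[OF v(1) st(2)] v(2) x by simp
      then have "x i \<notin> ?S" by blast
      then have "?S \<subset> range x" by auto
      then have "card ?S < card (range x)" by (intro psubset_card_mono) auto
      then show ?thesis using True by simp
    next
      case False
      then have "subbundle_degree trivial_bundle L \<le> - 1"
        using trivial_subbundle_degree(1)[OF L] by simp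
      then have "real_of_int (subbundle_degree trivial_bundle L) \<le> - 1" by linarith
      then show ?thesis using card_le by simp
    qed
    then show "q_par_slope (range x) ?H > q_par_slope_sub (range x) ?H L"
      using trivialized_bundle_degree[OF hol_bundle_trivial id]
      by (simp add: q_par_slope_def q_par_slope_sub_def)
  qed
  moreover have "hol_trivial trivial_bundle" using id by (auto simp: hol_trivial_def)
  ultimately show ?thesis by (simp add: stable_trivial_def sl2_higgs_def)
qed

lemma matrix_sum_outer_vec:
  "(\<chi> r s. \<Sum>i\<in>I. c i * outer (q i) (p i) $ r $ s) *v v = (\<Sum>i\<in>I. (c i * scalar_product (p i) v) *s q i)"
  by (simp add: vec_eq_iff matrix_vector_mult_def outer_def scalar_product_def sum_2 sum_distrib_right
      sum_distrib_left sum.distrib[symmetric] algebra_simps)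

text \<open>
  The pulled back field has residues \<open>q\<^sub>i p\<^sub>i\<close>, hence it is the field of \<open>higgs_of x (p, q)\<close> and the
  residues add up to zero.  If the \<open>q\<^sub>i\<close> were all proportional to \<open>v\<close>, all residues would annihilate \<open>v\<close>.
  Then the image of the constant line through \<open>v\<close> would be annihilated by the Higgs field, have degree
  zero and contain all flags, so that its slope would be \<open>n / 2\<close>, contrary to stability.
\<close>

lemma stable_higgs_representative:
  fixes x :: "'n::finite \<Rightarrow> cp1" and p q :: "(complex ^ 2) ^ 'n"
  assumes x: "inj x" and H: "\<H> \<in> stable_trivial (range x)"
    and \<psi>: "bundle_iso trivial_bundle (frames \<H>) \<psi>"
    and q: "\<And>i. q $ i \<noteq> 0"
    and flag: "\<And>i. flag \<H> (x i) = (\<lambda>v. \<psi> (x i) *v v) ` vec.span {q $ i}"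
    and res: "\<And>i. higgs_res \<H> (x i) = \<psi> (x i) ** outer (q $ i) (p $ i) ** matrix_inv (\<psi> (x i))"
  shows "(p, q) \<in> mu_complex_stable" "higgs_iso (range x) (higgs_of x (p, q)) \<H>"
proof -
  have E: "hol_bundle (frames \<H>)" and log: "log_one_form (range x) (frames \<H>) (field \<H>)"
    and kill: "\<And>i v. v \<in> flag \<H> (x i) \<Longrightarrow> higgs_res \<H> (x i) *v v = 0"
    and res_nz: "\<And>i. higgs_res \<H> (x i) \<noteq> 0"
    and slope: "\<And>L. line_subbundle (frames \<H>) L \<Longrightarrow> preserved (range x) \<H> L \<Longrightarrow>
        q_par_slope (range x) \<H> > q_par_slope_sub (range x) \<H> L"
    using H by (auto simp: stable_trivial_def sl2_higgs_def quasi_parabolic_higgs_def stable_higgs_def)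
  note inv = bundle_isoD(1)[OF \<psi>]
  define \<Phi>' where "\<Phi>' = (\<lambda>y. matrix_inv (\<psi> y) ** field \<H> y ** \<psi> y)"
  note tr = trivialized_field[OF E \<psi> log, folded \<Phi>'_def]
  have tres: "trivial_res \<Phi>' (x i) = outer (q $ i) (p $ i)" for i
  proof -
    have "higgs_res \<H> (x i) = \<psi> (x i) ** trivial_res \<Phi>' (x i) ** matrix_inv (\<psi> (x i))"
      by (rule higgs_res_unique) (use tr(2) hol_bundleD(1)[OF E] in \<open>auto simp: eq_commute\<close>)
    then have "matrix_inv (\<psi> (x i)) ** (\<psi> (x i) ** (trivial_res \<Phi>' (x i) ** matrix_inv (\<psi> (x i)))) ** \<psi> (x i)
      = matrix_inv (\<psi> (x i)) ** (\<psi> (x i) ** (outer (q $ i) (p $ i) ** matrix_inv (\<psi> (x i)))) ** \<psi> (x i)"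
      using res by (simp add: matrix_mul_assoc)
    then show ?thesis by (simp add: matrix_inv_cancel inv)
  qed
  have hol': "y \<notin> range x \<Longrightarrow> (\<lambda>t. jac y t * \<Phi>' (loc y t) $ r $ s) analytic_on {0}"
    and pole': "y \<in> range x \<Longrightarrow> \<exists>h. h analytic_on {0} \<and>
        (\<forall>\<^sub>F t in at 0. t * (jac y t * \<Phi>' (loc y t) $ r $ s) = h t)" for y r s
    using tr(1) by (auto simp: log_one_form_def trivial_bundle_def local_entry_trivial)
  have resid: "residue (\<lambda>t. jac (x i) t * \<Phi>' (loc (x i) t) $ r $ s) 0 = outer (q $ i) (p $ i) $ r $ s" for i r s
    using tres[of i] by (simp add: trivial_res_def vec_eq_iff)
  note det = log_form_determined_by_residues[OF x hol' pole', unfolded resid]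
  have sum0: "(\<Sum>i\<in>UNIV. outer (q $ i) (p $ i)) = 0"
    using det(1) by (simp add: vec_eq_iff)
  have field_eq: "field (higgs_of x (p, q)) y = \<Phi>' y" if "y \<notin> range x" for y
    using that by (simp add: vec_eq_iff det(2))
  have p: "p $ i \<noteq> 0" for i
  proof
    assume "p $ i = 0"
    then have "outer (q $ i) (p $ i) = 0" by (simp add: outer_eq_0_iff)
    then show False using res[of i] res_nz[of i] by simp
  qed
  have pq: "scalar_product (p $ i) (q $ i) = 0" for i
  proof -
    have "\<psi> (x i) *v q $ i \<in> flag \<H> (x i)" using flag by (auto simp: vec.span_base)
    from kill[OF this] have "\<psi> (x i) *v (outer (q $ i) (p $ i) *v q $ i) = 0"
      unfolding res by (simp add: matrix_vector_mul_assoc[symmetric] matrix_inv_cancel inv)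
    then show ?thesis
      using q by (simp add: invertible_mult_vec_eq_0[OF inv] outer_mult_vec)
  qed
  have "\<not> (\<forall>i j. \<exists>c. q $ j = c *s q $ i)"
  proof
    assume prp: "\<forall>i j. \<exists>c. q $ j = c *s q $ i"
    \<comment> \<open>Any of the \<open>q\<^sub>i\<close> will do.\<close>
    define v where "v = q $ (SOME i. True)"
    have v: "v \<noteq> 0" by (simp add: v_def q)
    have spans: "vec.span {q $ i} = vec.span {v}" for i
    proof (rule span_single_eq)
      show "q $ i \<in> vec.span {v}" using prp by (auto simp: v_def span_single)
    qed (rule q)
    define L where "L = (\<lambda>y. vec.span {\<psi> y *v v})"
    have sub: "line_subbundle (frames \<H>) L" "subbundle_degree (frames \<H>) L = 0"
      unfolding L_def using constant_subbundle[OF E \<psi> v] by auto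
    have pv: "scalar_product (p $ i) v = 0" for i
    proof -
      obtain c where "v = c *s q $ i" using prp by (auto simp: v_def)
      then show ?thesis using pq[of i] by (simp add: scalar_product_smult)
    qed
    have pres: "preserved (range x) \<H> L"
      unfolding preserved_def
    proof (intro allI impI ballI)
      fix y w assume y: "y \<notin> range x" and "w \<in> L y"
      then obtain c where w: "w = c *s (\<psi> y *v v)" by (auto simp: L_def span_single)
      have "\<Phi>' y *v v = 0"
        unfolding field_eq[OF y, symmetric] higgs_of_simps matrix_sum_outer_vec by (simp add: pv)
      then have "matrix_inv (\<psi> y) *v (field \<H> y *v (\<psi> y *v v)) = 0"
        by (simp add: \<Phi>'_def matrix_vector_mul_assoc matrix_mul_assoc)
      then have "field \<H> y *v (\<psi> y *v v) = 0"
        by (simp add: invertible_mult_vec_eq_0 inv)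
      then have "field \<H> y *v w = 0" by (simp add: w vector_scalar_commute)
      then show "field \<H> y *v w \<in> L y" by (simp add: L_def vec.span_zero)
    qed
    have "L (x i) \<inter> flag \<H> (x i) \<noteq> {0}" for i
    proof -
      have "L (x i) = flag \<H> (x i)"
        unfolding flag spans image_span_single L_def ..
      moreover have "\<psi> (x i) *v v \<in> L (x i)" by (simp add: L_def vec.span_base)
      moreover have "\<psi> (x i) *v v \<noteq> 0" using v by (simp add: invertible_mult_vec_eq_0 inv)
      ultimately show ?thesis by auto
    qed
    then have "{z \<in> range x. L z \<inter> flag \<H> z \<noteq> {0}} = range x" by auto
    then show False
      using slope[OF sub(1) pres] sub(2) trivialized_bundle_degree[OF E \<psi>]
      by (simp add: q_par_slope_def q_par_slope_sub_def)
  qed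
  then show "(p, q) \<in> mu_complex_stable"
    using mu_complex_zero_iff[of p q] pq sum0 p q by (simp add: mu_complex_stable_def)
  show "higgs_iso (range x) (higgs_of x (p, q)) \<H>"
    unfolding higgs_iso_def
  proof (intro exI[of _ \<psi>] conjI ballI allI impI)
    show "bundle_iso (frames (higgs_of x (p, q))) (frames \<H>) \<psi>" using \<psi> by simp
    show "(\<lambda>v. \<psi> z *v v) ` flag (higgs_of x (p, q)) z = flag \<H> z" if "z \<in> range x" for z
      using that flag x by auto
    show "\<psi> z ** field (higgs_of x (p, q)) z = field \<H> z ** \<psi> z" if "z \<notin> range x" for z
      unfolding field_eq[OF that] \<Phi>'_def by (simp add: matrix_inv_cancel inv flip: matrix_mul_assoc)
  qed
qed

text \<open>
  The residue, moved to the trivial bundle, has its image in the flag line \<open>\<langle>q\<rangle>\<close>, so it has the form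
  \<open>q p\<close>.
\<close>

lemma stable_trivial_representative:
  fixes x :: "'n::finite \<Rightarrow> cp1"
  assumes x: "inj x" and H: "\<H> \<in> stable_trivial (range x)"
  obtains y where "y \<in> mu_complex_stable" "higgs_iso (range x) (higgs_of x y) \<H>"
proof -
  obtain \<psi> where \<psi>: "bundle_iso trivial_bundle (frames \<H>) \<psi>"
    using H by (auto simp: stable_trivial_def hol_trivial_def)
  note inv = bundle_isoD(1)[OF \<psi>]
  have line: "is_line (flag \<H> (x i))"
    and image: "higgs_res \<H> (x i) *v v \<in> flag \<H> (x i)" for i v
    using H by (auto simp: stable_trivial_def sl2_higgs_def quasi_parabolic_higgs_def)
  have "\<exists>q p. q \<noteq> 0 \<and> flag \<H> (x i) = (\<lambda>v. \<psi> (x i) *v v) ` vec.span {q} \<and>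
      higgs_res \<H> (x i) = \<psi> (x i) ** outer q p ** matrix_inv (\<psi> (x i))" for i
  proof -
    obtain v where v: "v \<noteq> 0" "flag \<H> (x i) = vec.span {v}" using line is_lineE by blast
    define q where "q = matrix_inv (\<psi> (x i)) *v v"
    have q: "q \<noteq> 0" "flag \<H> (x i) = (\<lambda>v. \<psi> (x i) *v v) ` vec.span {q}"
      using v by (auto simp: q_def invertible_mult_vec_eq_0 inv image_span_single matrix_inv_cancel)
    define N where "N = matrix_inv (\<psi> (x i)) ** higgs_res \<H> (x i) ** \<psi> (x i)"
    have "N *v w \<in> vec.span {q}" for w
    proof -
      obtain u where u: "u \<in> vec.span {q}" "higgs_res \<H> (x i) *v (\<psi> (x i) *v w) = \<psi> (x i) *v u"
        using image[of i "\<psi> (x i) *v w"] q(2) by auto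
      have "N *v w = matrix_inv (\<psi> (x i)) *v (higgs_res \<H> (x i) *v (\<psi> (x i) *v w))"
        by (simp add: N_def matrix_vector_mul_assoc matrix_mul_assoc)
      then show ?thesis using u by (simp add: matrix_inv_cancel inv)
    qed
    then obtain p where p: "N = outer q p" using outer_exists q(1) by blast
    have "\<psi> (x i) ** N ** matrix_inv (\<psi> (x i)) =
        \<psi> (x i) ** (matrix_inv (\<psi> (x i)) ** (higgs_res \<H> (x i) ** (\<psi> (x i) ** matrix_inv (\<psi> (x i)))))"
      by (simp add: N_def matrix_mul_assoc)
    then have "higgs_res \<H> (x i) = \<psi> (x i) ** outer q p ** matrix_inv (\<psi> (x i))"
      by (simp add: matrix_inv_cancel matrix_inv_mult inv p)
    with q show ?thesis by blast
  qed
  then obtain q p where qp: "\<And>i. q i \<noteq> 0" "\<And>i. flag \<H> (x i) = (\<lambda>v. \<psi> (x i) *v v) ` vec.span {q i}"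
    "\<And>i. higgs_res \<H> (x i) = \<psi> (x i) ** outer (q i) (p i) ** matrix_inv (\<psi> (x i))"
    by metis
  show thesis
    using stable_higgs_representative[OF x H \<psi>, of "\<chi> i. q i" "\<chi> i. p i"] qp that by simp
qed

section \<open>Isomorphism classes and orbits\<close>

lemma pq_act_nth [simp]:
  "fst (pq_act y A e) $ i = inverse (e $ i) *s (fst y $ i v* A)"
  "snd (pq_act y A e) $ i = e $ i *s (matrix_inv A *v snd y $ i)"
  by (simp_all add: pq_act_def)

lemma SL2_invertible: "A \<in> SL2 \<Longrightarrow> invertible A"
  by (simp add: SL2_def invertible_det_nz)

lemma SL2_mult: "A \<in> SL2 \<Longrightarrow> B \<in> SL2 \<Longrightarrow> A ** B \<in> SL2"
  by (simp add: SL2_def det_mul)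

lemma SL2_inv: "A \<in> SL2 \<Longrightarrow> matrix_inv A \<in> SL2"
  using det_mul[of A "matrix_inv A"] by (simp add: SL2_def matrix_inv_mult invertible_det_nz det_I)

lemma smult_mult_vec: "(A :: complex ^ 2 ^ 2) *v (c *s v) = c *s (A *v v)"
  by (simp add: vector_scalar_commute)

lemma vec_mult_smult: "(c *s v) v* (A :: complex ^ 2 ^ 2) = c *s (v v* A)"
  by (simp add: vector_matrix_mult_def vec_eq_iff sum_2 algebra_simps)

lemma pq_act_pq_act:
  fixes y :: "'n::finite pq"
  assumes "invertible A" "invertible B"
  shows "pq_act (pq_act y A e) B f = pq_act y (A ** B) (\<chi> i. e $ i * f $ i)"
  by (intro prod_eqI; simp add: vec_eq_iff[where 'b = 'n] smult_mult_vec vec_mult_smult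
      matrix_inv_prod assms matrix_vector_mul_assoc vector_matrix_mul_assoc vector_smult_assoc mult.commute)

lemma pq_act_id:
  fixes y :: "'n::finite pq"
  shows "pq_act y (mat 1) (\<chi> i. 1) = y"
  by (intro prod_eqI; simp add: vec_eq_iff[where 'b = 'n])

lemma KC_orbitI: "A \<in> SL2 \<Longrightarrow> (\<And>i. e $ i \<noteq> 0) \<Longrightarrow> pq_act y A e \<in> KC_orbit y"
  by (auto simp: KC_orbit_def)

lemma KC_orbit_refl: "y \<in> KC_orbit (y :: 'n::finite pq)"
  using KC_orbitI[of "mat 1" "\<chi> i. 1" y] by (simp add: pq_act_id SL2_def det_I)

lemma KC_orbit_trans:
  assumes "y' \<in> KC_orbit y" "y'' \<in> KC_orbit y'"
  shows "y'' \<in> KC_orbit (y :: 'n::finite pq)"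
proof -
  obtain A e where A: "A \<in> SL2" "\<And>i. e $ i \<noteq> 0" "y' = pq_act y A e"
    using assms(1) by (auto simp: KC_orbit_def)
  obtain B f where B: "B \<in> SL2" "\<And>i. f $ i \<noteq> 0" "y'' = pq_act y' B f"
    using assms(2) by (auto simp: KC_orbit_def)
  have "y'' = pq_act y (A ** B) (\<chi> i. e $ i * f $ i)"
    using A B SL2_invertible pq_act_pq_act by metis
  then show ?thesis using A B by (auto intro!: KC_orbitI SL2_mult)
qed

lemma KC_orbit_sym:
  assumes "y' \<in> KC_orbit y"
  shows "y \<in> KC_orbit (y' :: 'n::finite pq)"
proof -
  obtain A e where A: "A \<in> SL2" "\<And>i. e $ i \<noteq> 0" "y' = pq_act y A e"
    using assms(1) by (auto simp: KC_orbit_def)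
  have "pq_act y' (matrix_inv A) (\<chi> i. inverse (e $ i)) = pq_act y (mat 1) (\<chi> i. 1)"
    using A SL2_invertible[OF A(1)] by (simp add: pq_act_pq_act matrix_inv_mult)
  then have "y = pq_act y' (matrix_inv A) (\<chi> i. inverse (e $ i))" by (simp add: pq_act_id)
  moreover have "pq_act y' (matrix_inv A) (\<chi> i. inverse (e $ i)) \<in> KC_orbit y'"
    using A by (intro KC_orbitI SL2_inv) auto
  ultimately show ?thesis by simp
qed

lemma KC_orbit_eq_iff: "KC_orbit y' = KC_orbit y \<longleftrightarrow> y' \<in> KC_orbit (y :: 'n::finite pq)"
  using KC_orbit_refl KC_orbit_trans KC_orbit_sym by blast

lemma outer_pq_act:
  fixes y :: "'n::finite pq"
  assumes "e $ i \<noteq> 0"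
  shows "outer (snd (pq_act y A e) $ i) (fst (pq_act y A e) $ i) =
    matrix_inv A ** outer (snd y $ i) (fst y $ i) ** A"
  using assms by (simp add: outer_smult matrix_mult_outer vector_smult_assoc)

lemma matrix_mult_sum: "(A :: complex ^ 2 ^ 2) ** (\<Sum>i\<in>I. f i) ** B = (\<Sum>i\<in>I. A ** f i ** (B :: complex ^ 2 ^ 2))"
proof (induction I rule: infinite_finite_induct)
  case (insert i I)
  have "A ** (X + Y) ** B = A ** X ** B + A ** Y ** B" for X Y
    by (simp add: vec_eq_iff matrix_matrix_mult_def sum_2 algebra_simps)
  with insert show ?case by simp
qed (auto simp: vec_eq_iff matrix_matrix_mult_def)

text \<open>
  For nonzero \<open>p\<^sub>i\<close>, \<open>q\<^sub>i\<close> the condition \<open>p\<^sub>i q\<^sub>i = 0\<close> is equivalent to \<open>(q\<^sub>i p\<^sub>i)\<^sup>2 = 0\<close>, which is invariant under conjugation.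
\<close>

lemma pq_act_stable:
  fixes y :: "'n::finite pq"
  assumes y: "y \<in> mu_complex_stable" and A: "A \<in> SL2" and e: "\<And>i. e $ i \<noteq> 0"
  shows "pq_act y A e \<in> mu_complex_stable"
proof -
  note inv = SL2_invertible[OF A]
  note st = mu_complex_stableD[OF y]
  let ?y = "pq_act y A e"
  have nz: "snd ?y $ i \<noteq> 0" for i
    using e st(2)[of i] by (simp add: invertible_mult_vec_eq_0 inv)
  have nz': "fst ?y $ i \<noteq> 0" for i
  proof
    assume "fst ?y $ i = 0"
    then have "fst y $ i v* A v* matrix_inv A = 0 v* matrix_inv A" using e by simp
    then show False using st(3)[of i] by (simp add: vector_matrix_mul_assoc matrix_inv_mult inv)
  qed
  have sp: "scalar_product (fst ?y $ i) (snd ?y $ i) = 0" for i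
  proof -
    have "outer (snd y $ i) (fst y $ i) ** outer (snd y $ i) (fst y $ i) = 0"
      unfolding matrix_mult_outer outer_mult_vec st(4) by (simp add: outer_eq_0_iff)
    then have "outer (snd ?y $ i) (fst ?y $ i) ** outer (snd ?y $ i) (fst ?y $ i) = 0"
      unfolding outer_pq_act[of e i y A, OF e]
      using matrix_inv_cancel(1)[OF inv]
      by (simp add: matrix_mul_assoc[symmetric])
        (simp add: matrix_mul_assoc)
    then show ?thesis
      unfolding matrix_mult_outer outer_mult_vec outer_eq_0_iff using nz[of i] nz'[of i] by auto
  qed
  have "(\<Sum>i\<in>UNIV. outer (snd ?y $ i) (fst ?y $ i)) =
      matrix_inv A ** (\<Sum>i\<in>UNIV. outer (snd y $ i) (fst y $ i)) ** A"
    unfolding outer_pq_act[of e _ y A, OF e]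
    by (simp add: matrix_mult_sum)
  then have "(\<Sum>i\<in>UNIV. outer (snd ?y $ i) (fst ?y $ i)) = 0" using st(5) by simp
  moreover have "\<not> (\<forall>i j. \<exists>c. snd ?y $ j = c *s snd ?y $ i)"
  proof
    assume *: "\<forall>i j. \<exists>c. snd ?y $ j = c *s snd ?y $ i"
    have "\<exists>c. snd y $ j = c *s snd y $ i" for i j
    proof -
      obtain c where "snd ?y $ j = c *s snd ?y $ i" using * by blast
      then have "A *v snd ?y $ j = A *v (c *s snd ?y $ i)" by simp
      then have "e $ j *s snd y $ j = (c * e $ i) *s snd y $ i"
        by (simp add: smult_mult_vec matrix_inv_cancel inv vector_smult_assoc)
      then have "inverse (e $ j) *s (e $ j *s snd y $ j) = inverse (e $ j) *s ((c * e $ i) *s snd y $ i)"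
        by simp
      then show ?thesis using e by (auto simp: vector_smult_assoc)
    qed
    then show False using st(6) by blast
  qed
  ultimately show ?thesis
    using nz nz' sp mu_complex_zero_iff[of "fst ?y" "snd ?y"]
    by (cases ?y) (simp add: mu_complex_stable_def)
qed

lemma KC_orbit_stable: "y \<in> mu_complex_stable \<Longrightarrow> y' \<in> KC_orbit y \<Longrightarrow> y' \<in> mu_complex_stable"
  by (auto simp: KC_orbit_def intro: pq_act_stable)

lemma trivial_bundle_iso_const:
  assumes "bundle_iso trivial_bundle trivial_bundle \<psi>"
  shows "\<psi> z = \<psi> Infty"
proof -
  have "mat_analytic (\<lambda>u. \<psi> (loc y u))" for y
    using bundle_isoD(2)[OF assms, of UNIV "\<lambda>y. mat 1" y] by (simp add: trivial_bundle_def)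
  then have "hol_cp1 UNIV (\<lambda>y. \<psi> y $ i $ j)" for i j
    by (simp add: hol_cp1_def o_def mat_analytic_def)
  from hol_cp1_UNIV_constant[OF this] show ?thesis by (simp add: vec_eq_iff)
qed

text \<open>
  Dividing \<open>P\<close> by a square root \<open>c\<close> of its determinant gives an element of \<open>SL\<^sub>2\<close>; the scalars \<open>e\<^sub>i\<close> absorb
  the factor.
\<close>

lemma KC_orbit_GL2I:
  fixes y y' :: "'n::finite pq"
  assumes P: "invertible P" and a: "\<And>i. a i \<noteq> 0" "\<And>i. snd y' $ i = a i *s (P *v snd y $ i)"
    and p: "\<And>i. a i *s fst y' $ i = fst y $ i v* matrix_inv P"
  shows "y' \<in> KC_orbit y"
proof -
  define c where "c = csqrt (det P)"
  have c: "c\<^sup>2 = det P" "c \<noteq> 0" using P by (auto simp: c_def invertible_det_nz)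
  define A where "A = mat c ** matrix_inv P"
  have mat_c: "mat c ** mat (inverse c) = (mat 1 :: complex ^ 2 ^ 2)"
    using c(2) by (simp add: vec_eq_iff forall_2 matrix_matrix_mult_def sum_2 mat_def)
  have det_inv: "det P * det (matrix_inv P) = 1"
    using P by (simp add: matrix_inv_mult det_I flip: det_mul)
  have "det A = c\<^sup>2 * det (matrix_inv P)"
    by (simp add: A_def det_mul) (simp add: det_2 mat_def power2_eq_square)
  then have A: "A \<in> SL2" using det_inv by (simp add: SL2_def c)
  have A_inv: "matrix_inv A = P ** mat (inverse c)"
  proof (rule matrix_inv_eqI)
    have "A ** (P ** mat (inverse c)) = mat c ** (matrix_inv P ** P) ** mat (inverse c)"
      by (simp add: A_def matrix_mul_assoc)
    then show "A ** (P ** mat (inverse c)) = mat 1" by (simp add: matrix_inv_mult P mat_c)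
  qed
  have mat_vec: "mat a *v v = a *s v" "v v* mat a = a *s v" for a and v :: "complex ^ 2"
    by (simp_all add: vec_eq_iff forall_2 matrix_vector_mult_def vector_matrix_mult_def sum_2 mat_def)
  let ?e = "\<chi> i. a i * c"
  have "y' = pq_act y A ?e"
  proof (rule prod_eqI)
    show "fst y' = fst (pq_act y A ?e)"
    proof (subst vec_eq_iff, rule allI)
      fix i
      have "fst y' $ i = inverse (a i) *s (a i *s fst y' $ i)" using a(1) by (simp add: vector_smult_assoc)
      also have "\<dots> = inverse (a i) *s (fst y $ i v* matrix_inv P)" by (simp only: p)
      also have "\<dots> = inverse (a i * c) *s (fst y $ i v* mat c v* matrix_inv P)"
        using c(2) a(1) by (simp add: mat_vec vec_mult_smult vector_smult_assoc)
      finally show "fst y' $ i = fst (pq_act y A ?e) $ i"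
        by (simp add: A_def vector_matrix_mul_assoc)
    qed
    show "snd y' = snd (pq_act y A ?e)"
    proof (subst vec_eq_iff, rule allI)
      fix i
      have "matrix_inv A *v snd y $ i = inverse c *s (P *v snd y $ i)"
        by (simp add: A_inv mat_vec smult_mult_vec flip: matrix_vector_mul_assoc)
      then show "snd y' $ i = snd (pq_act y A ?e) $ i"
        using a c(2) by (simp add: vector_smult_assoc)
    qed
  qed
  then show ?thesis using A a(1) c(2) by (auto intro!: KC_orbitI)
qed

text \<open>
  An isomorphism between trivial bundles is a constant matrix \<open>P\<close>.  It conjugates the Higgs fields off
  the marked points, therefore also the residues.
\<close>

lemma higgs_iso_imp_KC_orbit:
  fixes x :: "'n::finite \<Rightarrow> cp1"
  assumes x: "inj x" and y: "y \<in> mu_complex_stable" and y': "y' \<in> mu_complex_stable"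
    and iso: "higgs_iso (range x) (higgs_of x y) (higgs_of x y')"
  shows "y' \<in> KC_orbit y"
proof -
  obtain \<psi> where \<psi>: "bundle_iso trivial_bundle trivial_bundle \<psi>"
    "\<And>i. (\<lambda>v. \<psi> (x i) *v v) ` flag (higgs_of x y) (x i) = flag (higgs_of x y') (x i)"
    "\<And>z. z \<notin> range x \<Longrightarrow> \<psi> z ** field (higgs_of x y) z = field (higgs_of x y') z ** \<psi> z"
    using iso unfolding higgs_iso_def by auto
  define P where "P = \<psi> Infty"
  have \<psi>P: "\<psi> = (\<lambda>z. P)" using trivial_bundle_iso_const[OF \<psi>(1)] by (auto simp: P_def)
  have P: "invertible P" unfolding P_def by (rule bundle_isoD(1)[OF \<psi>(1)])
  note st = mu_complex_stableD[OF y] and st' = mu_complex_stableD[OF y']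
  let ?\<Phi>' = "\<lambda>z. matrix_inv (\<psi> z) ** field (higgs_of x y') z ** \<psi> z"
  have eq: "?\<Phi>' z = field (higgs_of x y) z" if "z \<notin> range x" for z
    using \<psi>(3)[OF that] P unfolding \<psi>P by (metis matrix_inv_cancel(2) matrix_mul_assoc)
  have res: "outer (snd y' $ i) (fst y' $ i) = P ** outer (snd y $ i) (fst y $ i) ** matrix_inv P" for i
  proof -
    have "outer (snd y' $ i) (fst y' $ i) = trivial_res (field (higgs_of x y')) (x i)"
      using higgs_res_higgs_of(1)[OF x st'(1)] by (simp add: higgs_res_trivial)
    also have "\<dots> = P ** trivial_res ?\<Phi>' (x i) ** matrix_inv P"
      using trivialized_field(2)[OF hol_bundle_trivial \<psi>(1) higgs_res_higgs_of(2)[OF x st'(1)], of "x i" UNIV "\<lambda>z. mat 1"]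
      by (simp add: trivial_bundle_def local_entry_trivial trivial_res_def \<psi>P)
    also have "trivial_res ?\<Phi>' (x i) = trivial_res (field (higgs_of x y)) (x i)"
      unfolding trivial_res_def
    proof (intro vec_eq_iff[THEN iffD2] allI, simp only: vec_lambda_beta, rule residue_cong[OF _ refl])
      fix r s
      show "\<forall>\<^sub>F t in at 0. jac (x i) t * ?\<Phi>' (loc (x i) t) $ r $ s = jac (x i) t * field (higgs_of x y) (loc (x i) t) $ r $ s"
        using eventually_loc_notin[of "range x" "x i", simplified] by eventually_elim (drule eq, simp only:)
    qed
    also have "\<dots> = outer (snd y $ i) (fst y $ i)"
      using higgs_res_higgs_of(1)[OF x st(1)] by (simp add: higgs_res_trivial)
    finally show ?thesis .
  qed
  have "\<exists>a. a \<noteq> 0 \<and> snd y' $ i = a *s (P *v snd y $ i)" for i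
  proof -
    have "vec.span {P *v snd y $ i} = vec.span {snd y' $ i}"
      using \<psi>(2)[of i] x by (simp add: \<psi>P image_span_single)
    then have "snd y' $ i \<in> vec.span {P *v snd y $ i}" by (simp add: vec.span_base)
    then show ?thesis using st'(2)[of i] by (auto simp: span_single)
  qed
  then obtain a where a: "\<And>i. a i \<noteq> 0" "\<And>i. snd y' $ i = a i *s (P *v snd y $ i)" by metis
  have p: "a i *s fst y' $ i = fst y $ i v* matrix_inv P" for i
  proof (rule outer_cancel)
    show "outer (P *v snd y $ i) (a i *s fst y' $ i) = outer (P *v snd y $ i) (fst y $ i v* matrix_inv P)"
      using res[of i] unfolding a(2) by (simp add: outer_smult matrix_mult_outer)
    show "P *v snd y $ i \<noteq> 0" using st(2) P by (simp add: invertible_mult_vec_eq_0)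
  qed
  show ?thesis by (rule KC_orbit_GL2I[OF P a p])
qed

lemma KC_orbit_imp_higgs_iso:
  fixes x :: "'n::finite \<Rightarrow> cp1"
  assumes x: "inj x" and y: "y \<in> mu_complex_stable" and y': "y' \<in> KC_orbit y"
  shows "higgs_iso (range x) (higgs_of x y) (higgs_of x y')"
proof -
  obtain A e where A: "A \<in> SL2" "\<And>i. e $ i \<noteq> 0" "y' = pq_act y A e"
    using y' by (auto simp: KC_orbit_def)
  note inv = SL2_invertible[OF A(1)]
  have st': "y' \<in> mu_complex_stable" by (rule KC_orbit_stable[OF y y'])
  have "higgs_iso (range x) (higgs_of x (fst y, snd y)) (higgs_of x y')"
  proof (rule stable_higgs_representative(2)[where \<psi> = "\<lambda>z. matrix_inv A", OF x higgs_of_in_stable_trivial[OF x st']])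
    show "bundle_iso trivial_bundle (frames (higgs_of x y')) (\<lambda>z. matrix_inv A)"
      by (simp add: bundle_iso_trivial inv)
    show "snd y $ i \<noteq> 0" for i by (rule mu_complex_stableD(2)[OF y])
    show "flag (higgs_of x y') (x i) = (\<lambda>v. matrix_inv A *v v) ` vec.span {snd y $ i}" for i
    proof -
      have "snd y' $ i \<in> vec.span {matrix_inv A *v snd y $ i}" by (auto simp: A(3) span_single)
      from span_single_eq[OF this mu_complex_stableD(2)[OF st']] show ?thesis
        using x by (simp add: image_span_single)
    qed
    show "higgs_res (higgs_of x y') (x i) =
        matrix_inv A ** outer (snd y $ i) (fst y $ i) ** matrix_inv (matrix_inv A)" for i
      using higgs_res_higgs_of(1)[OF x mu_complex_stableD(1)[OF st']] outer_pq_act[of e i y A, OF A(2)] inv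
      by (simp add: A(3))
  qed
  then show ?thesis by simp
qed

definition higgs_rel :: "cp1 set \<Rightarrow> (higgs_data \<times> higgs_data) set" where
  "higgs_rel D = {(\<H>, \<H>'). \<H> \<in> stable_trivial D \<and> \<H>' \<in> stable_trivial D \<and> higgs_iso D \<H> \<H>'}"

lemma stable_trivial_bundle: "\<H> \<in> stable_trivial D \<Longrightarrow> hol_bundle (frames \<H>)"
  by (simp add: stable_trivial_def sl2_higgs_def quasi_parabolic_higgs_def)

lemma bundle_iso_alt:
  "bundle_iso E E' \<psi> \<longleftrightarrow> (\<forall>x. invertible (\<psi> x)) \<and>
     (\<forall>U g V h y. (U, g) \<in> E \<longrightarrow> (V, h) \<in> E' \<longrightarrow> y \<in> U \<longrightarrow> y \<in> V \<longrightarrow>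
        mat_analytic (\<lambda>u. matrix_inv (h (loc y u)) ** \<psi> (loc y u) ** g (loc y u)))"
proof -
  have "(\<forall>(U, g)\<in>E. \<forall>(V, h)\<in>E'. P U g V h) \<longleftrightarrow>
      (\<forall>U g V h. (U, g) \<in> E \<longrightarrow> (V, h) \<in> E' \<longrightarrow> P U g V h)" for P
    by (simp add: Ball_def split_paired_all)
  then show ?thesis unfolding bundle_iso_def hol_mat_cp1_iff by (simp, blast)
qed

lemma bundle_iso_sym:
  assumes E: "hol_bundle E" "hol_bundle E'" and iso: "bundle_iso E E' \<psi>"
  shows "bundle_iso E' E (\<lambda>z. matrix_inv (\<psi> z))"
  unfolding bundle_iso_alt
proof (intro conjI allI impI)
  have inv: "invertible (\<psi> z)" for z using iso by (simp add: bundle_iso_def)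
  then show "invertible (matrix_inv (\<psi> z))" for z by simp
  fix U g V h y assume *: "(U, g) \<in> E'" "(V, h) \<in> E" "y \<in> U" "y \<in> V"
  let ?M = "\<lambda>u. matrix_inv (g (loc y u)) ** \<psi> (loc y u) ** h (loc y u)"
  have M: "mat_analytic ?M" using iso * unfolding bundle_iso_alt by blast
  have "invertible (?M 0)"
    using hol_bundleD(3)[OF E(2) *(1,3)] hol_bundleD(3)[OF E(1) *(2,4)] inv
    by (simp add: invertible_mult)
  note Mi = mat_analytic_inv[OF M this]
  show "mat_analytic (\<lambda>u. matrix_inv (h (loc y u)) ** matrix_inv (\<psi> (loc y u)) ** g (loc y u))"
  proof (rule mat_analytic_cong[OF Mi])
    show "\<forall>\<^sub>F u in nhds 0. matrix_inv (?M u) = matrix_inv (h (loc y u)) ** matrix_inv (\<psi> (loc y u)) ** g (loc y u)"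
      using open_cp1_eventually[OF hol_bundleD(2)[OF E(2) *(1)] *(3)]
        open_cp1_eventually[OF hol_bundleD(2)[OF E(1) *(2)] *(4)]
    proof eventually_elim
      case (elim u)
      then show ?case
        using hol_bundleD(3)[OF E(2) *(1)] hol_bundleD(3)[OF E(1) *(2)] inv
        by (simp add: matrix_inv_prod invertible_mult matrix_mul_assoc)
    qed
  qed
qed

lemma bundle_iso_trans:
  assumes E: "hol_bundle E'" and iso: "bundle_iso E E' \<psi>" "bundle_iso E' E'' \<psi>'"
  shows "bundle_iso E E'' (\<lambda>z. \<psi>' z ** \<psi> z)"
  unfolding bundle_iso_alt
proof (intro conjI allI impI)
  show "invertible (\<psi>' z ** \<psi> z)" for z
    using iso by (simp add: bundle_iso_def invertible_mult)
  fix U g V h y assume *: "(U, g) \<in> E" "(V, h) \<in> E''" "y \<in> U" "y \<in> V"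
  obtain W k where k: "(W, k) \<in> E'" "y \<in> W" using hol_bundleD(1)[OF E] by blast
  have "mat_analytic (\<lambda>u. (matrix_inv (h (loc y u)) ** \<psi>' (loc y u) ** k (loc y u)) **
      (matrix_inv (k (loc y u)) ** \<psi> (loc y u) ** g (loc y u)))"
  proof (rule mat_analytic_mult)
    show "mat_analytic (\<lambda>u. matrix_inv (h (loc y u)) ** \<psi>' (loc y u) ** k (loc y u))"
      using iso(2) * k unfolding bundle_iso_alt by blast
    show "mat_analytic (\<lambda>u. matrix_inv (k (loc y u)) ** \<psi> (loc y u) ** g (loc y u))"
      using iso(1) * k unfolding bundle_iso_alt by blast
  qed
  then show "mat_analytic (\<lambda>u. matrix_inv (h (loc y u)) ** (\<psi>' (loc y u) ** \<psi> (loc y u)) ** g (loc y u))"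
  proof (rule mat_analytic_cong)
    show "\<forall>\<^sub>F u in nhds 0. (matrix_inv (h (loc y u)) ** \<psi>' (loc y u) ** k (loc y u)) **
      (matrix_inv (k (loc y u)) ** \<psi> (loc y u) ** g (loc y u)) =
      matrix_inv (h (loc y u)) ** (\<psi>' (loc y u) ** \<psi> (loc y u)) ** g (loc y u)"
      using open_cp1_eventually[OF hol_bundleD(2)[OF E k(1)] k(2)]
    proof eventually_elim
      case (elim u)
      then show ?case using hol_bundleD(3)[OF E k(1)]
        by (simp add: matrix_mul_assoc matrix_inv_cancel)
    qed
  qed
qed

text \<open>
  The maps \<open>1\<close>, \<open>\<psi>\<^sup>-\<^sup>1\<close> and \<open>\<psi>' \<psi>\<close> are isomorphisms.  For composites, holomorphy is tested by
  inserting a frame of the middle bundle.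
\<close>

lemma equiv_higgs_rel: "equiv (stable_trivial D) (higgs_rel D)"
proof (rule equivI)
  show "refl_on (stable_trivial D) (higgs_rel D)"
  proof (rule refl_onI)
    fix \<H> assume H: "\<H> \<in> stable_trivial D"
    have "bundle_iso (frames \<H>) (frames \<H>) (\<lambda>z. mat 1)"
      unfolding bundle_iso_alt using hol_bundleD(4)[OF stable_trivial_bundle[OF H]]
      by (auto simp: invertible_def)
    then have "higgs_iso D \<H> \<H>" unfolding higgs_iso_def by (intro exI[of _ "\<lambda>z. mat 1"]) simp
    then show "(\<H>, \<H>) \<in> higgs_rel D" using H by (simp add: higgs_rel_def)
  qed
  show "higgs_rel D \<subseteq> stable_trivial D \<times> stable_trivial D" by (auto simp: higgs_rel_def)
  show "sym (higgs_rel D)"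
  proof (rule symI)
    fix \<H> \<H>' assume "(\<H>, \<H>') \<in> higgs_rel D"
    then obtain \<psi> where H: "\<H> \<in> stable_trivial D" "\<H>' \<in> stable_trivial D"
      and \<psi>: "bundle_iso (frames \<H>) (frames \<H>') \<psi>"
      "\<And>z. z \<in> D \<Longrightarrow> (\<lambda>v. \<psi> z *v v) ` flag \<H> z = flag \<H>' z"
      "\<And>z. z \<notin> D \<Longrightarrow> \<psi> z ** field \<H> z = field \<H>' z ** \<psi> z"
      by (auto simp: higgs_rel_def higgs_iso_def)
    have inv: "invertible (\<psi> z)" for z using \<psi>(1) by (simp add: bundle_iso_def)
    have "higgs_iso D \<H>' \<H>"
      unfolding higgs_iso_def
    proof (intro exI conjI ballI allI impI)
      show "bundle_iso (frames \<H>') (frames \<H>) (\<lambda>z. matrix_inv (\<psi> z))"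
        by (intro bundle_iso_sym stable_trivial_bundle[of _ D] H \<psi>)
      show "(\<lambda>v. matrix_inv (\<psi> z) *v v) ` flag \<H>' z = flag \<H> z" if "z \<in> D" for z
        unfolding \<psi>(2)[OF that, symmetric] by (simp add: image_image matrix_inv_cancel inv)
      show "matrix_inv (\<psi> z) ** field \<H>' z = field \<H> z ** matrix_inv (\<psi> z)" if "z \<notin> D" for z
        using \<psi>(3)[OF that] inv by (metis matrix_inv_cancel(2,3) matrix_mul_assoc)
    qed
    then show "(\<H>', \<H>) \<in> higgs_rel D" using H by (simp add: higgs_rel_def)
  qed
  show "trans (higgs_rel D)"
  proof (rule transI)
    fix \<H> \<H>' \<H>'' assume "(\<H>, \<H>') \<in> higgs_rel D" "(\<H>', \<H>'') \<in> higgs_rel D"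
    then obtain \<psi> \<psi>' where H: "\<H> \<in> stable_trivial D" "\<H>' \<in> stable_trivial D" "\<H>'' \<in> stable_trivial D"
      and \<psi>: "bundle_iso (frames \<H>) (frames \<H>') \<psi>"
      "\<And>z. z \<in> D \<Longrightarrow> (\<lambda>v. \<psi> z *v v) ` flag \<H> z = flag \<H>' z"
      "\<And>z. z \<notin> D \<Longrightarrow> \<psi> z ** field \<H> z = field \<H>' z ** \<psi> z"
      and \<psi>': "bundle_iso (frames \<H>') (frames \<H>'') \<psi>'"
      "\<And>z. z \<in> D \<Longrightarrow> (\<lambda>v. \<psi>' z *v v) ` flag \<H>' z = flag \<H>'' z"
      "\<And>z. z \<notin> D \<Longrightarrow> \<psi>' z ** field \<H>' z = field \<H>'' z ** \<psi>' z"
      by (auto simp: higgs_rel_def higgs_iso_def)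
    have "higgs_iso D \<H> \<H>''"
      unfolding higgs_iso_def
    proof (intro exI conjI ballI allI impI)
      show "bundle_iso (frames \<H>) (frames \<H>'') (\<lambda>z. \<psi>' z ** \<psi> z)"
        by (rule bundle_iso_trans[OF stable_trivial_bundle[OF H(2)] \<psi>(1) \<psi>'(1)])
      show "(\<lambda>v. (\<psi>' z ** \<psi> z) *v v) ` flag \<H> z = flag \<H>'' z" if "z \<in> D" for z
        unfolding \<psi>'(2)[OF that, symmetric] \<psi>(2)[OF that, symmetric]
        by (simp add: image_image matrix_vector_mul_assoc)
      show "\<psi>' z ** \<psi> z ** field \<H> z = field \<H>'' z ** (\<psi>' z ** \<psi> z)" if "z \<notin> D" for z
        using \<psi>(3)[OF that] \<psi>'(3)[OF that] by (metis matrix_mul_assoc)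
    qed
    then show "(\<H>, \<H>'') \<in> higgs_rel D" using H by (simp add: higgs_rel_def)
  qed
qed

definition higgs_class :: "('n::finite \<Rightarrow> cp1) \<Rightarrow> 'n pq \<Rightarrow> higgs_data set" where
  "higgs_class x y = higgs_rel (range x) `` {higgs_of x y}"

lemma H0_eq: "H0 D = stable_trivial D // higgs_rel D"
  by (simp add: H0_def higgs_rel_def)

lemma higgs_class_eq_iff:
  fixes x :: "'n::finite \<Rightarrow> cp1"
  assumes x: "inj x" and y: "y \<in> mu_complex_stable" "y' \<in> mu_complex_stable"
  shows "higgs_class x y = higgs_class x y' \<longleftrightarrow> y' \<in> KC_orbit y"
proof -
  have "higgs_class x y = higgs_class x y' \<longleftrightarrow> (higgs_of x y, higgs_of x y') \<in> higgs_rel (range x)"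
    unfolding higgs_class_def
    using higgs_of_in_stable_trivial[OF x] y by (intro eq_equiv_class_iff[OF equiv_higgs_rel]) auto
  also have "\<dots> \<longleftrightarrow> y' \<in> KC_orbit y"
    using higgs_of_in_stable_trivial[OF x y(1)] higgs_of_in_stable_trivial[OF x y(2)]
      higgs_iso_imp_KC_orbit[OF x y] KC_orbit_imp_higgs_iso[OF x y(1), of y']
    unfolding higgs_rel_def by blast
  finally show ?thesis .
qed

lemma H0_eq_image:
  fixes x :: "'n::finite \<Rightarrow> cp1"
  assumes x: "inj x"
  shows "H0 (range x) = higgs_class x ` mu_complex_stable"
proof
  show "higgs_class x ` mu_complex_stable \<subseteq> H0 (range x)"
    unfolding H0_eq higgs_class_def using higgs_of_in_stable_trivial[OF x] by (auto intro: quotientI)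
  show "H0 (range x) \<subseteq> higgs_class x ` mu_complex_stable"
  proof
    fix c assume "c \<in> H0 (range x)"
    then obtain \<H> where H: "\<H> \<in> stable_trivial (range x)" "c = higgs_rel (range x) `` {\<H>}"
      unfolding H0_eq by (auto elim: quotientE)
    obtain y where y: "y \<in> mu_complex_stable" "higgs_iso (range x) (higgs_of x y) \<H>"
      using stable_trivial_representative[OF x H(1)] .
    then have "(higgs_of x y, \<H>) \<in> higgs_rel (range x)"
      using H higgs_of_in_stable_trivial[OF x] by (simp add: higgs_rel_def)
    then have "higgs_class x y = c"
      unfolding higgs_class_def H(2) by (rule equiv_class_eq[OF equiv_higgs_rel])
    then show "c \<in> higgs_class x ` mu_complex_stable" using y by blast
  qed
qed

text \<open>
  A Higgs bundle with trivial frames is determined up to isomorphism by its flags and residues: this is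
  \<open>stable_higgs_representative\<close> with the trivialisation \<open>\<psi> = 1\<close>.
\<close>

theorem corresponds_iff:
  fixes x :: "'n::finite \<Rightarrow> cp1" and y :: "'n pq"
  assumes x: "inj x" and nz: "\<And>i. snd y $ i \<noteq> 0"
  shows "corresponds x y c \<longleftrightarrow> y \<in> mu_complex_stable \<and> c = higgs_class x y"
proof
  assume "corresponds x y c"
  then obtain \<H> where c: "c \<in> H0 (range x)" and H: "\<H> \<in> c" "frames \<H> = trivial_bundle"
    "\<And>i. flag \<H> (x i) = vec.span {snd y $ i}" "\<And>i. higgs_res \<H> (x i) = outer (snd y $ i) (fst y $ i)"
    by (auto simp: corresponds_def)
  have "\<H> \<in> stable_trivial (range x)"
    using c H(1) equiv_higgs_rel unfolding H0_eq by (meson in_quotient_imp_subset subsetD)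
  note rep = stable_higgs_representative[OF x this, of "\<lambda>z. mat 1" "snd y" "fst y"]
  have y: "y \<in> mu_complex_stable" "higgs_iso (range x) (higgs_of x y) \<H>"
    using rep H nz bundle_iso_trivial[of "mat 1"] by (auto simp: invertible_def)
  then have "(higgs_of x y, \<H>) \<in> higgs_rel (range x)"
    using \<open>\<H> \<in> stable_trivial (range x)\<close> higgs_of_in_stable_trivial[OF x] by (simp add: higgs_rel_def)
  moreover have "c = higgs_rel (range x) `` {\<H>}"
    using c H(1) equiv_higgs_rel unfolding H0_eq by (metis quotientE Image_singleton_iff equiv_class_eq)
  ultimately have "c = higgs_class x y"
    unfolding higgs_class_def using equiv_class_eq[OF equiv_higgs_rel] by blast
  with y show "y \<in> mu_complex_stable \<and> c = higgs_class x y" by blast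
next
  assume y: "y \<in> mu_complex_stable \<and> c = higgs_class x y"
  then have "higgs_of x y \<in> c"
    using higgs_of_in_stable_trivial[OF x] equiv_class_self[OF equiv_higgs_rel] by (simp add: higgs_class_def)
  moreover have "c \<in> H0 (range x)" using y H0_eq_image[OF x] by blast
  ultimately show "corresponds x y c"
    unfolding corresponds_def using x higgs_res_higgs_of(1)[OF x mu_complex_stableD(1)] y
    by (intro conjI bexI[of _ "higgs_of x y"]) auto
qed

section \<open>Every stable orbit meets the zero level of the real moment map\<close>

text \<open>
  The row vector with \<open>perp q v = det (q, v)\<close>; it spans the annihilator of \<open>q\<close> if \<open>q \<noteq> 0\<close>.
\<close>

definition perp :: "complex ^ 2 \<Rightarrow> complex ^ 2" where
  "perp q = vector [- q $ 2, q $ 1]"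

lemma perp_nth [simp]: "perp q $ 1 = - q $ 2" "perp q $ 2 = q $ 1"
  by (simp_all add: perp_def)

lemma norm_2: "norm (v :: complex ^ 2) = sqrt ((cmod (v $ 1))\<^sup>2 + (cmod (v $ 2))\<^sup>2)"
  by (simp add: norm_vec_def L2_set_def sum_2)

lemma norm_perp [simp]: "norm (perp q) = norm q"
  by (simp add: norm_2 add.commute)

lemma norm_smult: "norm (c *s (v :: complex ^ 2)) = cmod c * norm v"
proof -
  have "norm (c *s v) = sqrt ((cmod c)\<^sup>2 * ((cmod (v $ 1))\<^sup>2 + (cmod (v $ 2))\<^sup>2))"
    by (simp add: norm_2 norm_mult power_mult_distrib distrib_left)
  then show ?thesis by (simp add: norm_2 real_sqrt_mult)
qed

lemma scalar_product_0_perp: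
  assumes "scalar_product p q = 0" "q \<noteq> 0"
  obtains t where "p = t *s perp q"
proof -
  have 0: "p $ 1 * q $ 1 + p $ 2 * q $ 2 = 0" using assms(1) by (simp add: scalar_product_def sum_2)
  show thesis
  proof (cases "q $ 1 = 0")
    case True
    then have "q $ 2 \<noteq> 0" using assms(2) by (simp add: vec_eq_iff forall_2)
    then show thesis using 0 True by (intro that[of "- p $ 1 / q $ 2"]) (simp add: vec_eq_iff forall_2)
  next
    case False
    then show thesis using 0
      by (intro that[of "p $ 2 / q $ 1"]) (simp add: vec_eq_iff forall_2 field_simps eq_neg_iff_add_eq_0)
  qed
qed

lemma sum_traceless_eq_0:
  fixes f g h :: "'n::finite \<Rightarrow> complex"
  shows "(\<Sum>i\<in>UNIV. (\<chi> r s. if r = 1 then (if s = 1 then f i else g i) else (if s = 1 then h i else - f i)) :: complex ^ 2 ^ 2) = 0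
    \<longleftrightarrow> (\<Sum>i\<in>UNIV. f i) = 0 \<and> (\<Sum>i\<in>UNIV. g i) = 0 \<and> (\<Sum>i\<in>UNIV. h i) = 0"
  by (auto simp: vec_eq_iff forall_2 sum_negf)

text \<open>
  If \<open>p = t perp q\<close> with \<open>|t| = 1\<close>, then \<open>p\<^sup>* p = |q|\<^sup>2 1 - q q\<^sup>*\<close>.  So the \<open>SU(2)\<close> part of the real moment
  map vanishes if and only if \<open>\<Sum>\<^sub>i q\<^sub>i q\<^sub>i\<^sup>*\<close> is scalar, which the two sums express.
\<close>

lemma P0_iff:
  fixes y :: "'n::finite pq"
  shows "y \<in> P0 \<longleftrightarrow> y \<in> mu_complex_zero \<and> (\<forall>i. norm (fst y $ i) = norm (snd y $ i) \<and> snd y $ i \<noteq> 0) \<and>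
    (\<Sum>i\<in>UNIV. (cmod (snd y $ i $ 1))\<^sup>2) = (\<Sum>i\<in>UNIV. (cmod (snd y $ i $ 2))\<^sup>2) \<and>
    (\<Sum>i\<in>UNIV. snd y $ i $ 1 * cnj (snd y $ i $ 2)) = 0"
proof -
  obtain p q where y: "y = (p, q)" by (cases y)
  define c where "c = (\<lambda>i. q $ i $ 1)"
  define d where "d = (\<lambda>i. q $ i $ 2)"
  have nz: "(norm (p $ i))\<^sup>2 + (norm (q $ i))\<^sup>2 \<noteq> 0 \<longleftrightarrow> q $ i \<noteq> 0" if "norm (q $ i) = norm (p $ i)" for i
    using that[symmetric] by (simp add: sum_power2_eq_zero_iff)
  have term1: "traceless (outer (q $ i) (conj_vec (q $ i)) - outer (conj_vec (p $ i)) (p $ i)) =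
      (\<chi> r s. if r = 1 then (if s = 1 then of_real ((cmod (c i))\<^sup>2 - (cmod (d i))\<^sup>2) else 2 * (c i * cnj (d i)))
        else (if s = 1 then 2 * cnj (c i * cnj (d i)) else - of_real ((cmod (c i))\<^sup>2 - (cmod (d i))\<^sup>2)))"
    if h: "(p, q) \<in> mu_complex_zero" "norm (q $ i) = norm (p $ i)" "q $ i \<noteq> 0" for i
  proof -
    have "scalar_product (p $ i) (q $ i) = 0" using h(1) by (simp add: mu_complex_zero_def)
    then obtain t where t: "p $ i = t *s perp (q $ i)" using scalar_product_0_perp h(3) by blast
    have "cmod t = 1" using h(2,3) unfolding t norm_smult by simp
    then have tt: "cnj t * t = 1" "t * cnj t = 1"
      using complex_norm_square[of t] by (simp_all add: mult.commute)
    have tt': "cnj t * (t * z) = z" "t * (cnj t * z) = z" for z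
      using tt by (simp_all flip: mult.assoc)
    show ?thesis
      unfolding t traceless_def
      by (simp add: vec_eq_iff forall_2 outer_def conj_vec_def trace_def sum_2 mat_def c_def d_def
          complex_norm_square[unfolded of_real_power] tt tt' algebra_simps)
  qed
  have "(\<Sum>i\<in>UNIV. traceless (outer (q $ i) (conj_vec (q $ i)) - outer (conj_vec (p $ i)) (p $ i))) = 0 \<longleftrightarrow>
      (\<Sum>i\<in>UNIV. (cmod (c i))\<^sup>2) = (\<Sum>i\<in>UNIV. (cmod (d i))\<^sup>2) \<and> (\<Sum>i\<in>UNIV. c i * cnj (d i)) = 0"
    if "(p, q) \<in> mu_complex_zero" "\<And>i. norm (q $ i) = norm (p $ i)" "\<And>i. q $ i \<noteq> 0"
  proof -
    have "(\<Sum>i\<in>UNIV. traceless (outer (q $ i) (conj_vec (q $ i)) - outer (conj_vec (p $ i)) (p $ i))) = 0 \<longleftrightarrow>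
      (\<Sum>i\<in>UNIV. of_real ((cmod (c i))\<^sup>2 - (cmod (d i))\<^sup>2)) = (0::complex) \<and>
      (\<Sum>i\<in>UNIV. 2 * (c i * cnj (d i))) = 0 \<and> (\<Sum>i\<in>UNIV. 2 * cnj (c i * cnj (d i))) = 0"
      unfolding term1[OF that] by (rule sum_traceless_eq_0)
    also have "\<dots> \<longleftrightarrow> of_real (\<Sum>i\<in>UNIV. (cmod (c i))\<^sup>2 - (cmod (d i))\<^sup>2) = (0::complex) \<and>
      2 * (\<Sum>i\<in>UNIV. c i * cnj (d i)) = 0 \<and> 2 * cnj (\<Sum>i\<in>UNIV. c i * cnj (d i)) = 0"
      unfolding of_real_sum sum_distrib_left cnj_sum ..
    finally have "(\<Sum>i\<in>UNIV. traceless (outer (q $ i) (conj_vec (q $ i)) - outer (conj_vec (p $ i)) (p $ i))) = 0 \<longleftrightarrow>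
      of_real (\<Sum>i\<in>UNIV. (cmod (c i))\<^sup>2 - (cmod (d i))\<^sup>2) = (0::complex) \<and>
      2 * (\<Sum>i\<in>UNIV. c i * cnj (d i)) = 0 \<and> 2 * cnj (\<Sum>i\<in>UNIV. c i * cnj (d i)) = 0" .
    then show ?thesis unfolding of_real_eq_0_iff by (auto simp: sum_subtractf simp del: cnj_sum)
  qed
  then show ?thesis
    unfolding y P0_def mu_real_zero_def using nz by (auto simp: c_def d_def)
qed

text \<open>
  The modulus of the factor \<open>t\<^sub>i\<close> in \<open>p\<^sub>i = t\<^sub>i perp q\<^sub>i\<close>.
\<close>

definition tau :: "'n::finite pq \<Rightarrow> 'n \<Rightarrow> real" where
  "tau y i = norm (fst y $ i) / norm (snd y $ i)"

text \<open>
  The next three functions are the entries of \<open>Q = \<Sum>\<^sub>i tau\<^sub>i q\<^sub>i q\<^sub>i\<^sup>*\<close>.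
\<close>

definition gram11 :: "'n::finite pq \<Rightarrow> real" where
  "gram11 y = (\<Sum>i\<in>UNIV. tau y i * (cmod (snd y $ i $ 1))\<^sup>2)"

definition gram22 :: "'n::finite pq \<Rightarrow> real" where
  "gram22 y = (\<Sum>i\<in>UNIV. tau y i * (cmod (snd y $ i $ 2))\<^sup>2)"

definition gram12 :: "'n::finite pq \<Rightarrow> complex" where
  "gram12 y = (\<Sum>i\<in>UNIV. of_real (tau y i) * (snd y $ i $ 1 * cnj (snd y $ i $ 2)))"

text \<open>
  The square root of \<open>det Q\<close>.
\<close>

definition gram_root :: "'n::finite pq \<Rightarrow> real" where
  "gram_root y = sqrt (gram11 y * gram22 y - (cmod (gram12 y))\<^sup>2)"

text \<open>
  The upper triangular matrix \<open>A\<close> with rows \<open>(chol_a, chol_b)\<close> and \<open>(0, 1 / chol_a)\<close> satisfies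
  \<open>A A\<^sup>* = Q / sqrt (det Q)\<close>.
\<close>

definition chol_a :: "'n::finite pq \<Rightarrow> real" where
  "chol_a y = sqrt (gram_root y / gram22 y)"

definition chol_b :: "'n::finite pq \<Rightarrow> complex" where
  "chol_b y = of_real (chol_a y / gram_root y) * gram12 y"

text \<open>
  The image of \<open>y\<close> under \<open>A\<close> and \<open>e\<^sub>i = sqrt tau\<^sub>i\<close>, written in entries so that continuity is visible.
\<close>

definition balanced :: "'n::finite pq \<Rightarrow> 'n pq" where
  "balanced y =
    ((\<chi> i k. if k = 1 then of_real (chol_a y / sqrt (tau y i)) * fst y $ i $ 1
        else of_real (1 / sqrt (tau y i)) * (chol_b y * fst y $ i $ 1 + of_real (1 / chol_a y) * fst y $ i $ 2)),
     (\<chi> i k. if k = 1 then of_real (sqrt (tau y i)) * (of_real (1 / chol_a y) * snd y $ i $ 1 - chol_b y * snd y $ i $ 2)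
        else of_real (sqrt (tau y i) * chol_a y) * snd y $ i $ 2))"

text \<open>
  For \<open>u = 1\<close> this completes the square in \<open>Q\<close>; for \<open>u = 1 / chol_a\<close> and \<open>v = chol_b\<close> it computes the
  \<open>(1, 1)\<close> entry of \<open>A\<^sup>-\<^sup>1 Q A\<^sup>-\<^sup>*\<close>.
\<close>

lemma sum_cmod_diff_sq:
  fixes c d :: "'n::finite \<Rightarrow> complex" and t :: "'n \<Rightarrow> real"
  shows "(\<Sum>i\<in>UNIV. t i * (cmod (of_real u * c i - v * d i))\<^sup>2) =
    u\<^sup>2 * (\<Sum>i\<in>UNIV. t i * (cmod (c i))\<^sup>2) - 2 * u * Re (cnj v * (\<Sum>i\<in>UNIV. of_real (t i) * (c i * cnj (d i))))
    + (cmod v)\<^sup>2 * (\<Sum>i\<in>UNIV. t i * (cmod (d i))\<^sup>2)"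
proof -
  have "t i * (cmod (of_real u * c i - v * d i))\<^sup>2 = u\<^sup>2 * (t i * (cmod (c i))\<^sup>2)
      - 2 * u * Re (cnj v * (of_real (t i) * (c i * cnj (d i)))) + (cmod v)\<^sup>2 * (t i * (cmod (d i))\<^sup>2)" for i
    unfolding cmod_power2 by (simp add: power2_eq_square algebra_simps)
  then show ?thesis
    by (simp only: sum.distrib sum_subtractf sum_distrib_left Re_sum)
qed

text \<open>
  Strict Cauchy-Schwarz: with \<open>m = Q\<^sub>1\<^sub>2 / Q\<^sub>2\<^sub>2\<close>, the sum of the \<open>tau\<^sub>i |c\<^sub>i - m d\<^sub>i|\<^sup>2\<close> is \<open>det Q / Q\<^sub>2\<^sub>2\<close>, and it
  is positive because the \<open>q\<^sub>i = (c\<^sub>i, d\<^sub>i)\<close> do not all lie on the line through \<open>(m, 1)\<close>.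
\<close>

lemma gram_pos:
  fixes y :: "'n::finite pq"
  assumes y: "y \<in> mu_complex_stable"
  shows "tau y i > 0" "gram22 y > 0" "gram11 y * gram22 y - (cmod (gram12 y))\<^sup>2 > 0"
proof -
  note st = mu_complex_stableD[OF y]
  show tau: "tau y i > 0" for i using st(2,3)[of i] by (simp add: tau_def)
  have pos: "(\<Sum>i\<in>UNIV. tau y i * f i) > 0" if "\<And>i. f i \<ge> 0" "f k > 0" for f and k :: 'n
    using that tau by (intro sum_pos2[of _ k]) (auto simp: less_imp_le)
  obtain i where i: "snd y $ i \<notin> vec.span {vector [1, 0]}"
    using not_all_proportional[OF st(6) st(2)] by blast
  have "snd y $ i $ 2 \<noteq> 0"
  proof
    assume "snd y $ i $ 2 = 0"
    then have "snd y $ i = snd y $ i $ 1 *s vector [1, 0]" by (simp add: vec_eq_iff forall_2)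
    then show False using i by (metis vec.span_base vec.span_scale singletonI)
  qed
  then show D: "gram22 y > 0" unfolding gram22_def by (intro pos[where k = i]) auto
  \<comment> \<open>Minimises \<open>\<Sum>\<^sub>i tau\<^sub>i |c\<^sub>i - m d\<^sub>i|\<^sup>2\<close>.\<close>
  define m where "m = gram12 y / of_real (gram22 y)"
  obtain j where j: "snd y $ j \<notin> vec.span {vector [m, 1]}"
    using not_all_proportional[OF st(6) st(2)] by blast
  have "snd y $ j $ 1 - m * snd y $ j $ 2 \<noteq> 0"
  proof
    assume "snd y $ j $ 1 - m * snd y $ j $ 2 = 0"
    then have "snd y $ j = snd y $ j $ 2 *s vector [m, 1]" by (simp add: vec_eq_iff forall_2 mult.commute)
    then show False using j by (metis vec.span_base vec.span_scale singletonI)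
  qed
  then have "0 < (\<Sum>i\<in>UNIV. tau y i * (cmod (of_real 1 * snd y $ i $ 1 - m * snd y $ i $ 2))\<^sup>2)"
    by (intro pos[where k = j]) auto
  also have "\<dots> = gram11 y - 2 * Re (cnj m * gram12 y) + (cmod m)\<^sup>2 * gram22 y"
    unfolding sum_cmod_diff_sq gram11_def gram12_def gram22_def by simp
  also have "\<dots> = gram11 y - (cmod (gram12 y))\<^sup>2 / gram22 y"
  proof -
    have "cnj m * gram12 y = of_real ((cmod (gram12 y))\<^sup>2 / gram22 y)"
      unfolding m_def complex_cnj_divide complex_cnj_complex_of_real of_real_divide complex_norm_square
      by (simp add: mult.commute)
    then have "Re (cnj m * gram12 y) = (cmod (gram12 y))\<^sup>2 / gram22 y" by (simp only: Re_complex_of_real)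
    moreover have "(cmod m)\<^sup>2 * gram22 y = (cmod (gram12 y))\<^sup>2 / gram22 y"
      using D by (simp add: m_def norm_divide power_divide power2_eq_square)
    ultimately show ?thesis by simp
  qed
  finally show "gram11 y * gram22 y - (cmod (gram12 y))\<^sup>2 > 0"
    using D by (simp add: field_simps)
qed

text \<open>
  The choice of \<open>e\<close> makes all \<open>|p\<^sub>i| = |q\<^sub>i|\<close>, and \<open>\<Sum>\<^sub>i q\<^sub>i q\<^sub>i\<^sup>*\<close> becomes \<open>A\<^sup>-\<^sup>1 Q A\<^sup>-\<^sup>*\<close>, which is the scalar matrix
  \<open>sqrt (det Q)\<close>.
\<close>

lemma balanced_in:
  fixes y :: "'n::finite pq"
  assumes y: "y \<in> mu_complex_stable"
  shows "balanced y \<in> KC_orbit y" "balanced y \<in> P0"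
proof -
  note pos = gram_pos[OF y]
  define al where "al = chol_a y"
  define be where "be = chol_b y"
  define D where "D = gram22 y"
  define dl where "dl = gram_root y"
  have D: "D > 0" using pos(2) by (simp add: D_def)
  have dl: "dl > 0" "dl\<^sup>2 = gram11 y * D - (cmod (gram12 y))\<^sup>2"
    using pos(3) by (simp_all add: dl_def gram_root_def D_def)
  have al: "al > 0" "al\<^sup>2 = dl / D"
    using D dl by (simp_all add: al_def chol_a_def flip: dl_def D_def)
  have be: "be = of_real (al / dl) * gram12 y" by (simp add: be_def chol_b_def al_def dl_def)
  define A :: "complex ^ 2 ^ 2" where "A = vector [vector [of_real al, be], vector [0, of_real (1 / al)]]"
  define e :: "complex ^ 'n" where "e = (\<chi> i. of_real (sqrt (tau y i)))"
  have A: "A \<in> SL2" using al by (simp add: SL2_def A_def det_2)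
  have A_inv: "matrix_inv A = vector [vector [of_real (1 / al), - be], vector [0, of_real al]]"
    using al by (intro matrix_inv_eqI)
      (simp add: A_def vec_eq_iff forall_2 matrix_matrix_mult_def sum_2 mat_def)
  have eq: "balanced y = pq_act y A e"
  proof (rule prod_eqI; subst vec_eq_iff; intro allI)
    fix i
    show "fst (balanced y) $ i = fst (pq_act y A e) $ i"
      by (simp add: balanced_def e_def A_def vec_eq_iff forall_2 vector_matrix_mult_def sum_2
          divide_inverse algebra_simps flip: al_def be_def)
    show "snd (balanced y) $ i = snd (pq_act y A e) $ i"
      unfolding pq_act_nth A_inv
      by (simp add: balanced_def e_def vec_eq_iff forall_2 matrix_vector_mult_def sum_2
          algebra_simps flip: al_def be_def)
  qed
  have e0: "e $ i \<noteq> 0" for i using pos(1)[of i] by (simp add: e_def)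
  show KC: "balanced y \<in> KC_orbit y" unfolding eq by (intro KC_orbitI A e0)
  have st: "balanced y \<in> mu_complex_stable" by (rule KC_orbit_stable[OF y KC])
  note sty = mu_complex_stableD[OF y]
  have norms: "norm (fst (balanced y) $ i) = norm (snd (balanced y) $ i)" for i
  proof -
    obtain t where t: "fst y $ i = t *s perp (snd y $ i)"
      using scalar_product_0_perp[OF sty(4) sty(2)] .
    have "tau y i = cmod t" using sty(2)[of i] by (simp add: tau_def t norm_smult)
    then have ct: "cmod t = (sqrt (tau y i))\<^sup>2" using pos(1)[of i] by simp
    have "perp (snd y $ i) v* A = perp (matrix_inv A *v snd y $ i)"
      unfolding A_inv using al
      by (simp add: A_def vec_eq_iff forall_2 vector_matrix_mult_def matrix_vector_mult_def sum_2 algebra_simps)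
    then have "fst (balanced y) $ i = inverse (e $ i) *s (t *s perp (matrix_inv A *v snd y $ i))"
      by (simp add: eq t vec_mult_smult)
    then have "norm (fst (balanced y) $ i) = inverse (sqrt (tau y i)) * (cmod t * norm (matrix_inv A *v snd y $ i))"
      using pos(1)[of i] by (simp add: norm_smult norm_mult norm_inverse e_def)
    also have "\<dots> = sqrt (tau y i) * norm (matrix_inv A *v snd y $ i)"
      using pos(1)[of i] by (simp add: ct power2_eq_square del: real_sqrt_mult_self)
    also have "\<dots> = norm (snd (balanced y) $ i)"
      using pos(1)[of i] by (simp add: eq norm_smult e_def)
    finally show ?thesis .
  qed
  have q1: "snd (balanced y) $ i $ 1 = of_real (sqrt (tau y i)) * (of_real (1 / al) * snd y $ i $ 1 - be * snd y $ i $ 2)"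
    and q2: "snd (balanced y) $ i $ 2 = of_real (sqrt (tau y i) * al) * snd y $ i $ 2" for i
    by (simp_all add: balanced_def al_def be_def)
  have sum2: "(\<Sum>i\<in>UNIV. (cmod (snd (balanced y) $ i $ 2))\<^sup>2) = dl"
  proof -
    have "(\<Sum>i\<in>UNIV. (cmod (snd (balanced y) $ i $ 2))\<^sup>2) = al\<^sup>2 * D"
      using pos(1) less_imp_le[OF pos(1)] by (simp add: q2 norm_mult power_mult_distrib D_def gram22_def sum_distrib_left algebra_simps)
    then show ?thesis using al D by simp
  qed
  have sum1: "(\<Sum>i\<in>UNIV. (cmod (snd (balanced y) $ i $ 1))\<^sup>2) = dl"
  proof -
    have "(\<Sum>i\<in>UNIV. (cmod (snd (balanced y) $ i $ 1))\<^sup>2) =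
        (\<Sum>i\<in>UNIV. tau y i * (cmod (of_real (1 / al) * snd y $ i $ 1 - be * snd y $ i $ 2))\<^sup>2)"
      using less_imp_le[OF pos(1)] unfolding q1 by (simp add: norm_mult power_mult_distrib)
    also have "\<dots> = (1 / al)\<^sup>2 * gram11 y - 2 * (1 / al) * Re (cnj be * gram12 y) + (cmod be)\<^sup>2 * D"
      unfolding sum_cmod_diff_sq gram11_def gram12_def gram22_def D_def ..
    also have "Re (cnj be * gram12 y) = al / dl * (cmod (gram12 y))\<^sup>2"
    proof -
      have "cnj be * gram12 y = of_real (al / dl * (cmod (gram12 y))\<^sup>2)"
        unfolding be complex_cnj_mult complex_cnj_complex_of_real of_real_mult complex_norm_square
        by (simp add: mult.commute mult.left_commute)
      then show ?thesis by (simp only: Re_complex_of_real)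
    qed
    also have "(cmod be)\<^sup>2 = al\<^sup>2 / dl\<^sup>2 * (cmod (gram12 y))\<^sup>2"
      using al dl by (simp add: be norm_mult norm_divide power_mult_distrib power_divide)
    also have "(1 / al)\<^sup>2 * gram11 y - 2 * (1 / al) * (al / dl * (cmod (gram12 y))\<^sup>2) + al\<^sup>2 / dl\<^sup>2 * (cmod (gram12 y))\<^sup>2 * D
      = (gram11 y * D - (cmod (gram12 y))\<^sup>2) / dl"
      using al(1) dl(1) D unfolding power_divide al(2) by (simp add: field_simps power2_eq_square)
    also have "\<dots> = dl" unfolding dl(2)[symmetric] using dl(1) by (simp add: power2_eq_square)
    finally show ?thesis .
  qed
  have sum12: "(\<Sum>i\<in>UNIV. snd (balanced y) $ i $ 1 * cnj (snd (balanced y) $ i $ 2)) = 0"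
  proof -
    have "snd (balanced y) $ i $ 1 * cnj (snd (balanced y) $ i $ 2) =
      of_real (tau y i) * (snd y $ i $ 1 * cnj (snd y $ i $ 2)) -
      be * of_real al * of_real (tau y i * (cmod (snd y $ i $ 2))\<^sup>2)" for i
    proof -
      have "of_real (sqrt (tau y i)) * of_real (sqrt (tau y i)) = (of_real (tau y i) :: complex)"
        using less_imp_le[OF pos(1)[of i]] by (simp flip: of_real_mult)
      then have s: "of_real (sqrt (tau y i)) * (of_real (sqrt (tau y i)) * z) = of_real (tau y i) * z" for z :: complex
        by (simp flip: mult.assoc)
      show ?thesis
        unfolding q1 q2 of_real_mult complex_norm_square using al(1)
        by (simp add: algebra_simps s)
    qed
    then have "(\<Sum>i\<in>UNIV. snd (balanced y) $ i $ 1 * cnj (snd (balanced y) $ i $ 2)) =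
        gram12 y - be * of_real al * of_real D"
      by (simp add: sum_subtractf gram12_def D_def gram22_def sum_distrib_left)
    also have "be * of_real al * of_real D = of_real (al\<^sup>2 * D / dl) * gram12 y"
      by (simp add: be power2_eq_square)
    also have "al\<^sup>2 * D / dl = 1" using al(2) D dl(1) by simp
    finally show ?thesis by simp
  qed
  show "balanced y \<in> P0"
    unfolding P0_iff using mu_complex_stableD(1,2)[OF st] norms sum1 sum2 sum12 by simp
qed

lemma continuous_on_if_const:
  "(P \<Longrightarrow> continuous_on S f) \<Longrightarrow> (\<not> P \<Longrightarrow> continuous_on S g) \<Longrightarrow>
    continuous_on S (\<lambda>x. if P then f x else g x)"
  by (cases P) auto

lemma continuous_on_balanced: "continuous_on mu_complex_stable (balanced :: 'n::finite pq \<Rightarrow> _)"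
proof -
  have nz: "norm (snd y $ i) \<noteq> 0" "tau y i \<noteq> 0" "gram22 y \<noteq> 0" "gram_root y \<noteq> 0" "chol_a y \<noteq> 0"
    if "y \<in> mu_complex_stable" for y :: "'n pq" and i
  proof -
    note pos = gram_pos[OF that]
    show "norm (snd y $ i) \<noteq> 0" using mu_complex_stableD(2)[OF that] by simp
    show "tau y i \<noteq> 0" using pos(1)[of i] by simp
    show "gram22 y \<noteq> 0" "gram_root y \<noteq> 0" "chol_a y \<noteq> 0"
      using pos(2,3) by (auto simp: gram_root_def chol_a_def)
  qed
  have tau: "continuous_on mu_complex_stable (\<lambda>y :: 'n pq. tau y i)" for i
    unfolding tau_def by (intro continuous_intros) (use nz in blast)
  have grams: "continuous_on mu_complex_stable (\<lambda>y :: 'n pq. gram11 y)"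
    "continuous_on mu_complex_stable (\<lambda>y :: 'n pq. gram22 y)"
    "continuous_on mu_complex_stable (\<lambda>y :: 'n pq. gram12 y)"
    unfolding gram11_def gram12_def gram22_def by (intro continuous_intros tau)+
  have root: "continuous_on mu_complex_stable (\<lambda>y :: 'n pq. gram_root y)"
    unfolding gram_root_def by (intro continuous_intros grams)
  have a: "continuous_on mu_complex_stable (\<lambda>y :: 'n pq. chol_a y)"
    unfolding chol_a_def by (intro continuous_intros root grams) (use nz in blast)
  have b: "continuous_on mu_complex_stable (\<lambda>y :: 'n pq. chol_b y)"
    unfolding chol_b_def by (intro continuous_intros root grams a) (use nz in blast)
  show ?thesis
    unfolding balanced_def
    by (intro continuous_on_Pair continuous_on_vec_lambda continuous_on_if_const continuous_intros tau a b)
      (use nz in \<open>auto simp: real_sqrt_eq_0_iff\<close>)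
qed

section \<open>Orbits of the compact group\<close>

text \<open>
  If all \<open>q\<^sub>i\<close> were multiples of one vector, the nonzero matrix \<open>\<Sum>\<^sub>i q\<^sub>i q\<^sub>i\<^sup>*\<close> would have rank one, but it is
  scalar.
\<close>

lemma P0_imp_stable:
  fixes y :: "'n::finite pq"
  assumes y: "y \<in> P0"
  shows "y \<in> mu_complex_stable"
proof -
  have h: "y \<in> mu_complex_zero" "\<And>i. norm (fst y $ i) = norm (snd y $ i)" "\<And>i. snd y $ i \<noteq> 0"
    "(\<Sum>i\<in>UNIV. (cmod (snd y $ i $ 1))\<^sup>2) = (\<Sum>i\<in>UNIV. (cmod (snd y $ i $ 2))\<^sup>2)"
    "(\<Sum>i\<in>UNIV. snd y $ i $ 1 * cnj (snd y $ i $ 2)) = 0"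
    using y unfolding P0_iff by auto
  have "fst y $ i \<noteq> 0" for i using h(2,3)[of i] by auto
  moreover have "\<not> (\<forall>i j. \<exists>c. snd y $ j = c *s snd y $ i)"
  proof
    assume *: "\<forall>i j. \<exists>c. snd y $ j = c *s snd y $ i"
    fix u :: 'n
    define v where "v = snd y $ u"
    have "\<forall>j. \<exists>c. snd y $ j = c *s v" using * by (simp add: v_def)
    then obtain c where c: "\<And>j. snd y $ j = c j *s v" by metis
    define S where "S = (\<Sum>i\<in>UNIV. (cmod (c i))\<^sup>2)"
    have v: "v \<noteq> 0" using h(3) by (simp add: v_def)
    have "c u \<noteq> 0" using c[of u] v by (auto simp: v_def)
    then have S: "S > 0" unfolding S_def by (intro sum_pos2[of _ u]) auto
    have "S * (cmod (v $ 1))\<^sup>2 = S * (cmod (v $ 2))\<^sup>2"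
      using h(4) unfolding c by (simp add: norm_mult power_mult_distrib S_def sum_distrib_right)
    then have 1: "cmod (v $ 1) = cmod (v $ 2)" using S by simp
    have "of_real S * (v $ 1 * cnj (v $ 2)) = (\<Sum>i\<in>UNIV. snd y $ i $ 1 * cnj (snd y $ i $ 2))"
      unfolding c S_def of_real_sum complex_norm_square sum_distrib_right
      by (intro sum.cong refl) (simp add: algebra_simps)
    then have "v $ 1 = 0 \<or> v $ 2 = 0" using S unfolding h(5) by simp
    then have "v $ 1 = 0 \<and> v $ 2 = 0" using 1 by auto
    then show False using v by (simp add: vec_eq_iff forall_2)
  qed
  ultimately show ?thesis
    using h(1,3) by (cases y) (simp add: mu_complex_stable_def)
qed

definition adj :: "complex ^ 2 ^ 2 \<Rightarrow> complex ^ 2 ^ 2" where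
  "adj A = (\<chi> r s. cnj (A $ s $ r))"

lemma adj_adj [simp]: "adj (adj A) = A"
  by (simp add: adj_def vec_eq_iff)

lemma det_adj: "det (adj A) = cnj (det A)"
  by (simp add: adj_def det_2 mult.commute)

lemma SU2_iff: "A \<in> SU2 \<longleftrightarrow> A ** adj A = mat 1 \<and> det A = 1"
  by (simp add: SU2_def adj_def)

lemma SU2_D:
  assumes "A \<in> SU2"
  shows "A ** adj A = mat 1" "adj A ** A = mat 1" "matrix_inv A = adj A" "A \<in> SL2"
proof -
  show 1: "A ** adj A = mat 1" "A \<in> SL2" using assms by (auto simp: SU2_iff SL2_def)
  then show "adj A ** A = mat 1" using matrix_left_right_inverse by blast
  show "matrix_inv A = adj A" by (rule matrix_inv_eqI[OF 1(1)])
qed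

lemma unitary_norm:
  assumes "adj B ** B = mat 1"
  shows "norm (B *v v) = norm v"
proof -
  have e: "cnj (B $ 1 $ 1) * B $ 1 $ 1 + cnj (B $ 2 $ 1) * B $ 2 $ 1 = 1"
    "cnj (B $ 1 $ 1) * B $ 1 $ 2 + cnj (B $ 2 $ 1) * B $ 2 $ 2 = 0"
    "cnj (B $ 1 $ 2) * B $ 1 $ 1 + cnj (B $ 2 $ 2) * B $ 2 $ 1 = 0"
    "cnj (B $ 1 $ 2) * B $ 1 $ 2 + cnj (B $ 2 $ 2) * B $ 2 $ 2 = 1"
    using assms by (simp_all add: vec_eq_iff forall_2 matrix_matrix_mult_def sum_2 adj_def mat_def)
  have sq: "of_real ((norm w)\<^sup>2) = w $ 1 * cnj (w $ 1) + w $ 2 * cnj (w $ 2)" for w :: "complex ^ 2"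
  proof -
    have "(norm w)\<^sup>2 = (cmod (w $ 1))\<^sup>2 + (cmod (w $ 2))\<^sup>2" by (simp add: norm_2)
    then show ?thesis by (simp only: of_real_add complex_norm_square)
  qed
  have "complex_of_real ((norm (B *v v))\<^sup>2) =
      v $ 1 * cnj (v $ 1) * (cnj (B $ 1 $ 1) * B $ 1 $ 1 + cnj (B $ 2 $ 1) * B $ 2 $ 1) +
      v $ 2 * cnj (v $ 1) * (cnj (B $ 1 $ 1) * B $ 1 $ 2 + cnj (B $ 2 $ 1) * B $ 2 $ 2) +
      v $ 1 * cnj (v $ 2) * (cnj (B $ 1 $ 2) * B $ 1 $ 1 + cnj (B $ 2 $ 2) * B $ 2 $ 1) +
      v $ 2 * cnj (v $ 2) * (cnj (B $ 1 $ 2) * B $ 1 $ 2 + cnj (B $ 2 $ 2) * B $ 2 $ 2)"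
    unfolding sq by (simp add: matrix_vector_mult_def sum_2 algebra_simps)
  also have "\<dots> = of_real ((norm v)\<^sup>2)" unfolding e sq by simp
  finally have "(norm (B *v v))\<^sup>2 = (norm v)\<^sup>2" by (simp only: of_real_eq_iff)
  then show ?thesis by simp
qed

lemma vec_mult_eq_transpose: "v v* (A :: complex ^ 2 ^ 2) = transpose A *v v"
  by (simp add: vector_matrix_mult_def matrix_vector_mult_def transpose_def mult.commute)

lemma SU2_norm:
  assumes "A \<in> SU2"
  shows "norm (v v* A) = norm v" "norm (matrix_inv A *v v) = norm v"
proof -
  show "norm (matrix_inv A *v v) = norm v"
    using SU2_D[OF assms] by (simp add: unitary_norm)
  have "adj (transpose A) ** transpose A = transpose (A ** adj A)"
    by (simp add: vec_eq_iff matrix_matrix_mult_def adj_def transpose_def mult.commute)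
  also have "\<dots> = mat 1" using SU2_D(1)[OF assms] by (simp add: transpose_mat)
  finally show "norm (v v* A) = norm v" unfolding vec_mult_eq_transpose by (rule unitary_norm)
qed

definition gram :: "'n::finite pq \<Rightarrow> complex ^ 2 ^ 2" where
  "gram y = (\<Sum>i\<in>UNIV. outer (snd y $ i) (conj_vec (snd y $ i)))"

lemma gram_scalar_iff:
  fixes y :: "'n::finite pq"
  shows "(\<Sum>i\<in>UNIV. (cmod (snd y $ i $ 1))\<^sup>2) = (\<Sum>i\<in>UNIV. (cmod (snd y $ i $ 2))\<^sup>2) \<and>
    (\<Sum>i\<in>UNIV. snd y $ i $ 1 * cnj (snd y $ i $ 2)) = 0 \<longleftrightarrow>
    gram y = mat (of_real (\<Sum>i\<in>UNIV. (cmod (snd y $ i $ 1))\<^sup>2))"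
    (is "?a = ?b \<and> ?c = 0 \<longleftrightarrow> _")
    and "gram y = mat s \<Longrightarrow> s = of_real (\<Sum>i\<in>UNIV. (cmod (snd y $ i $ 1))\<^sup>2)"
proof -
  have e: "gram y $ 1 $ 1 = of_real ?a" "gram y $ 2 $ 2 = of_real ?b" "gram y $ 1 $ 2 = ?c"
    "gram y $ 2 $ 1 = cnj ?c"
    unfolding of_real_sum complex_norm_square by (simp_all add: gram_def outer_def conj_vec_def mult.commute)
  have "gram y = mat (of_real ?a) \<longleftrightarrow> of_real ?b = (of_real ?a :: complex) \<and> ?c = 0 \<and> cnj ?c = 0"
    unfolding vec_eq_iff forall_2 e mat_def by simp blast
  then show "?a = ?b \<and> ?c = 0 \<longleftrightarrow> gram y = mat (of_real ?a)"
    unfolding of_real_eq_iff complex_cnj_zero_iff by auto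
  assume "gram y = mat s"
  then show "s = of_real ?a" using e(1) by (simp add: mat_def)
qed

lemma outer_conj:
  "outer (e *s (B *v q)) (conj_vec (e *s (B *v q))) = mat (of_real ((cmod e)\<^sup>2)) ** (B ** outer q (conj_vec q) ** adj B)"
  unfolding complex_norm_square
  by (simp add: vec_eq_iff forall_2 outer_def conj_vec_def matrix_matrix_mult_def matrix_vector_mult_def
      sum_2 mat_def adj_def algebra_simps)

text \<open>
  For \<open>|e\<^sub>i| = 1\<close> the torus does not affect \<open>q\<^sub>i q\<^sub>i\<^sup>*\<close>.
\<close>

lemma gram_pq_act:
  fixes y :: "'n::finite pq"
  assumes "\<And>i. cmod (e $ i) = 1"
  shows "gram (pq_act y A e) = matrix_inv A ** gram y ** adj (matrix_inv A)"
  unfolding gram_def by (simp add: outer_conj assms matrix_mult_sum)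

lemma P0_gram:
  fixes y :: "'n::finite pq"
  shows "y \<in> P0 \<longleftrightarrow> y \<in> mu_complex_zero \<and> (\<forall>i. norm (fst y $ i) = norm (snd y $ i) \<and> snd y $ i \<noteq> 0) \<and>
    gram y = mat (of_real (\<Sum>i\<in>UNIV. (cmod (snd y $ i $ 1))\<^sup>2))"
  unfolding P0_iff gram_scalar_iff(1)[symmetric] by blast

lemma mat_mult_comm: "mat s ** (A :: complex ^ 2 ^ 2) = A ** mat s"
  by (simp add: vec_eq_iff forall_2 matrix_matrix_mult_def sum_2 mat_def mult.commute)

lemma pq_act_P0:
  fixes y :: "'n::finite pq"
  assumes y: "y \<in> P0" and A: "A \<in> SU2" and e: "\<And>i. cmod (e $ i) = 1"
  shows "pq_act y A e \<in> P0"
proof -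
  have e0: "e $ i \<noteq> 0" for i using e[of i] by auto
  note st = pq_act_stable[OF P0_imp_stable[OF y] SU2_D(4)[OF A], of e, OF e0]
  define s where "s = complex_of_real (\<Sum>i\<in>UNIV. (cmod (snd y $ i $ 1))\<^sup>2)"
  have g: "gram y = mat s" using y unfolding P0_gram s_def by blast
  have "gram (pq_act y A e) = adj A ** mat s ** A"
    unfolding gram_pq_act[of e, OF e] g by (simp add: SU2_D[OF A])
  also have "\<dots> = mat s ** (adj A ** A)"
    by (simp add: mat_mult_comm[symmetric] matrix_mul_assoc)
  also have "\<dots> = mat s" by (simp add: SU2_D[OF A])
  finally have g': "gram (pq_act y A e) = mat s" .
  have "norm (fst (pq_act y A e) $ i) = norm (snd (pq_act y A e) $ i)" for i
    using y e by (simp add: P0_gram norm_smult SU2_norm[OF A] norm_inverse)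
  then show ?thesis
    unfolding P0_gram using mu_complex_stableD(1,2)[OF st] g' gram_scalar_iff(2)[OF g'] by simp
qed

lemma det_mat_2: "det (mat s :: complex ^ 2 ^ 2) = s\<^sup>2"
  by (simp add: det_2 mat_def power2_eq_square)

text \<open>
  Uniqueness: \<open>|p\<^sub>i| = |q\<^sub>i|\<close> before and after the action gives \<open>|e\<^sub>i| = 1\<close>.  Then \<open>B = A\<^sup>-\<^sup>1\<close> satisfies
  \<open>s B B\<^sup>* = s' 1\<close> with positive \<open>s\<close>, \<open>s'\<close>; taking determinants gives \<open>s = s'\<close>, so that \<open>B\<close> is unitary.
\<close>

lemma KC_orbit_in_P0:
  fixes y :: "'n::finite pq"
  assumes y: "y \<in> P0" "y' \<in> P0" and KC: "y' \<in> KC_orbit y"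
  shows "y' \<in> K_orbit y"
proof -
  obtain A e where A: "A \<in> SL2" "\<And>i. e $ i \<noteq> 0" "y' = pq_act y A e"
    using KC by (auto simp: KC_orbit_def)
  note inv = SL2_invertible[OF A(1)]
  have e: "cmod (e $ i) = 1" for i
  proof -
    have sp: "scalar_product (fst y $ i) (snd y $ i) = 0" "snd y $ i \<noteq> 0"
      using mu_complex_stableD[OF P0_imp_stable[OF y(1)]] by auto
    obtain t where t: "fst y $ i = t *s perp (snd y $ i)" using scalar_product_0_perp[OF sp] .
    have "norm (fst y $ i) = norm (snd y $ i)" using y(1) by (simp add: P0_gram)
    then have t1: "cmod t = 1" using sp(2) unfolding t norm_smult by simp
    have detA: "A $ 1 $ 1 * A $ 2 $ 2 - A $ 1 $ 2 * A $ 2 $ 1 = 1" using A(1) by (simp add: SL2_def det_2)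
    have "perp (A *v w) v* A = (A $ 1 $ 1 * A $ 2 $ 2 - A $ 1 $ 2 * A $ 2 $ 1) *s perp w" for w
      by (simp add: vec_eq_iff forall_2 vector_matrix_mult_def matrix_vector_mult_def sum_2 algebra_simps)
    from this[of "matrix_inv A *v snd y $ i"]
    have "perp (snd y $ i) v* A = perp (matrix_inv A *v snd y $ i)"
      unfolding detA by (simp add: matrix_inv_cancel inv)
    then have "fst y' $ i = inverse (e $ i) *s (t *s perp (matrix_inv A *v snd y $ i))"
      by (simp add: A(3) t vec_mult_smult)
    then have "norm (fst y' $ i) = norm (matrix_inv A *v snd y $ i) / cmod (e $ i)"
      by (simp add: norm_smult t1 norm_mult norm_inverse divide_inverse)
    moreover have "norm (snd y' $ i) = cmod (e $ i) * norm (matrix_inv A *v snd y $ i)"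
      by (simp add: A(3) norm_smult)
    moreover have "norm (fst y' $ i) = norm (snd y' $ i)" using y(2) by (simp add: P0_gram)
    moreover have "norm (matrix_inv A *v snd y $ i) \<noteq> 0"
      using sp(2) inv by (simp add: invertible_mult_vec_eq_0)
    ultimately have "cmod (e $ i) * cmod (e $ i) = 1" using A(2)[of i] by (simp add: field_simps)
    then show ?thesis by (simp add: abs_square_eq_1[unfolded power2_eq_square] flip: power2_eq_square) (metis abs_norm_cancel abs_square_eq_1)
  qed
  define s where "s = (\<Sum>i\<in>UNIV. (cmod (snd y $ i $ 1))\<^sup>2)"
  define s' where "s' = (\<Sum>i\<in>UNIV. (cmod (snd y' $ i $ 1))\<^sup>2)"
  define B where "B = matrix_inv A"
  have detB: "det B = 1" using SL2_inv[OF A(1)] by (simp add: B_def SL2_def)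
  have "mat (of_real s') = B ** mat (of_real s) ** adj B"
    using y gram_pq_act[of e y A, OF e] unfolding P0_gram s_def s'_def B_def A(3) by simp
  then have BB: "mat (of_real s') = mat (of_real s) ** (B ** adj B)"
    by (simp add: mat_mult_comm[symmetric] matrix_mul_assoc)
  have "det (mat (of_real s') :: complex ^ 2 ^ 2) = det (mat (of_real s) :: complex ^ 2 ^ 2) * (det B * cnj (det B))"
    unfolding BB det_mul det_adj ..
  then have "(of_real s')\<^sup>2 = ((of_real s)\<^sup>2 :: complex)" by (simp add: det_mat_2 detB)
  then have "s'\<^sup>2 = s\<^sup>2" by (simp flip: of_real_power)
  moreover have "s \<ge> 0" "s' \<ge> 0" by (auto simp: s_def s'_def intro: sum_nonneg)
  ultimately have ss: "s' = s" by simp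
  have "s \<noteq> 0"
  proof
    assume "s = 0"
    moreover have "(\<Sum>i\<in>UNIV. (cmod (snd y $ i $ 1))\<^sup>2) = (\<Sum>i\<in>UNIV. (cmod (snd y $ i $ 2))\<^sup>2)"
      using y(1) by (simp add: P0_iff)
    ultimately have "\<forall>i. snd y $ i $ 1 = 0" "\<forall>i. snd y $ i $ 2 = 0"
      by (auto simp: s_def sum_nonneg_eq_0_iff)
    then have "snd y $ i = 0" for i by (simp add: vec_eq_iff forall_2)
    then show False using y(1) by (simp add: P0_gram)
  qed
  have "mat (inverse (of_real s)) ** (mat (of_real s) ** (B ** adj B)) = mat (inverse (of_real s)) ** mat (of_real s)"
    using BB ss by simp
  moreover have "mat (inverse (of_real s)) ** mat (of_real s) = (mat 1 :: complex ^ 2 ^ 2)"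
    using \<open>s \<noteq> 0\<close> by (simp add: vec_eq_iff forall_2 matrix_matrix_mult_def sum_2 mat_def)
  ultimately have "B ** adj B = mat 1" by (simp add: matrix_mul_assoc)
  then have "B \<in> SU2" using detB by (simp add: SU2_iff)
  then have "adj B ** B = mat 1" "A = adj B" using SU2_D[of B] inv by (simp_all add: B_def)
  then have "A \<in> SU2" using detB by (simp add: SU2_iff det_adj)
  then show ?thesis using A(3) e by (auto simp: K_orbit_def)
qed

lemma K_orbit_eq:
  fixes y :: "'n::finite pq"
  assumes y: "y \<in> P0"
  shows "K_orbit y = KC_orbit y \<inter> P0"
proof
  show "K_orbit y \<subseteq> KC_orbit y \<inter> P0"
  proof
    fix z assume "z \<in> K_orbit y"
    then obtain A e where A: "A \<in> SU2" "\<And>i. norm (e $ i) = 1" "z = pq_act y A e"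
      by (auto simp: K_orbit_def)
    have "e $ i \<noteq> 0" for i using A(2)[of i] by auto
    then show "z \<in> KC_orbit y \<inter> P0"
      unfolding A(3) using pq_act_P0[OF y A(1,2)] KC_orbitI[OF SU2_D(4)[OF A(1)]] by blast
  qed
  show "KC_orbit y \<inter> P0 \<subseteq> K_orbit y" using KC_orbit_in_P0[OF y] by blast
qed

lemma X0_proj_eq_K_orbit: "y \<in> P0 \<Longrightarrow> X0_proj y = K_orbit (y :: 'n::finite pq)"
  by (simp add: X0_proj_def K_orbit_eq)

text \<open>
  The point \<open>balanced y\<close> lies in the orbit of \<open>y\<close> and in \<open>P0\<close>, so that \<open>X0_proj y\<close> is not empty.
\<close>

lemma X0_proj_eq_iff:
  fixes y y' :: "'n::finite pq"
  assumes y: "y \<in> mu_complex_stable" "y' \<in> mu_complex_stable"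
  shows "X0_proj y = X0_proj y' \<longleftrightarrow> y' \<in> KC_orbit y"
proof
  assume eq: "X0_proj y = X0_proj y'"
  have "balanced y \<in> X0_proj y'"
    using balanced_in[OF y(1)] unfolding eq[symmetric] by (simp add: X0_proj_def)
  then have "balanced y \<in> KC_orbit y'" by (simp add: X0_proj_def)
  then show "y' \<in> KC_orbit y"
    using balanced_in(1)[OF y(1)] KC_orbit_sym KC_orbit_trans by blast
next
  assume "y' \<in> KC_orbit y"
  then show "X0_proj y = X0_proj y'" using KC_orbit_eq_iff[of y' y] by (simp add: X0_proj_def)
qed

lemma X0_proj_balanced:
  fixes y :: "'n::finite pq"
  assumes y: "y \<in> mu_complex_stable"
  shows "X0_proj y = K_orbit (balanced y)"
  using X0_proj_eq_iff[OF y KC_orbit_stable[OF y balanced_in(1)[OF y]]] balanced_in[OF y] X0_proj_eq_K_orbit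
  by metis

lemma X0_eq_image: "X0 = X0_proj ` (mu_complex_stable :: 'n::finite pq set)"
proof
  show "X0 \<subseteq> X0_proj ` (mu_complex_stable :: 'n pq set)"
  proof
    fix z :: "'n pq set" assume "z \<in> X0"
    then obtain y where "y \<in> P0" "z = K_orbit y" by (auto simp: X0_def)
    then show "z \<in> X0_proj ` mu_complex_stable"
      using X0_proj_eq_K_orbit P0_imp_stable by blast
  qed
  show "X0_proj ` (mu_complex_stable :: 'n pq set) \<subseteq> X0"
  proof (rule image_subsetI)
    fix y :: "'n pq" assume "y \<in> mu_complex_stable"
    then show "X0_proj y \<in> X0"
      unfolding X0_def X0_proj_balanced[OF \<open>y \<in> mu_complex_stable\<close>]
      by (intro imageI balanced_in(2))
  qed
qed

section \<open>The topology of the space of null hyperpolygons\<close>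

lemma topspace_X0_top: "topspace X0_top = (X0 :: 'n::finite pq set set)"
proof -
  have "{y \<in> P0. K_orbit y \<in> K_orbit ` P0} = (P0 :: 'n pq set)" by blast
  then have "openin X0_top (X0 :: 'n pq set set)"
    unfolding X0_top_def openin_quotient_topology X0_def by simp
  moreover have "U \<subseteq> X0" if "openin X0_top U" for U :: "'n pq set set"
    using that unfolding X0_top_def openin_quotient_topology X0_def by simp
  ultimately show ?thesis unfolding topspace_def by blast
qed

lemma openin_X0_top_P0:
  fixes U :: "'n::finite pq set set"
  shows "openin X0_top U \<longleftrightarrow> U \<subseteq> X0 \<and> openin (top_of_set P0) {y \<in> P0. K_orbit y \<in> U}"
  unfolding X0_top_def openin_quotient_topology X0_def by simp

text \<open>
  The retraction \<open>balanced\<close> of the stable locus to \<open>P0\<close> is continuous and compatible with the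
  projections to \<open>X0\<close>; conversely, \<open>P0\<close> is a subspace of the stable locus.
\<close>

theorem openin_X0_top:
  fixes U :: "'n::finite pq set set"
  shows "openin X0_top U \<longleftrightarrow> U \<subseteq> X0 \<and> openin (top_of_set mu_complex_stable) {y \<in> mu_complex_stable. X0_proj y \<in> U}"
proof (intro iffI conjI; (elim conjE)?)
  assume U: "openin X0_top U"
  then show "U \<subseteq> X0" by (simp add: openin_X0_top_P0)
  have "{y \<in> mu_complex_stable. X0_proj y \<in> U} = mu_complex_stable \<inter> balanced -` {y \<in> P0. K_orbit y \<in> U}"
  proof (intro set_eqI)
    fix y :: "'n pq"
    show "y \<in> {y \<in> mu_complex_stable. X0_proj y \<in> U} \<longleftrightarrow>
        y \<in> mu_complex_stable \<inter> balanced -` {y \<in> P0. K_orbit y \<in> U}"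
      using balanced_in(2)[of y] X0_proj_balanced[of y] by (cases "y \<in> mu_complex_stable") simp_all
  qed
  moreover have "openin (top_of_set mu_complex_stable) (mu_complex_stable \<inter> balanced -` {y \<in> P0. K_orbit y \<in> U})"
  proof (rule continuous_openin_preimage[OF continuous_on_balanced])
    show "balanced \<in> mu_complex_stable \<rightarrow> (P0 :: 'n pq set)" by (intro Pi_I balanced_in(2))
    show "openin (top_of_set P0) {y \<in> P0. K_orbit y \<in> U}" using U by (simp add: openin_X0_top_P0)
  qed
  ultimately show "openin (top_of_set mu_complex_stable) {y \<in> mu_complex_stable. X0_proj y \<in> U}" by simp
next
  assume U: "U \<subseteq> X0" "openin (top_of_set mu_complex_stable) {y \<in> mu_complex_stable. X0_proj y \<in> U}"
  have "{y \<in> P0. K_orbit y \<in> U} = P0 \<inter> {y \<in> mu_complex_stable. X0_proj y \<in> U}"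
  proof (intro set_eqI)
    fix y :: "'n pq"
    show "y \<in> {y \<in> P0. K_orbit y \<in> U} \<longleftrightarrow> y \<in> P0 \<inter> {y \<in> mu_complex_stable. X0_proj y \<in> U}"
      using P0_imp_stable[of y] X0_proj_eq_K_orbit[of y] by (cases "y \<in> P0") simp_all
  qed
  moreover have "P0 \<subseteq> (mu_complex_stable :: 'n pq set)" by (rule subsetI) (rule P0_imp_stable)
  moreover obtain O' where "open O'" "{y \<in> mu_complex_stable. X0_proj y \<in> U} = mu_complex_stable \<inter> O'"
    using U(2) unfolding openin_open by auto
  ultimately have "{y \<in> P0. K_orbit y \<in> U} = P0 \<inter> O'" "open O'" by auto
  then show "openin X0_top U"
    unfolding openin_X0_top_P0 using U(1) by (simp add: openin_open_Int)
qed

lemma continuous_on_pq_act: "continuous_on S (\<lambda>y. pq_act y A e)"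
  unfolding pq_act_def vector_scalar_mult_def matrix_vector_mult_def vector_matrix_mult_def
  by (intro continuous_intros continuous_on_vec_lambda)

lemma K_orbit_mem_iff:
  fixes y z :: "'n::finite pq"
  assumes "y \<in> P0" "z \<in> P0"
  shows "K_orbit y = K_orbit z \<longleftrightarrow> z \<in> K_orbit y"
proof -
  have "K_orbit y = K_orbit z \<longleftrightarrow> z \<in> KC_orbit y"
    using X0_proj_eq_iff[OF P0_imp_stable P0_imp_stable] X0_proj_eq_K_orbit assms by metis
  then show ?thesis using assms K_orbit_eq by blast
qed

text \<open>
  The saturation of an open set is a union of translates of this set.
\<close>

lemma K_orbit_open:
  fixes O' :: "'n::finite pq set"
  assumes "openin (top_of_set P0) O'"
  shows "openin X0_top (K_orbit ` O')"
proof -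
  have sub: "O' \<subseteq> P0" using assms openin_imp_subset by blast
  have "{y \<in> P0. K_orbit y \<in> K_orbit ` O'} =
      \<Union>{P0 \<inter> (\<lambda>y. pq_act y A e) -` O' | A e. A \<in> SU2 \<and> (\<forall>i. norm (e $ i) = 1)}" (is "?L = ?R")
  proof
    show "?L \<subseteq> ?R"
    proof
      fix y assume "y \<in> ?L"
      then obtain z where z: "y \<in> P0" "z \<in> O'" "K_orbit y = K_orbit z" by blast
      then have "z \<in> K_orbit y" using K_orbit_mem_iff sub by blast
      then obtain A e where "A \<in> SU2" "\<forall>i. norm (e $ i) = 1" "z = pq_act y A e"
        by (auto simp: K_orbit_def)
      then show "y \<in> ?R" using z by blast
    qed
    show "?R \<subseteq> ?L"
    proof
      fix y assume "y \<in> ?R"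
      then obtain A e where y: "A \<in> SU2" "\<forall>i. norm (e $ i) = 1" "y \<in> P0" "pq_act y A e \<in> O'" by blast
      then have "pq_act y A e \<in> K_orbit y" by (auto simp: K_orbit_def)
      then have "K_orbit y = K_orbit (pq_act y A e)" using K_orbit_mem_iff sub y by blast
      then show "y \<in> ?L" using y by blast
    qed
  qed
  moreover have "openin (top_of_set P0) ?R"
  proof (rule openin_Union)
    fix T assume "T \<in> {P0 \<inter> (\<lambda>y. pq_act y A e) -` O' | A e. A \<in> SU2 \<and> (\<forall>i. norm (e $ i) = 1)}"
    then obtain A e where T: "A \<in> SU2" "\<And>i. norm (e $ i) = 1" "T = P0 \<inter> (\<lambda>y. pq_act y A e) -` O'" by blast
    show "openin (top_of_set P0) T"
      unfolding T(3)
    proof (rule continuous_openin_preimage[OF continuous_on_pq_act _ assms])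
      show "(\<lambda>y. pq_act y A e) \<in> P0 \<rightarrow> P0" by (rule Pi_I) (rule pq_act_P0[OF _ T(1,2)])
    qed
  qed
  ultimately show ?thesis
    unfolding openin_X0_top_P0 using sub by (auto simp: X0_def)
qed

lemma second_countable_X0: "second_countable (X0_top :: 'n::finite pq set topology)"
proof (rule second_countable_open_map_image[where X = "top_of_set (P0 :: 'n pq set)" and f = K_orbit])
  show "continuous_map (top_of_set P0) X0_top (K_orbit :: 'n pq \<Rightarrow> _)"
    unfolding continuous_map_def topspace_X0_top by (auto simp: openin_X0_top_P0 X0_def)
  show "open_map (top_of_set P0) X0_top (K_orbit :: 'n pq \<Rightarrow> _)"
    unfolding open_map_def using K_orbit_open by blast
  show "K_orbit ` topspace (top_of_set (P0 :: 'n pq set)) = topspace X0_top"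
    by (simp add: topspace_X0_top X0_def)
  have "second_countable (euclidean :: 'n pq topology)"
  proof -
    obtain B :: "'n pq set set" where "countable B" "topological_basis B"
      using ex_countable_basis by blast
    then show ?thesis
      unfolding second_countable_def
    proof (intro exI[of _ B] conjI ballI allI impI)
      show "openin euclidean V" if "V \<in> B" for V
        using \<open>topological_basis B\<close> that by (simp add: topological_basis_open)
      fix U :: "'n pq set" and z assume "openin euclidean U \<and> z \<in> U"
      then show "\<exists>V\<in>B. z \<in> V \<and> V \<subseteq> U"
        using topological_basisE[OF \<open>topological_basis B\<close>, of U z] by (metis open_openin)
    qed (rule \<open>countable B\<close>)
  qed
  then show "second_countable (top_of_set (P0 :: 'n pq set))" by (rule second_countable_subtopology)
qed

lemma compact_K_orbit: "compact (K_orbit (y :: 'n::finite pq))"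
proof -
  let ?g = "\<lambda>(A, e). ((\<chi> i. inverse (e $ i) *s (fst y $ i v* A)),
      (\<chi> i. e $ i *s (adj A *v (snd y $ i)))) :: 'n pq"
  have g: "?g (A, e) = pq_act y A e" if "A \<in> SU2" for A e
    using SU2_D(3)[OF that] by (simp add: pq_act_def)
  have "K_orbit y = ?g ` (SU2 \<times> {e. \<forall>i. norm (e $ i) = 1})"
  proof (intro set_eqI iffI)
    fix z assume "z \<in> K_orbit y"
    then obtain A e where "A \<in> SU2" "\<forall>i. norm (e $ i) = 1" "z = ?g (A, e)"
      using g by (auto simp: K_orbit_def)
    then show "z \<in> ?g ` (SU2 \<times> {e. \<forall>i. norm (e $ i) = 1})" by blast
  next
    fix z assume "z \<in> ?g ` (SU2 \<times> {e. \<forall>i. norm (e $ i) = 1})"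
    then obtain A e where "A \<in> SU2" "\<forall>i. norm (e $ i) = 1" "z = ?g (A, e)" by blast
    then show "z \<in> K_orbit y" using g[of A e] unfolding K_orbit_def by blast
  qed
  moreover have "compact SU2"
    unfolding compact_eq_bounded_closed
  proof
    have "norm A \<le> sqrt 2" if "A \<in> SU2" for A
    proof -
      have "A ** adj A = mat 1" using that by (simp add: SU2_iff)
      then have "A $ 1 $ 1 * cnj (A $ 1 $ 1) + A $ 1 $ 2 * cnj (A $ 1 $ 2) = 1"
        "A $ 2 $ 1 * cnj (A $ 2 $ 1) + A $ 2 $ 2 * cnj (A $ 2 $ 2) = 1"
        by (simp_all add: vec_eq_iff forall_2 matrix_matrix_mult_def sum_2 adj_def mat_def)
      then have "complex_of_real ((cmod (A $ 1 $ 1))\<^sup>2 + (cmod (A $ 1 $ 2))\<^sup>2) = of_real 1"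
        "complex_of_real ((cmod (A $ 2 $ 1))\<^sup>2 + (cmod (A $ 2 $ 2))\<^sup>2) = of_real 1"
        unfolding of_real_add complex_norm_square by simp_all
      then have "norm (A $ 1) = 1" "norm (A $ 2) = 1"
        unfolding of_real_eq_iff norm_2 by simp_all
      then show ?thesis by (simp add: norm_vec_def[of A] L2_set_def sum_2)
    qed
    then show "bounded SU2" by (auto simp: bounded_iff)
    have "closed {A. (\<forall>r s. (A ** adj A) $ r $ s = mat 1 $ r $ s) \<and> det A = (1 :: complex)}"
      unfolding det_2 matrix_matrix_mult_def adj_def vec_lambda_beta
      by (intro closed_Collect_conj closed_Collect_all closed_Collect_eq continuous_intros)
    moreover have "SU2 = {A. (\<forall>r s. (A ** adj A) $ r $ s = mat 1 $ r $ s) \<and> det A = 1}"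
      by (simp add: set_eq_iff SU2_iff vec_eq_iff)
    ultimately show "closed SU2" by simp
  qed
  moreover have "compact {e :: complex ^ 'n. \<forall>i. norm (e $ i) = 1}"
    unfolding compact_eq_bounded_closed
  proof
    have "norm e \<le> real CARD('n)" if "\<forall>i. norm (e $ i) = 1" for e :: "complex ^ 'n"
      unfolding norm_vec_def using L2_set_le_sum[of UNIV "\<lambda>i. norm (e $ i)"] that by simp
    then show "bounded {e :: complex ^ 'n. \<forall>i. norm (e $ i) = 1}" by (auto simp: bounded_iff)
    show "closed {e :: complex ^ 'n. \<forall>i. norm (e $ i) = 1}"
      by (intro closed_Collect_all closed_Collect_eq continuous_intros)
  qed
  moreover have "continuous_on (SU2 \<times> {e. \<forall>i. norm (e $ i) = 1}) ?g"
  proof -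
    have nz: "snd z $ i \<noteq> 0" if "z \<in> SU2 \<times> {e. \<forall>i. norm (e $ i) = 1}" for i and z :: "(complex ^ 2 ^ 2) \<times> (complex ^ 'n)"
    proof -
      have "norm (snd z $ i) = 1" using that by auto
      then show ?thesis by auto
    qed
    have adj: "adj A *v v = (\<chi> r. cnj (A $ 1 $ r) * v $ 1 + cnj (A $ 2 $ r) * v $ 2)" for A v
      by (simp add: vec_eq_iff adj_def matrix_vector_mult_def sum_2)
    show ?thesis
      unfolding split_beta vector_scalar_mult_def adj vector_matrix_mult_def sum_2 vec_lambda_beta
      by (intro continuous_on_Pair continuous_on_vec_lambda continuous_intros) (rule ballI, rule nz)
  qed
  ultimately show ?thesis
    by (simp only:) (intro compact_continuous_image compact_Times)
qed

lemma dist_pq_act: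
  fixes y z :: "'n::finite pq"
  assumes A: "A \<in> SU2" and e: "\<And>i. norm (e $ i) = 1"
  shows "dist (pq_act y A e) (pq_act z A e) = dist y z"
proof -
  have "fst (pq_act y A e) $ i - fst (pq_act z A e) $ i = inverse (e $ i) *s ((fst y $ i - fst z $ i) v* A)"
    "snd (pq_act y A e) $ i - snd (pq_act z A e) $ i = e $ i *s (matrix_inv A *v (snd y $ i - snd z $ i))" for i
    by (simp_all add: vec_eq_iff vector_matrix_mult_def matrix_vector_mult_def sum_2 algebra_simps)
  then have "norm (fst (pq_act y A e) $ i - fst (pq_act z A e) $ i) = norm (fst y $ i - fst z $ i)"
    "norm (snd (pq_act y A e) $ i - snd (pq_act z A e) $ i) = norm (snd y $ i - snd z $ i)" for i
    by (simp_all add: norm_smult norm_inverse e SU2_norm[OF A])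
  then show ?thesis
    by (simp add: dist_norm norm_prod_def norm_vec_def[where 'b = 'n])
qed

text \<open>
  As \<open>K\<close> acts by isometries, the distance from a given orbit is a \<open>K\<close>-invariant continuous function.
  It is positive on every other orbit, since orbits are compact; its values separate the two orbits.
\<close>

lemma Hausdorff_space_X0: "Hausdorff_space (X0_top :: 'n::finite pq set topology)"
  unfolding Hausdorff_space_def topspace_X0_top
proof (intro allI impI, elim conjE)
  fix S T :: "'n pq set" assume "S \<in> X0" "T \<in> X0" "S \<noteq> T"
  then obtain a b where ab: "a \<in> P0" "b \<in> P0" "S = K_orbit a" "T = K_orbit b" by (auto simp: X0_def)
  define f where "f = (\<lambda>z. infdist z (K_orbit a))"
  have ne: "K_orbit a \<noteq> {}" "a \<in> K_orbit a" using K_orbit_mem_iff[OF ab(1) ab(1)] by auto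
  have mono: "f (pq_act z A e) \<le> f z" if A: "A \<in> SU2" "\<And>i. norm (e $ i) = 1" for z A e
    unfolding f_def infdist_notempty[OF ne(1)]
  proof (rule cINF_greatest[OF ne(1)])
    fix s assume s: "s \<in> K_orbit a"
    then have sP: "s \<in> P0" using K_orbit_eq[OF ab(1)] by blast
    have "pq_act s A e \<in> K_orbit s" using A by (auto simp: K_orbit_def)
    then have "pq_act s A e \<in> K_orbit a" using K_orbit_mem_iff[OF ab(1) sP] s by blast
    then have "infdist (pq_act z A e) (K_orbit a) \<le> dist (pq_act z A e) (pq_act s A e)" by (rule infdist_le)
    then show "(INF s\<in>K_orbit a. dist (pq_act z A e) s) \<le> dist z s"
      unfolding dist_pq_act[of A e, OF A] infdist_notempty[OF ne(1)] .
  qed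
  have inv: "f z' = f z" if "z \<in> P0" "z' \<in> P0" "K_orbit z = K_orbit z'" for z z'
  proof -
    have le: "f u' \<le> f u" if "u' \<in> K_orbit u" for u u'
      using that mono[of _ _ u] unfolding K_orbit_def by blast
    have "z' \<in> K_orbit z" "z \<in> K_orbit z'" using K_orbit_mem_iff that by blast+
    then show ?thesis using le by (intro antisym) auto
  qed
  have fa: "f a = 0" using ne by (simp add: f_def)
  have "b \<notin> K_orbit a" using \<open>S \<noteq> T\<close> K_orbit_mem_iff ab by blast
  then have fb: "f b > 0"
    using compact_imp_closed[OF compact_K_orbit] ne(1) in_closed_iff_infdist_zero infdist_nonneg[of b "K_orbit a"]
    unfolding f_def by (metis less_eq_real_def)
  have cont: "continuous_on P0 f" unfolding f_def by (intro continuous_intros)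
  let ?U = "P0 \<inter> f -` {..<f b / 2}" and ?V = "P0 \<inter> f -` {f b / 2<..}"
  show "\<exists>U V. openin X0_top U \<and> openin X0_top V \<and> S \<in> U \<and> T \<in> V \<and> disjnt U V"
  proof (intro exI conjI)
    show "openin X0_top (K_orbit ` ?U)" "openin X0_top (K_orbit ` ?V)"
      by (intro K_orbit_open continuous_openin_preimage_gen[OF cont]; simp)+
    show "S \<in> K_orbit ` ?U" "T \<in> K_orbit ` ?V" using ab fa fb by auto
    show "disjnt (K_orbit ` ?U) (K_orbit ` ?V)"
      unfolding disjnt_iff
    proof (intro allI notI, elim conjE imageE)
      fix O' z z' assume "O' = K_orbit z" "z \<in> ?U" "O' = K_orbit z'" "z' \<in> ?V"
      then show False using inv[of z z'] by auto
    qed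
  qed
qed

section \<open>Normal forms\<close>

text \<open>
  The points that have a normal form for \<open>(A, j, k)\<close>.  In the basis \<open>q\<^sub>j, q\<^sub>k\<close> the vector \<open>q\<^sub>i\<close> has the
  coordinates \<open>det (q\<^sub>i, q\<^sub>k)\<close> and \<open>det (q\<^sub>j, q\<^sub>i)\<close>, divided by \<open>det (q\<^sub>j, q\<^sub>k)\<close>.  The normal form needs a nonzero
  first coordinate for \<open>i \<in> A\<close>, and a nonzero second coordinate otherwise.
\<close>

definition nf_dom :: "'n set \<Rightarrow> 'n \<Rightarrow> 'n \<Rightarrow> ('n::finite) pq set" where
  "nf_dom A j k = {y \<in> mu_complex_stable.
     (\<forall>i. if i \<in> A then det2 (snd y $ i) (snd y $ k) \<noteq> 0 else det2 (snd y $ j) (snd y $ i) \<noteq> 0)}"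

text \<open>
  The parameters of the normal form.  The condition \<open>\<lambda>\<^sub>j = 1\<close> fixes the relative scale of the basis:
  the first coordinate is multiplied by \<open>1 / (p\<^sub>j q\<^sub>k)\<close>.
\<close>

definition nf_u :: "'n set \<Rightarrow> 'n \<Rightarrow> 'n \<Rightarrow> ('n::finite) pq \<Rightarrow> 'n \<Rightarrow> complex" where
  "nf_u A j k y i = (if i \<in> A
     then scalar_product (fst y $ j) (snd y $ k) * det2 (snd y $ j) (snd y $ i) / det2 (snd y $ i) (snd y $ k)
     else det2 (snd y $ i) (snd y $ k) / (scalar_product (fst y $ j) (snd y $ k) * det2 (snd y $ j) (snd y $ i)))"

definition nf_l :: "'n set \<Rightarrow> 'n \<Rightarrow> 'n \<Rightarrow> ('n::finite) pq \<Rightarrow> 'n \<Rightarrow> complex" where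
  "nf_l A j k y i = (if i \<in> A
     then scalar_product (fst y $ i) (snd y $ k) * det2 (snd y $ i) (snd y $ k)
       / (scalar_product (fst y $ j) (snd y $ k) * det2 (snd y $ j) (snd y $ k))
     else - (scalar_product (fst y $ i) (snd y $ j) * scalar_product (fst y $ j) (snd y $ k)
       * det2 (snd y $ j) (snd y $ i) / det2 (snd y $ j) (snd y $ k)))"

definition nf_pt :: "'n set \<Rightarrow> ('n \<Rightarrow> complex) \<Rightarrow> ('n \<Rightarrow> complex) \<Rightarrow> ('n::finite) pq" where
  "nf_pt A u l = ((\<chi> i. l i *s perp (nf_dir A u i)), (\<chi> i. nf_dir A u i))"

lemma nf_pt_nth [simp]:
  "fst (nf_pt A u l) $ i = l i *s perp (nf_dir A u i)" "snd (nf_pt A u l) $ i = nf_dir A u i"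
  by (simp_all add: nf_pt_def)

lemma nf_dir_nth [simp]:
  "nf_dir A u i $ 1 = (if i \<in> A then 1 else u i)" "nf_dir A u i $ 2 = (if i \<in> A then u i else 1)"
  by (simp_all add: nf_dir_def)

lemma nf_dir_nz: "nf_dir A u i \<noteq> 0"
  by (cases "i \<in> A") (auto simp: vec_eq_iff forall_2)

lemma nf_res_eq_outer: "nf_res A u l i = outer (nf_dir A u i) (l i *s perp (nf_dir A u i))"
  by (simp add: nf_res_def outer_def vec_eq_iff forall_2 matrix_matrix_mult_def sum_2 mat_def
      power2_eq_square mult.commute)

lemma scalar_product_perp: "scalar_product (perp v) w = det2 v w"
  by (simp add: scalar_product_def sum_2 det2_def)

lemma scalar_product_smult_left: "scalar_product (c *s v) w = c * scalar_product v (w :: complex ^ 2)"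
  by (simp add: scalar_product_def sum_2 algebra_simps)

lemma det2_mult: "det2 (A *v v) (A *v w) = det A * det2 v w"
  by (simp add: det2_def matrix_vector_mult_def sum_2 det_2 algebra_simps)

lemma scalar_product_act:
  fixes A :: "complex ^ 2 ^ 2"
  shows "invertible A \<Longrightarrow> scalar_product (v v* A) (matrix_inv A *v w) = scalar_product v w"
proof -
  assume A: "invertible A"
  have "scalar_product (v v* A) w' = scalar_product v (A *v w')" for w'
    by (simp add: scalar_product_def vector_matrix_mult_def matrix_vector_mult_def sum_2 algebra_simps)
  then show ?thesis by (simp add: matrix_inv_cancel A)
qed

lemma stable_residue:
  fixes y :: "'n::finite pq"
  assumes "y \<in> mu_complex_stable"
  obtains t where "t \<noteq> 0" "fst y $ i = t *s perp (snd y $ i)"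
proof -
  note st = mu_complex_stableD[OF assms]
  obtain t where t: "fst y $ i = t *s perp (snd y $ i)" using scalar_product_0_perp[OF st(4) st(2)] .
  moreover have "t \<noteq> 0" using st(3)[of i] t by auto
  ultimately show thesis using that by blast
qed

lemma nf_dom_nz:
  fixes y :: "'n::finite pq"
  assumes y: "y \<in> nf_dom A j k" and jk: "j \<in> A"
  shows "det2 (snd y $ j) (snd y $ k) \<noteq> 0" "scalar_product (fst y $ j) (snd y $ k) \<noteq> 0"
    "y \<in> mu_complex_stable" "i \<in> A \<Longrightarrow> det2 (snd y $ i) (snd y $ k) \<noteq> 0"
    "i \<notin> A \<Longrightarrow> det2 (snd y $ j) (snd y $ i) \<noteq> 0"
proof -
  show st: "y \<in> mu_complex_stable" and d: "det2 (snd y $ j) (snd y $ k) \<noteq> 0"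
    and "i \<in> A \<Longrightarrow> det2 (snd y $ i) (snd y $ k) \<noteq> 0" "i \<notin> A \<Longrightarrow> det2 (snd y $ j) (snd y $ i) \<noteq> 0"
    using y jk by (auto simp: nf_dom_def dest: spec[of _ j] spec[of _ i])
  obtain t where "t \<noteq> 0" "fst y $ j = t *s perp (snd y $ j)" by (rule stable_residue[OF st])
  then show "scalar_product (fst y $ j) (snd y $ k) \<noteq> 0"
    using d by (simp add: scalar_product_smult_left scalar_product_perp)
qed

text \<open>
  Under \<open>[A; e]\<close> the number \<open>det (q\<^sub>a, q\<^sub>b)\<close> is multiplied by \<open>e\<^sub>a e\<^sub>b\<close> and \<open>p\<^sub>a q\<^sub>b\<close> by \<open>e\<^sub>b / e\<^sub>a\<close>; all factors
  cancel in the parameters.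
\<close>

lemma nf_invariant:
  fixes y :: "'n::finite pq"
  assumes y: "y' \<in> KC_orbit y"
  shows "nf_u A j k y' = nf_u A j k y" "nf_l A j k y' = nf_l A j k y"
    "y \<in> nf_dom A j k \<Longrightarrow> y' \<in> nf_dom A j k"
proof -
  obtain B e where B: "B \<in> SL2" "\<And>i. e $ i \<noteq> 0" "y' = pq_act y B e"
    using y by (auto simp: KC_orbit_def)
  have detB: "det (matrix_inv B) = 1" using SL2_inv[OF B(1)] by (simp add: SL2_def)
  have d: "det2 (snd y' $ a) (snd y' $ b) = e $ a * e $ b * det2 (snd y $ a) (snd y $ b)" for a b
    by (simp add: B(3) det2_mult detB)
  have s: "scalar_product (fst y' $ a) (snd y' $ b) = e $ b / e $ a * scalar_product (fst y $ a) (snd y $ b)" for a b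
    by (simp add: B(3) scalar_product_smult scalar_product_smult_left scalar_product_act SL2_invertible[OF B(1)]
        divide_inverse)
  show "nf_u A j k y' = nf_u A j k y" "nf_l A j k y' = nf_l A j k y"
    unfolding nf_u_def nf_l_def fun_eq_iff d s using B(2) by (auto simp: field_simps)
  show "y' \<in> nf_dom A j k" if "y \<in> nf_dom A j k"
    using that B(2) KC_orbit_stable[OF _ y] by (auto simp: nf_dom_def d)
qed

lemma nf_pt_coords:
  assumes jk: "j \<in> A" "k \<notin> A" and ul: "u j = 0" "u k = 0" "l j = 1"
  shows "nf_u A j k (nf_pt A u l) = u" "nf_l A j k (nf_pt A u l) = l"
    "nf_pt A u l \<in> mu_complex_stable \<Longrightarrow> nf_pt A u l \<in> nf_dom A j k"
  using jk ul
  by (auto simp: fun_eq_iff nf_u_def nf_l_def nf_dom_def scalar_product_smult_left scalar_product_perp det2_def)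

text \<open>
  The matrix \<open>P\<close> expresses vectors in the basis \<open>q\<^sub>j, q\<^sub>k\<close>, with the first coordinate multiplied by
  \<open>s = 1 / (p\<^sub>j q\<^sub>k)\<close>; \<open>a\<^sub>i\<close> rescales \<open>P q\<^sub>i\<close> to \<open>(1, w\<^sub>i)\<close> or \<open>(z\<^sub>i, 1)\<close>.
\<close>

lemma nf_pt_in_orbit:
  fixes y :: "'n::finite pq"
  assumes y: "y \<in> nf_dom A j k" and jk: "j \<in> A" "k \<notin> A"
  shows "nf_pt A (nf_u A j k y) (nf_l A j k y) \<in> KC_orbit y"
proof -
  note nz = nf_dom_nz[OF y jk(1)]
  define \<delta> where "\<delta> = det2 (snd y $ j) (snd y $ k)"
  define s where "s = 1 / scalar_product (fst y $ j) (snd y $ k)"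
  define c where "c = (\<lambda>i. det2 (snd y $ i) (snd y $ k))"
  define b where "b = (\<lambda>i. det2 (snd y $ j) (snd y $ i))"
  have \<delta>: "\<delta> \<noteq> 0" and s: "s \<noteq> 0" using nz by (simp_all add: \<delta>_def s_def)
  define P :: "complex ^ 2 ^ 2" where
    "P = vector [vector [s / \<delta> * snd y $ k $ 2, - (s / \<delta> * snd y $ k $ 1)],
      vector [- (snd y $ j $ 2 / \<delta>), snd y $ j $ 1 / \<delta>]]"
  have P_vec: "P *v snd y $ i = vector [s / \<delta> * c i, b i / \<delta>]" for i
    by (simp add: P_def vec_eq_iff forall_2 matrix_vector_mult_def sum_2 b_def c_def det2_def
        algebra_simps diff_divide_distrib)
  have "det P = s / \<delta> * (det2 (snd y $ j) (snd y $ k) / \<delta>)"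
    by (simp add: P_def det_2 det2_def algebra_simps diff_divide_distrib)
  then have detP: "det P = s / \<delta>" using \<delta> by (simp flip: \<delta>_def)
  then have P: "invertible P" using \<delta> s by (simp add: invertible_det_nz)
  define a where "a = (\<lambda>i. if i \<in> A then \<delta> / (s * c i) else \<delta> / b i)"
  have cnz: "i \<in> A \<Longrightarrow> c i \<noteq> 0" and bnz: "i \<notin> A \<Longrightarrow> b i \<noteq> 0" for i
    using nz(4,5)[of i] by (simp_all add: c_def b_def)
  have a: "a i \<noteq> 0" for i using cnz bnz \<delta> s by (simp add: a_def)
  let ?u = "nf_u A j k y" and ?l = "nf_l A j k y"
  have u: "?u i = (if i \<in> A then b i / (s * c i) else s * c i / b i)" for i
    by (simp add: nf_u_def b_def c_def s_def)
  have q: "nf_dir A ?u i = a i *s (P *v snd y $ i)" for i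
    using cnz[of i] bnz[of i] \<delta> s
    by (cases "i \<in> A") (simp_all add: vec_eq_iff forall_2 P_vec a_def u)
  have p: "a i *s (?l i *s perp (nf_dir A ?u i)) = fst y $ i v* matrix_inv P" for i
  proof -
    obtain t where t: "fst y $ i = t *s perp (snd y $ i)" by (rule stable_residue[OF nz(3)])
    have l: "?l i = (if i \<in> A then t * s * c i * c i / \<delta> else t * b i * b i / (s * \<delta>))"
      by (simp add: nf_l_def t scalar_product_smult_left scalar_product_perp det2_swap[of "snd y $ i" "snd y $ j"]
          c_def b_def \<delta>_def s_def)
    have perpP: "perp (P *v w) v* P = (s / \<delta>) *s perp w" for w
    proof -
      have "perp (P *v w) v* P = (P $ 1 $ 1 * P $ 2 $ 2 - P $ 1 $ 2 * P $ 2 $ 1) *s perp w"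
        by (simp add: vec_eq_iff forall_2 vector_matrix_mult_def matrix_vector_mult_def sum_2 algebra_simps)
      then show ?thesis using detP unfolding det_2 by (simp only:)
    qed
    have perp_smult: "perp (r *s v) = r *s perp v" for r v
      by (simp add: vec_eq_iff forall_2)
    have "(a i *s (?l i *s perp (nf_dir A ?u i))) v* P = (a i * ?l i * a i * (s / \<delta>)) *s perp (snd y $ i)"
      unfolding q by (simp add: perp_smult vec_mult_smult perpP vector_smult_assoc)
    also have "a i * ?l i * a i * (s / \<delta>) = t"
      using cnz[of i] bnz[of i] \<delta> s by (cases "i \<in> A") (simp_all add: a_def l field_simps)
    finally have "(a i *s (?l i *s perp (nf_dir A ?u i))) v* P v* matrix_inv P = fst y $ i v* matrix_inv P"
      by (simp add: t)
    then show ?thesis by (simp add: vector_matrix_mul_assoc matrix_inv_mult P)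
  qed
  show ?thesis
  proof (rule KC_orbit_GL2I[OF P a])
    show "snd (nf_pt A ?u ?l) $ i = a i *s (P *v snd y $ i)" for i
      unfolding nf_pt_nth by (rule q)
    show "a i *s fst (nf_pt A ?u ?l) $ i = fst y $ i v* matrix_inv P" for i
      unfolding nf_pt_nth by (rule p)
  qed
qed

text \<open>
  By invariance the parameters can be read off from any point of the orbit, in particular from the
  normal form itself; this gives uniqueness.
\<close>

lemma normal_form_iff:
  fixes x :: "'n::finite \<Rightarrow> cp1" and y :: "'n pq"
  assumes x: "inj x" and jk: "j \<in> A" "k \<notin> A" and y: "y \<in> mu_complex_stable"
  shows "normal_form x A j k (higgs_class x y) u l \<longleftrightarrow>
     y \<in> nf_dom A j k \<and> u = nf_u A j k y \<and> l = nf_l A j k y"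
proof -
  have "normal_form x A j k (higgs_class x y) u l \<longleftrightarrow> u j = 0 \<and> u k = 0 \<and> l j = 1 \<and> (\<forall>i. l i \<noteq> 0) \<and>
      corresponds x (nf_pt A u l) (higgs_class x y)"
    using H0_eq_image[OF x] y unfolding normal_form_def corresponds_def by (auto simp: nf_res_eq_outer)
  also have "\<dots> \<longleftrightarrow> u j = 0 \<and> u k = 0 \<and> l j = 1 \<and> (\<forall>i. l i \<noteq> 0) \<and>
      nf_pt A u l \<in> mu_complex_stable \<and> nf_pt A u l \<in> KC_orbit y"
    using corresponds_iff[OF x, of "nf_pt A u l"] higgs_class_eq_iff[OF x y, of "nf_pt A u l"]
    by (auto simp: nf_dir_nz)
  also have "\<dots> \<longleftrightarrow> y \<in> nf_dom A j k \<and> u = nf_u A j k y \<and> l = nf_l A j k y"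
  proof
    assume h: "u j = 0 \<and> u k = 0 \<and> l j = 1 \<and> (\<forall>i. l i \<noteq> 0) \<and>
      nf_pt A u l \<in> mu_complex_stable \<and> nf_pt A u l \<in> KC_orbit y"
    then have "nf_pt A u l \<in> nf_dom A j k" using nf_pt_coords(3)[of j A k u l] jk by blast
    then have "y \<in> nf_dom A j k" using nf_invariant(3)[OF KC_orbit_sym] h by blast
    then show "y \<in> nf_dom A j k \<and> u = nf_u A j k y \<and> l = nf_l A j k y"
      using nf_invariant(1,2)[of "nf_pt A u l" y A j k] nf_pt_coords(1,2)[of j A k u l] jk h by simp
  next
    assume h: "y \<in> nf_dom A j k \<and> u = nf_u A j k y \<and> l = nf_l A j k y"
    then have yd: "y \<in> nf_dom A j k" by blast
    note nz = nf_dom_nz[OF yd jk(1)]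
    have orb: "nf_pt A u l \<in> KC_orbit y" using nf_pt_in_orbit[OF yd jk] h by simp
    then have st: "nf_pt A u l \<in> mu_complex_stable" using KC_orbit_stable y by blast
    have "l i \<noteq> 0" for i using mu_complex_stableD(3)[OF st, of i] by auto
    moreover have "u j = 0" "u k = 0" "l j = 1"
      using h jk nz(1,2) by (simp_all add: nf_u_def nf_l_def)
    ultimately show "u j = 0 \<and> u k = 0 \<and> l j = 1 \<and> (\<forall>i. l i \<noteq> 0) \<and>
      nf_pt A u l \<in> mu_complex_stable \<and> nf_pt A u l \<in> KC_orbit y"
      using orb st by blast
  qed
  finally show ?thesis .
qed

text \<open>
  The points over the domain of the chart with index \<open>(A, j, k, i0)\<close>.
\<close>

definition chart_dom :: "'n set \<Rightarrow> 'n \<Rightarrow> 'n \<Rightarrow> 'n \<Rightarrow> ('n::finite) pq set" where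
  "chart_dom A j k i0 = {y \<in> nf_dom A j k. i0 \<in> A \<or> nf_u A j k y i0 \<noteq> 0}"

definition chart_coord :: "'n set \<Rightarrow> 'n \<Rightarrow> 'n \<Rightarrow> 'n \<Rightarrow> ('n::finite) pq \<Rightarrow> complex ^ ('n + 'n)" where
  "chart_coord A j k i0 y = (\<chi> m. case m of Inl i \<Rightarrow> if i \<in> {j, k, i0} then 0 else nf_u A j k y i
                       | Inr i \<Rightarrow> if i \<in> {j, k, i0} then 0 else nf_l A j k y i)"

lemma H0_chart_dom_iff:
  fixes x :: "'n::finite \<Rightarrow> cp1" and y :: "'n pq"
  assumes x: "inj x" and jk: "j \<in> A" "k \<notin> A" and y: "y \<in> mu_complex_stable"
  shows "higgs_class x y \<in> H0_chart_dom x A j k i0 \<longleftrightarrow> y \<in> chart_dom A j k i0"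
proof -
  have "higgs_class x y \<in> H0 (range x)" using H0_eq_image[OF x] y by blast
  then have "higgs_class x y \<in> H0_chart_dom x A j k i0 \<longleftrightarrow>
      (\<exists>u l. normal_form x A j k (higgs_class x y) u l \<and> (i0 \<in> A \<or> u i0 \<noteq> 0))"
    by (simp add: H0_chart_dom_def)
  also have "\<dots> \<longleftrightarrow> y \<in> chart_dom A j k i0"
    unfolding normal_form_iff[OF x jk y] chart_dom_def by blast
  finally show ?thesis .
qed

lemma H0_chart_map_eq:
  fixes x :: "'n::finite \<Rightarrow> cp1" and y :: "'n pq"
  assumes x: "inj x" and jk: "j \<in> A" "k \<notin> A" and y: "y \<in> chart_dom A j k i0"
  shows "H0_chart_map x A j k i0 (higgs_class x y) = chart_coord A j k i0 y"
proof -
  have st: "y \<in> mu_complex_stable" and dom: "y \<in> nf_dom A j k"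
    using y by (auto simp: chart_dom_def nf_dom_def)
  have "(THE (u, l). normal_form x A j k (higgs_class x y) u l) = (nf_u A j k y, nf_l A j k y)"
    using dom normal_form_iff[OF x jk st] by (intro the_equality) auto
  then show ?thesis by (simp only: H0_chart_map_def chart_coord_def Let_def prod.case)
qed

text \<open>
  Fix \<open>k\<close>, and let \<open>A\<close> consist of the indices with \<open>q\<^sub>i\<close> not proportional to \<open>q\<^sub>k\<close>; it contains some \<open>j\<close>.
  If \<open>j\<close> were its only element, all residues other than \<open>N\<^sub>j\<close> would annihilate \<open>q\<^sub>k\<close>, so that \<open>N\<^sub>j q\<^sub>k = 0\<close>,
  which is impossible.  Any other element of \<open>A\<close> can be eliminated.
\<close>

lemma ex_chart_dom:
  fixes y :: "'n::finite pq"
  assumes y: "y \<in> mu_complex_stable"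
  shows "\<exists>A j k i0. j \<in> A \<and> k \<notin> A \<and> i0 \<notin> {j, k} \<and> y \<in> chart_dom A j k i0"
proof -
  note st = mu_complex_stableD[OF y]
  fix k0 :: 'n
  obtain j where j: "snd y $ j \<notin> vec.span {snd y $ k0}"
    using not_all_proportional[OF st(6) st(2)] by blast
  then have jk: "det2 (snd y $ j) (snd y $ k0) \<noteq> 0" using in_span_iff_det2[OF st(2)] by blast
  define A where "A = {i. det2 (snd y $ i) (snd y $ k0) \<noteq> 0}"
  have par: "\<exists>c. snd y $ i = c *s snd y $ k0" if "i \<notin> A" for i
    using that in_span_iff_det2[OF st(2)[of k0], of "snd y $ i"] by (auto simp: A_def span_single)
  have "det2 (snd y $ j) (snd y $ i) \<noteq> 0" if "i \<notin> A" for i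
    using par[OF that] jk st(2)[of i] by auto
  then have dom: "y \<in> nf_dom A j k0" using y by (auto simp: nf_dom_def A_def)
  have "\<exists>i0\<in>A. i0 \<noteq> j"
  proof (rule ccontr)
    assume "\<not> ?thesis"
    then have A: "i \<notin> A" if "i \<noteq> j" for i using that by blast
    have "0 = (\<Sum>i\<in>UNIV. outer (snd y $ i) (fst y $ i)) *v snd y $ k0" by (simp add: st(5))
    also have "\<dots> = (\<Sum>i\<in>UNIV. outer (snd y $ i) (fst y $ i) *v snd y $ k0)"
      by (simp add: matrix_vector_mult_def vec_eq_iff sum_2 sum.distrib sum_distrib_right)
    also have "\<dots> = (\<Sum>i\<in>UNIV. if i = j then scalar_product (fst y $ j) (snd y $ k0) *s snd y $ j else 0)"
    proof (rule sum.cong[OF refl])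
      fix i
      show "outer (snd y $ i) (fst y $ i) *v snd y $ k0 =
          (if i = j then scalar_product (fst y $ j) (snd y $ k0) *s snd y $ j else 0)"
      proof (cases "i = j")
        case False
        obtain c where c: "snd y $ i = c *s snd y $ k0" using par[OF A[OF False]] by blast
        then have "c \<noteq> 0" using st(2)[of i] by auto
        moreover have "c * scalar_product (fst y $ i) (snd y $ k0) = 0"
          using st(4)[of i] unfolding c by (simp add: scalar_product_smult)
        ultimately show ?thesis using False by (simp add: outer_mult_vec)
      qed (simp add: outer_mult_vec)
    qed
    also have "\<dots> = scalar_product (fst y $ j) (snd y $ k0) *s snd y $ j" by simp
    finally have "scalar_product (fst y $ j) (snd y $ k0) = 0" using st(2)[of j] by simp
    moreover obtain t where "t \<noteq> 0" "fst y $ j = t *s perp (snd y $ j)" by (rule stable_residue[OF y])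
    ultimately show False using jk by (simp add: scalar_product_smult_left scalar_product_perp)
  qed
  then obtain i0 where i0: "i0 \<in> A" "i0 \<noteq> j" by blast
  have "j \<in> A" "k0 \<notin> A" using jk by (simp_all add: A_def)
  then have "j \<in> A \<and> k0 \<notin> A \<and> i0 \<notin> {j, k0} \<and> y \<in> chart_dom A j k0 i0"
    using i0 dom by (auto simp: chart_dom_def)
  then show ?thesis by blast
qed

section \<open>Solving the moment map equations\<close>

definition free_ix :: "'n \<Rightarrow> 'n \<Rightarrow> 'n \<Rightarrow> ('n::finite) set" where
  "free_ix j k i0 = - {j, k, i0}"

text \<open>
  The following functions solve \<open>\<Sum>\<^sub>i N\<^sub>i = 0\<close>.  The entries \<open>(1, 1)\<close> and \<open>(1, 2)\<close> do not involve \<open>\<lambda>\<^sub>k\<close>, since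
  \<open>z\<^sub>k = 0\<close>.  They prescribe \<open>\<lambda>\<^sub>i\<^sub>0 u\<^sub>i\<^sub>0 = - sum11\<close>, and \<open>\<lambda>\<^sub>i\<^sub>0 = - sum12\<close> or \<open>\<lambda>\<^sub>i\<^sub>0 u\<^sub>i\<^sub>0\<^sup>2 = - sum12\<close>, according to whether
  \<open>i0 \<in> A\<close>.  The entry \<open>(2, 1)\<close> then gives \<open>\<lambda>\<^sub>k\<close>.
\<close>

definition sum11 :: "'n \<Rightarrow> 'n \<Rightarrow> 'n \<Rightarrow> complex ^ (('n::finite) + 'n) \<Rightarrow> complex" where
  "sum11 j k i0 v = (\<Sum>i\<in>free_ix j k i0. v $ Inr i * v $ Inl i)"

text \<open>
  The summand \<open>1\<close> is \<open>\<lambda>\<^sub>j\<close>.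
\<close>

definition sum12 :: "'n set \<Rightarrow> 'n \<Rightarrow> 'n \<Rightarrow> 'n \<Rightarrow> complex ^ (('n::finite) + 'n) \<Rightarrow> complex" where
  "sum12 A j k i0 v = 1 + (\<Sum>i\<in>free_ix j k i0. if i \<in> A then v $ Inr i else v $ Inr i * (v $ Inl i)\<^sup>2)"

text \<open>
  In both cases the contribution of \<open>i0\<close> to the entry \<open>(2, 1)\<close> is \<open>sum11\<^sup>2 / sum12\<close>.
\<close>

definition solve_lk :: "'n set \<Rightarrow> 'n \<Rightarrow> 'n \<Rightarrow> 'n \<Rightarrow> complex ^ (('n::finite) + 'n) \<Rightarrow> complex" where
  "solve_lk A j k i0 v = (sum11 j k i0 v)\<^sup>2 / sum12 A j k i0 v
     - (\<Sum>i\<in>free_ix j k i0. if i \<in> A then v $ Inr i * (v $ Inl i)\<^sup>2 else v $ Inr i)"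

definition solve_u :: "'n set \<Rightarrow> 'n \<Rightarrow> 'n \<Rightarrow> 'n \<Rightarrow> complex ^ (('n::finite) + 'n) \<Rightarrow> 'n \<Rightarrow> complex" where
  "solve_u A j k i0 v i = (if i = j \<or> i = k then 0
     else if i = i0 then (if i0 \<in> A then sum11 j k i0 v / sum12 A j k i0 v else sum12 A j k i0 v / sum11 j k i0 v)
     else v $ Inl i)"

definition solve_l :: "'n set \<Rightarrow> 'n \<Rightarrow> 'n \<Rightarrow> 'n \<Rightarrow> complex ^ (('n::finite) + 'n) \<Rightarrow> 'n \<Rightarrow> complex" where
  "solve_l A j k i0 v i = (if i = j then 1 else if i = k then solve_lk A j k i0 v
     else if i = i0 then (if i0 \<in> A then - sum12 A j k i0 v else - ((sum11 j k i0 v)\<^sup>2 / sum12 A j k i0 v))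
     else v $ Inr i)"

text \<open>
  The image of the chart is the intersection of this open set with the coordinate subspace: the
  conditions say that the solution exists and that all \<open>\<lambda>\<^sub>i\<close> are nonzero.
\<close>

definition chart_open :: "'n set \<Rightarrow> 'n \<Rightarrow> 'n \<Rightarrow> 'n \<Rightarrow> (complex ^ (('n::finite) + 'n)) set" where
  "chart_open A j k i0 = {v. (\<forall>i\<in>free_ix j k i0. v $ Inr i \<noteq> 0) \<and> sum12 A j k i0 v \<noteq> 0 \<and>
     (i0 \<in> A \<or> sum11 j k i0 v \<noteq> 0) \<and> solve_lk A j k i0 v \<noteq> 0}"

definition chart_ix :: "'n \<Rightarrow> 'n \<Rightarrow> 'n \<Rightarrow> (('n::finite) + 'n) set" where
  "chart_ix j k i0 = Inl ` free_ix j k i0 \<union> Inr ` free_ix j k i0"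

definition chart_lift :: "'n set \<Rightarrow> 'n \<Rightarrow> 'n \<Rightarrow> 'n \<Rightarrow> complex ^ (('n::finite) + 'n) \<Rightarrow> 'n pq" where
  "chart_lift A j k i0 v = nf_pt A (solve_u A j k i0 v) (solve_l A j k i0 v)"

text \<open>
  The three sums are the entries of \<open>\<Sum>\<^sub>i N\<^sub>i\<close>, up to sign.  The vectors \<open>q\<^sub>j = (1, 0)\<close> and \<open>q\<^sub>k = (0, 1)\<close> are
  never proportional.
\<close>

lemma nf_pt_stable_iff:
  fixes u l :: "'n::finite \<Rightarrow> complex"
  assumes jk: "j \<in> A" "k \<notin> A" and ul: "u j = 0" "u k = 0"
  shows "nf_pt A u l \<in> mu_complex_stable \<longleftrightarrow> (\<forall>i. l i \<noteq> 0) \<and>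
    (\<Sum>i\<in>UNIV. l i * u i) = 0 \<and> (\<Sum>i\<in>UNIV. if i \<in> A then l i else l i * (u i)\<^sup>2) = 0 \<and>
    (\<Sum>i\<in>UNIV. if i \<in> A then l i * (u i)\<^sup>2 else l i) = 0"
proof -
  let ?N = "\<Sum>i\<in>UNIV. outer (nf_dir A u i) (l i *s perp (nf_dir A u i))"
  have e: "?N $ 1 $ 1 = - (\<Sum>i\<in>UNIV. l i * u i)" "?N $ 2 $ 2 = (\<Sum>i\<in>UNIV. l i * u i)"
    "?N $ 1 $ 2 = (\<Sum>i\<in>UNIV. if i \<in> A then l i else l i * (u i)\<^sup>2)"
    "?N $ 2 $ 1 = - (\<Sum>i\<in>UNIV. if i \<in> A then l i * (u i)\<^sup>2 else l i)"
    unfolding sum_component sum_negf[symmetric]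
    by (intro sum.cong refl; simp add: outer_def power2_eq_square mult.commute)+
  have N0: "?N = 0 \<longleftrightarrow> (\<Sum>i\<in>UNIV. l i * u i) = 0 \<and> (\<Sum>i\<in>UNIV. if i \<in> A then l i else l i * (u i)\<^sup>2) = 0 \<and>
    (\<Sum>i\<in>UNIV. if i \<in> A then l i * (u i)\<^sup>2 else l i) = 0"
    unfolding vec_eq_iff forall_2 e zero_index by (simp only: neg_equal_0_iff_equal) blast
  have sp: "scalar_product (l i *s perp (nf_dir A u i)) (nf_dir A u i) = 0" for i
    by (simp add: scalar_product_smult_left scalar_product_perp)
  have perp0: "perp v = 0 \<longleftrightarrow> v = 0" for v by (auto simp: vec_eq_iff forall_2)
  have "nf_dir A u k \<noteq> c *s nf_dir A u j" for c
    using jk ul by (auto simp: vec_eq_iff forall_2)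
  then have np: "\<not> (\<forall>i j. \<exists>c. nf_dir A u j = c *s nf_dir A u i)" by blast
  have "nf_pt A u l \<in> mu_complex_stable \<longleftrightarrow> ?N = 0 \<and> (\<forall>i. l i \<noteq> 0)"
    unfolding nf_pt_def mu_complex_stable_def mem_Collect_eq case_prod_conv mu_complex_zero_iff vec_lambda_beta
    using np by (auto simp: sp nf_dir_nz perp0)
  then show ?thesis unfolding N0 by blast
qed

lemma sum_split_free_ix:
  fixes f :: "'n::finite \<Rightarrow> complex"
  assumes "j \<noteq> k" "i0 \<notin> {j, k}"
  shows "(\<Sum>i\<in>UNIV. f i) = f j + f k + f i0 + (\<Sum>i\<in>free_ix j k i0. f i)"
proof -
  have "(\<Sum>i\<in>UNIV. f i) = (\<Sum>i\<in>{j, k, i0}. f i) + (\<Sum>i\<in>free_ix j k i0. f i)"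
    unfolding free_ix_def by (subst sum.union_disjoint[symmetric]) auto
  moreover have "j \<noteq> i0" "k \<noteq> i0" using assms(2) by auto
  ultimately show ?thesis using assms(1) by (simp add: add.assoc)
qed

context
  fixes A :: "'n::finite set" and j k i0 :: 'n
  assumes jk: "j \<in> A" "k \<notin> A" and i0: "i0 \<notin> {j, k}"
begin

lemma index_ne: "j \<noteq> k" "i0 \<noteq> j" "i0 \<noteq> k"
  using jk i0 by auto

lemma chart_lift_in:
  assumes v: "v \<in> chart_open A j k i0"
  shows "chart_lift A j k i0 v \<in> chart_dom A j k i0"
    and "v \<in> coord_space (chart_ix j k i0) \<Longrightarrow> chart_coord A j k i0 (chart_lift A j k i0 v) = v"
proof -
  let ?u = "solve_u A j k i0 v" and ?l = "solve_l A j k i0 v"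
  let ?S = "sum11 j k i0 v" and ?T = "sum12 A j k i0 v"
  have nz: "\<And>i. i \<in> free_ix j k i0 \<Longrightarrow> v $ Inr i \<noteq> 0" "?T \<noteq> 0" "i0 \<notin> A \<Longrightarrow> ?S \<noteq> 0"
    "solve_lk A j k i0 v \<noteq> 0"
    using v by (auto simp: chart_open_def)
  have spec: "?u j = 0" "?u k = 0" "?l j = 1" "?l k = solve_lk A j k i0 v"
    using index_ne by (simp_all add: solve_u_def solve_l_def)
  have u0: "?u i0 = (if i0 \<in> A then ?S / ?T else ?T / ?S)"
    and l0: "?l i0 = (if i0 \<in> A then - ?T else - (?S\<^sup>2 / ?T))"
    using index_ne by (simp_all add: solve_u_def solve_l_def)
  have free: "?u i = v $ Inl i" "?l i = v $ Inr i" if "i \<in> free_ix j k i0" for i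
    using that by (auto simp: solve_u_def solve_l_def free_ix_def)
  have "?l i \<noteq> 0" for i
    using nz(1)[of i] nz(2-4) by (auto simp: solve_l_def free_ix_def)
  moreover have "(\<Sum>i\<in>UNIV. ?l i * ?u i) = 0"
  proof -
    have "(\<Sum>i\<in>UNIV. ?l i * ?u i) = ?l i0 * ?u i0 + ?S"
      unfolding sum_split_free_ix[OF index_ne(1) i0] sum11_def by (simp add: spec free)
    also have "?l i0 * ?u i0 = - ?S" unfolding u0 l0 using nz by (simp add: power2_eq_square)
    finally show ?thesis by simp
  qed
  moreover have "(\<Sum>i\<in>UNIV. if i \<in> A then ?l i else ?l i * (?u i)\<^sup>2) = 0"
  proof -
    have "(\<Sum>i\<in>UNIV. if i \<in> A then ?l i else ?l i * (?u i)\<^sup>2) =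
        (if i0 \<in> A then ?l i0 else ?l i0 * (?u i0)\<^sup>2) + ?T"
      unfolding sum_split_free_ix[OF index_ne(1) i0] sum12_def using jk
      by (simp add: spec free cong: if_cong)
    also have "(if i0 \<in> A then ?l i0 else ?l i0 * (?u i0)\<^sup>2) = - ?T"
      unfolding u0 l0 using nz by (simp add: power2_eq_square)
    finally show ?thesis by simp
  qed
  moreover have "(\<Sum>i\<in>UNIV. if i \<in> A then ?l i * (?u i)\<^sup>2 else ?l i) = 0"
  proof -
    have "(\<Sum>i\<in>UNIV. if i \<in> A then ?l i * (?u i)\<^sup>2 else ?l i) = solve_lk A j k i0 v
        + (if i0 \<in> A then ?l i0 * (?u i0)\<^sup>2 else ?l i0)
        + (\<Sum>i\<in>free_ix j k i0. if i \<in> A then v $ Inr i * (v $ Inl i)\<^sup>2 else v $ Inr i)"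
      unfolding sum_split_free_ix[OF index_ne(1) i0] using jk
      by (simp add: spec free cong: if_cong)
    also have "(if i0 \<in> A then ?l i0 * (?u i0)\<^sup>2 else ?l i0) = - (?S\<^sup>2 / ?T)"
      unfolding u0 l0 using nz by (simp add: power2_eq_square)
    finally show ?thesis by (simp add: solve_lk_def)
  qed
  ultimately have st: "chart_lift A j k i0 v \<in> mu_complex_stable"
    unfolding chart_lift_def using nf_pt_stable_iff[of j A k ?u ?l] jk spec by blast
  note co = nf_pt_coords[of j A k ?u ?l, OF jk spec(1-3), folded chart_lift_def]
  show "chart_lift A j k i0 v \<in> chart_dom A j k i0"
    using co(3)[OF st] u0 nz by (auto simp: chart_dom_def co(1))
  assume vc: "v \<in> coord_space (chart_ix j k i0)"
  have off: "v $ Inl i = 0 \<and> v $ Inr i = 0" if "i \<notin> free_ix j k i0" for i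
    using vc that by (auto simp: coord_space_def chart_ix_def)
  show "chart_coord A j k i0 (chart_lift A j k i0 v) = v"
    unfolding chart_coord_def co
  proof (subst vec_eq_iff, intro allI)
    fix m
    show "(\<chi> m. case m of Inl i \<Rightarrow> if i \<in> {j, k, i0} then 0 else ?u i
        | Inr i \<Rightarrow> if i \<in> {j, k, i0} then 0 else ?l i) $ m = v $ m"
    proof (cases m)
      case (Inl i)
      then show ?thesis using off[of i] free[of i] by (auto simp: free_ix_def)
    next
      case (Inr i)
      then show ?thesis using off[of i] free[of i] by (auto simp: free_ix_def)
    qed
  qed
qed

text \<open>
  The moment map equations determine the eliminated parameters, so that the solution formulas recover
  those of \<open>y\<close>.
\<close>

lemma chart_coord_in:
  assumes y: "y \<in> chart_dom A j k i0"
  shows "chart_coord A j k i0 y \<in> chart_open A j k i0 \<inter> coord_space (chart_ix j k i0)"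
    and "chart_lift A j k i0 (chart_coord A j k i0 y) \<in> KC_orbit y"
proof -
  let ?u = "nf_u A j k y" and ?l = "nf_l A j k y"
  let ?v = "chart_coord A j k i0 y"
  let ?S = "sum11 j k i0 ?v" and ?T = "sum12 A j k i0 ?v"
  have dom: "y \<in> nf_dom A j k" and u0: "i0 \<notin> A \<Longrightarrow> ?u i0 \<noteq> 0" using y by (auto simp: chart_dom_def)
  note nz = nf_dom_nz[OF dom jk(1)]
  have spec: "?u j = 0" "?u k = 0" "?l j = 1"
    using jk nz(1,2) by (simp_all add: nf_u_def nf_l_def)
  have orb: "nf_pt A ?u ?l \<in> KC_orbit y" by (rule nf_pt_in_orbit[OF dom jk])
  then have "nf_pt A ?u ?l \<in> mu_complex_stable" using KC_orbit_stable nz(3) by blast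
  then have l: "\<And>i. ?l i \<noteq> 0" and eqs: "(\<Sum>i\<in>UNIV. ?l i * ?u i) = 0"
    "(\<Sum>i\<in>UNIV. if i \<in> A then ?l i else ?l i * (?u i)\<^sup>2) = 0"
    "(\<Sum>i\<in>UNIV. if i \<in> A then ?l i * (?u i)\<^sup>2 else ?l i) = 0"
    unfolding nf_pt_stable_iff[of j A k ?u ?l, OF jk spec(1,2)] by auto
  have free: "?v $ Inl i = ?u i" "?v $ Inr i = ?l i" if "i \<in> free_ix j k i0" for i
    using that by (auto simp: chart_coord_def free_ix_def)
  have S: "?S = - (?l i0 * ?u i0)"
    using eqs(1) unfolding sum_split_free_ix[OF index_ne(1) i0] sum11_def
    by (simp add: spec free eq_neg_iff_add_eq_0 add.commute)
  have T: "?T = - (if i0 \<in> A then ?l i0 else ?l i0 * (?u i0)\<^sup>2)"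
    using eqs(2) jk unfolding sum_split_free_ix[OF index_ne(1) i0] sum12_def
    by (simp add: spec free eq_neg_iff_add_eq_0 add_ac cong: if_cong)
  have T0: "?T \<noteq> 0" and S0: "i0 \<notin> A \<Longrightarrow> ?S \<noteq> 0" unfolding S T using l u0 by auto
  have "?S\<^sup>2 / ?T = - (if i0 \<in> A then ?l i0 * (?u i0)\<^sup>2 else ?l i0)"
    unfolding S T using l[of i0] u0 by (simp add: power2_eq_square)
  moreover have "?l k = - (if i0 \<in> A then ?l i0 * (?u i0)\<^sup>2 else ?l i0)
      - (\<Sum>i\<in>free_ix j k i0. if i \<in> A then ?l i * (?u i)\<^sup>2 else ?l i)"
    using eqs(3) jk unfolding sum_split_free_ix[OF index_ne(1) i0]
    by (simp add: spec eq_neg_iff_add_eq_0 algebra_simps)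
  ultimately have lk: "solve_lk A j k i0 ?v = ?l k"
    unfolding solve_lk_def by (simp add: free cong: if_cong sum.cong)
  have "solve_u A j k i0 ?v i = ?u i" for i
  proof (cases "i \<in> free_ix j k i0")
    case True
    then show ?thesis using free[OF True] by (auto simp: solve_u_def free_ix_def)
  next
    case False
    then have "i = j \<or> i = k \<or> i = i0" by (auto simp: free_ix_def)
    moreover have "?S / ?T = ?u i0" if "i0 \<in> A" unfolding S T using l[of i0] that by simp
    moreover have "?T / ?S = ?u i0" if "i0 \<notin> A"
      unfolding S T using l[of i0] u0 that by (simp add: power2_eq_square)
    ultimately show ?thesis using index_ne spec by (auto simp: solve_u_def)
  qed
  moreover have "solve_l A j k i0 ?v i = ?l i" for i
  proof (cases "i \<in> free_ix j k i0")
    case True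
    then show ?thesis using free[OF True] by (auto simp: solve_l_def free_ix_def)
  next
    case False
    then have "i = j \<or> i = k \<or> i = i0" by (auto simp: free_ix_def)
    moreover have "- ?T = ?l i0" if "i0 \<in> A" unfolding T using that by simp
    moreover have "- (?S\<^sup>2 / ?T) = ?l i0" if "i0 \<notin> A"
      unfolding S T using l[of i0] u0 that by (simp add: power2_eq_square)
    ultimately show ?thesis using index_ne spec lk by (auto simp: solve_l_def)
  qed
  ultimately have "chart_lift A j k i0 ?v = nf_pt A ?u ?l"
    unfolding chart_lift_def by presburger
  then show "chart_lift A j k i0 ?v \<in> KC_orbit y" using orb by simp
  have "?v \<in> coord_space (chart_ix j k i0)"
    unfolding coord_space_def
  proof (intro CollectI allI impI)
    fix m assume "m \<notin> chart_ix j k i0"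
    then show "?v $ m = 0" by (cases m) (auto simp: chart_ix_def free_ix_def chart_coord_def)
  qed
  then show "?v \<in> chart_open A j k i0 \<inter> coord_space (chart_ix j k i0)"
    using free l T0 S0 lk by (auto simp: chart_open_def)
qed

lemma card_chart_ix: "card (chart_ix j k i0) = 2 * (CARD('n) - 3)"
proof -
  have "card (free_ix j k i0) = CARD('n) - 3"
    unfolding free_ix_def Compl_eq_Diff_UNIV using index_ne by (subst card_Diff_subset) auto
  then show ?thesis
    unfolding chart_ix_def by (subst card_Un_disjoint) (auto simp: card_image inj_on_def)
qed

lemma cdiff_sums:
  fixes v :: "complex ^ ('n + 'n)"
  shows "cdiff_at (sum11 j k i0) v" "cdiff_at (sum12 A j k i0) v"
    "sum12 A j k i0 v \<noteq> 0 \<Longrightarrow> cdiff_at (solve_lk A j k i0) v"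
proof -
  have if_cd: "cdiff_at (\<lambda>v. if P then f v else g v) v"
    if "cdiff_at f v" "cdiff_at g v" for P and f g :: "complex ^ ('n + 'n) \<Rightarrow> complex"
    using that by (cases P) auto
  show 1: "cdiff_at (sum11 j k i0) v" unfolding sum11_def by (intro cdiff_at_intros)
  show 2: "cdiff_at (sum12 A j k i0) v" unfolding sum12_def by (intro cdiff_at_intros if_cd)
  show "cdiff_at (solve_lk A j k i0) v" if "sum12 A j k i0 v \<noteq> 0"
    unfolding solve_lk_def using that by (intro cdiff_at_intros if_cd 1 2)
qed

lemma open_chart_open: "open (chart_open A j k i0)"
proof -
  let ?D = "{v. sum12 A j k i0 v \<noteq> 0}"
  have c: "continuous_on UNIV (sum12 A j k i0)" "continuous_on UNIV (sum11 j k i0)"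
    using cdiff_sums by (auto intro!: continuous_at_imp_continuous_on cdiff_at_imp_isCont)
  have D: "open ?D"
    using open_Collect_neq[OF c(1) continuous_on_const[of UNIV 0]] by simp
  have "continuous_on ?D (solve_lk A j k i0)"
    using cdiff_sums(3) by (auto intro!: continuous_at_imp_continuous_on cdiff_at_imp_isCont)
  then have "open (?D \<inter> solve_lk A j k i0 -` (- {0}))"
    by (rule continuous_open_preimage[OF _ D]) auto
  moreover have "open {v. sum11 j k i0 v \<noteq> 0}"
    using open_Collect_neq[OF c(2) continuous_on_const[of UNIV 0]] by simp
  then have "open {v. i0 \<in> A \<or> sum11 j k i0 v \<noteq> 0}" by (cases "i0 \<in> A") auto
  moreover have "open {v :: complex ^ ('n + 'n). \<forall>i\<in>free_ix j k i0. v $ Inr i \<noteq> 0}"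
  proof -
    have "open {v :: complex ^ ('n + 'n). v $ Inr i \<noteq> 0}" for i
      by (intro open_Collect_neq continuous_intros)
    moreover have "{v :: complex ^ ('n + 'n). \<forall>i\<in>free_ix j k i0. v $ Inr i \<noteq> 0} = (\<Inter>i\<in>free_ix j k i0. {v. v $ Inr i \<noteq> 0})"
      by blast
    ultimately show ?thesis by (simp only:) (intro open_INT finite ballI)
  qed
  ultimately have "open (?D \<inter> solve_lk A j k i0 -` (- {0}) \<inter> {v. i0 \<in> A \<or> sum11 j k i0 v \<noteq> 0} \<inter>
      {v. \<forall>i\<in>free_ix j k i0. v $ Inr i \<noteq> 0})"
    by (blast intro: open_Int)
  also have "\<dots> = chart_open A j k i0" by (auto simp: chart_open_def)
  finally show ?thesis .
qed

lemma holomorphic_chart_lift: "holomorphic_open (chart_open A j k i0) (chart_lift A j k i0)"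
  unfolding holomorphic_open_iff
proof (intro conjI ballI open_chart_open)
  fix v assume v: "v \<in> chart_open A j k i0"
  have T: "sum12 A j k i0 v \<noteq> 0" and S: "i0 \<notin> A \<Longrightarrow> sum11 j k i0 v \<noteq> 0"
    using v by (auto simp: chart_open_def)
  have u: "cdiff_at (\<lambda>v. solve_u A j k i0 v i) v" for i
    unfolding solve_u_def using T S index_ne
    by (cases "i = j \<or> i = k"; cases "i = i0"; cases "i0 \<in> A") (auto intro!: cdiff_at_intros cdiff_sums)
  have l: "cdiff_at (\<lambda>v. solve_l A j k i0 v i) v" for i
    unfolding solve_l_def using T index_ne
    by (cases "i = j"; cases "i = k"; cases "i = i0"; cases "i0 \<in> A") (auto intro!: cdiff_at_intros cdiff_sums)
  have eq: "chart_lift A j k i0 = (\<lambda>v.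
     ((\<chi> i s. if s = 1 then - (solve_l A j k i0 v i * (if i \<in> A then solve_u A j k i0 v i else 1))
        else solve_l A j k i0 v i * (if i \<in> A then 1 else solve_u A j k i0 v i)),
      (\<chi> i s. if s = 1 then (if i \<in> A then 1 else solve_u A j k i0 v i)
        else (if i \<in> A then solve_u A j k i0 v i else 1))))"
    by (auto simp: chart_lift_def nf_pt_def fun_eq_iff vec_eq_iff forall_2)
  have if_cd: "cdiff_at (\<lambda>v. if P then f v else g v) v"
    if "cdiff_at f v" "cdiff_at g v" for P and f g :: "complex ^ ('n + 'n) \<Rightarrow> complex"
    using that by (cases P) auto
  show "cdiff_at (chart_lift A j k i0) v"
    unfolding eq by (intro cdiff_at_Pair cdiff_at_vec_lambda if_cd cdiff_at_uminus cdiff_at_mult cdiff_at_const u l)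
qed

lemma holomorphic_chart_coord:
  "\<exists>W. holomorphic_open W (chart_coord A j k i0) \<and> chart_dom A j k i0 = mu_complex_stable \<inter> W"
proof -
  let ?sp = "\<lambda>(y :: 'n pq) a b. scalar_product (fst y $ a) (snd y $ b)"
  let ?d = "\<lambda>(y :: 'n pq) a b. det2 (snd y $ a) (snd y $ b)"
  define W where "W = {y :: 'n pq. (\<forall>i. if i \<in> A then ?d y i k \<noteq> 0 else ?d y j i \<noteq> 0) \<and> ?sp y j k \<noteq> 0 \<and>
      (i0 \<in> A \<or> ?d y i0 k \<noteq> 0)}"
  have cd: "cdiff_at (\<lambda>y. ?sp y a b) y" "cdiff_at (\<lambda>y. ?d y a b) y" for a b y
    unfolding scalar_product_def det2_def by (intro cdiff_at_intros)+
  then have co: "continuous_on UNIV (\<lambda>y. ?sp y a b)" "continuous_on UNIV (\<lambda>y. ?d y a b)" for a b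
    by (auto intro!: continuous_at_imp_continuous_on cdiff_at_imp_isCont)
  have op: "open {y. ?sp y a b \<noteq> 0}" "open {y. ?d y a b \<noteq> 0}" for a b
    using open_Collect_neq[OF co(1) continuous_on_const[of UNIV 0]] open_Collect_neq[OF co(2) continuous_on_const[of UNIV 0]]
    by auto
  have "open {y. if i \<in> A then ?d y i k \<noteq> 0 else ?d y j i \<noteq> 0}" for i
    using op by (cases "i \<in> A") auto
  moreover have "open {y. i0 \<in> A \<or> ?d y i0 k \<noteq> 0}" using op by (cases "i0 \<in> A") auto
  moreover have "{y. \<forall>i. if i \<in> A then ?d y i k \<noteq> 0 else ?d y j i \<noteq> 0} =
      (\<Inter>i. {y. if i \<in> A then ?d y i k \<noteq> 0 else ?d y j i \<noteq> 0})" by blast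
  ultimately have "open {y. \<forall>i. if i \<in> A then ?d y i k \<noteq> 0 else ?d y j i \<noteq> 0}" "open {y. i0 \<in> A \<or> ?d y i0 k \<noteq> 0}"
    by (simp_all only:) (intro open_INT finite ballI)
  then have "open W"
    unfolding W_def by (intro open_Collect_conj op)
  moreover have "cdiff_at (chart_coord A j k i0) y" if y: "y \<in> W" for y
  proof -
    have nz: "?sp y j k \<noteq> 0" "\<And>i. i \<in> A \<Longrightarrow> ?d y i k \<noteq> 0" "\<And>i. i \<notin> A \<Longrightarrow> ?d y j i \<noteq> 0"
      using y unfolding W_def by (auto split: if_splits)
    have u: "cdiff_at (\<lambda>y. nf_u A j k y i) y" for i
      unfolding nf_u_def using nz by (cases "i \<in> A") (auto intro!: cdiff_at_divide cdiff_at_mult cd)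
    have l: "cdiff_at (\<lambda>y. nf_l A j k y i) y" for i
      unfolding nf_l_def using nz jk(1) by (cases "i \<in> A") (auto intro!: cdiff_at_divide cdiff_at_mult cdiff_at_uminus cd)
    show ?thesis
      unfolding chart_coord_def
    proof (rule cdiff_at_vec_lambda)
      fix m :: "'n + 'n"
      show "cdiff_at (\<lambda>y. case m of Inl i \<Rightarrow> if i \<in> {j, k, i0} then 0 else nf_u A j k y i
          | Inr i \<Rightarrow> if i \<in> {j, k, i0} then 0 else nf_l A j k y i) y"
      proof (cases m)
        case (Inl i)
        then show ?thesis using u by (cases "i \<in> {j, k, i0}") (auto simp: cdiff_at_const)
      next
        case (Inr i)
        then show ?thesis using l by (cases "i \<in> {j, k, i0}") (auto simp: cdiff_at_const)
      qed
    qed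
  qed
  moreover have "chart_dom A j k i0 = mu_complex_stable \<inter> W"
  proof -
    have "y \<in> chart_dom A j k i0 \<longleftrightarrow> y \<in> W" if st: "y \<in> mu_complex_stable" for y
    proof -
      have "?sp y j k \<noteq> 0" if "y \<in> nf_dom A j k" by (rule nf_dom_nz(2)[OF that jk(1)])
      moreover have "nf_u A j k y i0 \<noteq> 0 \<longleftrightarrow> ?d y i0 k \<noteq> 0" if "y \<in> nf_dom A j k" "i0 \<notin> A"
        using nf_dom_nz[OF that(1) jk(1)] that(2) by (simp add: nf_u_def)
      ultimately show ?thesis
        using st unfolding chart_dom_def W_def nf_dom_def by (smt (verit) mem_Collect_eq)
    qed
    moreover have "chart_dom A j k i0 \<subseteq> mu_complex_stable" by (auto simp: chart_dom_def nf_dom_def)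
    ultimately show ?thesis by blast
  qed
  ultimately show ?thesis unfolding holomorphic_open_iff by blast
qed

end

section \<open>The manifold of null hyperpolygons\<close>

lemma X0_chartD:
  assumes "(V, \<phi>) \<in> (X0_charts :: (('n::finite) pq set, 'n + 'n) chart set)"
  shows "openin X0_top V" "inj_on \<phi> V" "open_in_model (2 * (CARD('n) - 3)) (\<phi> ` V)"
    "holomorphic_map {x \<in> mu_complex_stable. X0_proj x \<in> V} (\<phi> \<circ> X0_proj)"
    "y \<in> \<phi> ` V \<Longrightarrow> \<exists>W \<sigma>. openin (top_of_set (\<phi> ` V)) W \<and> y \<in> W \<and>
        holomorphic_map W (\<sigma> :: complex ^ ('n + 'n) \<Rightarrow> 'n pq) \<and>
        (\<forall>w\<in>W. \<sigma> w \<in> mu_complex_stable \<and> X0_proj (\<sigma> w) \<in> V \<and> \<phi> (X0_proj (\<sigma> w)) = w)"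
  using assms by (auto simp: X0_charts_def)

text \<open>
  Continuity can be tested on the stable locus, because \<open>X0\<close> has the quotient topology.  The map is
  open because its inverse lifts locally to continuous maps into the stable locus.
\<close>

lemma X0_chart_homeomorphic:
  assumes ch: "(V, \<phi>) \<in> (X0_charts :: (('n::finite) pq set, 'n + 'n) chart set)"
  shows "homeomorphic_map (subtopology X0_top V) (top_of_set (\<phi> ` V)) \<phi>"
proof -
  note c = X0_chartD[OF ch]
  have V: "V \<subseteq> X0" using openin_subset[OF c(1)] by (simp add: topspace_X0_top)
  have top: "topspace (subtopology X0_top V) = V" using V by (auto simp: topspace_X0_top)
  let ?S = "{x \<in> mu_complex_stable. X0_proj x \<in> V}"
  have S: "openin (top_of_set mu_complex_stable) ?S" using c(1) by (simp add: openin_X0_top)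
  have cont: "continuous_on ?S (\<phi> \<circ> X0_proj)" by (rule holomorphic_map_imp_continuous_on[OF c(4)])
  have "continuous_map (subtopology X0_top V) (top_of_set (\<phi> ` V)) \<phi>"
    unfolding continuous_map_def top
  proof (intro conjI allI impI)
    show "\<phi> \<in> V \<rightarrow> topspace (top_of_set (\<phi> ` V))" by auto
    fix U assume U: "openin (top_of_set (\<phi> ` V)) U"
    have "openin (top_of_set ?S) (?S \<inter> (\<phi> \<circ> X0_proj) -` U)"
      by (rule continuous_openin_preimage[OF cont _ U]) auto
    then have "openin (top_of_set mu_complex_stable) (?S \<inter> (\<phi> \<circ> X0_proj) -` U)"
      using S openin_trans by blast
    moreover have "?S \<inter> (\<phi> \<circ> X0_proj) -` U = {y \<in> mu_complex_stable. X0_proj y \<in> {x \<in> V. \<phi> x \<in> U}}"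
      by auto
    ultimately have "openin X0_top {x \<in> V. \<phi> x \<in> U}"
      unfolding openin_X0_top using V by auto
    then show "openin (subtopology X0_top V) {x \<in> V. \<phi> x \<in> U}"
      using c(1) by (auto simp: openin_open_subtopology)
  qed
  moreover have "open_map (subtopology X0_top V) (top_of_set (\<phi> ` V)) \<phi>"
    unfolding open_map_def
  proof (intro allI impI)
    fix U assume "openin (subtopology X0_top V) U"
    then have U: "openin X0_top U" "U \<subseteq> V" using c(1) by (auto simp: openin_open_subtopology)
    show "openin (top_of_set (\<phi> ` V)) (\<phi> ` U)"
    proof (subst openin_subopen, intro ballI)
      fix y assume y: "y \<in> \<phi> ` U"
      then have "y \<in> \<phi> ` V" using U by blast
      from c(5)[OF this] obtain W \<sigma> where W: "openin (top_of_set (\<phi> ` V)) W" "y \<in> W"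
        "holomorphic_map W (\<sigma> :: complex ^ ('n + 'n) \<Rightarrow> 'n pq)"
        "\<And>w. w \<in> W \<Longrightarrow> \<sigma> w \<in> mu_complex_stable" "\<And>w. w \<in> W \<Longrightarrow> X0_proj (\<sigma> w) \<in> V"
        "\<And>w. w \<in> W \<Longrightarrow> \<phi> (X0_proj (\<sigma> w)) = w" by blast
      let ?T = "W \<inter> \<sigma> -` {x \<in> mu_complex_stable. X0_proj x \<in> U}"
      have "openin (top_of_set W) ?T"
      proof (rule continuous_openin_preimage[OF holomorphic_map_imp_continuous_on[OF W(3)]])
        show "\<sigma> \<in> W \<rightarrow> mu_complex_stable" using W(4) by blast
        show "openin (top_of_set mu_complex_stable) {x \<in> mu_complex_stable. X0_proj x \<in> U}"
          using U(1) by (simp add: openin_X0_top)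
      qed
      then have "openin (top_of_set (\<phi> ` V)) ?T" using W(1) openin_trans by blast
      moreover have "y \<in> ?T"
      proof -
        obtain u where u: "u \<in> U" "y = \<phi> u" using y by blast
        have "X0_proj (\<sigma> y) = u"
          using inj_onD[OF c(2), of "X0_proj (\<sigma> y)" u] W(5,6)[OF W(2)] u U(2) by auto
        then show ?thesis using W(2,4) u by auto
      qed
      moreover have "?T \<subseteq> \<phi> ` U"
      proof
        fix w assume "w \<in> ?T"
        then have "X0_proj (\<sigma> w) \<in> U" "\<phi> (X0_proj (\<sigma> w)) = w" using W(6) by auto
        then show "w \<in> \<phi> ` U" by force
      qed
      ultimately show "\<exists>T. openin (top_of_set (\<phi> ` V)) T \<and> y \<in> T \<and> T \<subseteq> \<phi> ` U" by blast
    qed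
  qed
  ultimately show ?thesis
    using c(2) by (intro bijective_open_imp_homeomorphic_map) (simp_all add: top del: topspace_subtopology)
qed

text \<open>
  Locally the transition is a lift \<open>\<sigma>\<close> followed by the holomorphic map \<open>\<psi> \<circ> X0_proj\<close>.
\<close>

lemma X0_chart_transition:
  assumes U: "(U, \<phi>) \<in> (X0_charts :: (('n::finite) pq set, 'n + 'n) chart set)"
    and V: "(V, \<psi>) \<in> (X0_charts :: (('n::finite) pq set, 'n + 'n) chart set)"
  shows "holomorphic_map (\<phi> ` (U \<inter> V)) (\<psi> \<circ> inv_into U \<phi>)"
proof (rule holomorphic_map_locally)
  note c = X0_chartD[OF U] and d = X0_chartD[OF V]
  fix y assume y: "y \<in> \<phi> ` (U \<inter> V)"
  then have "y \<in> \<phi> ` U" by blast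
  from c(5)[OF this] obtain W \<sigma> where W: "openin (top_of_set (\<phi> ` U)) W" "y \<in> W"
    "holomorphic_map W (\<sigma> :: complex ^ ('n + 'n) \<Rightarrow> 'n pq)"
    "\<And>w. w \<in> W \<Longrightarrow> \<sigma> w \<in> mu_complex_stable" "\<And>w. w \<in> W \<Longrightarrow> X0_proj (\<sigma> w) \<in> U"
    "\<And>w. w \<in> W \<Longrightarrow> \<phi> (X0_proj (\<sigma> w)) = w" by blast
  have inv: "inv_into U \<phi> w = X0_proj (\<sigma> w)" if "w \<in> W" for w
    using inv_into_f_f[OF c(2) W(5)[OF that]] W(6)[OF that] by simp
  let ?W = "\<phi> ` (U \<inter> V) \<inter> W"
  have in_V: "X0_proj (\<sigma> w) \<in> V" if w: "w \<in> ?W" for w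
  proof -
    have "w \<in> W" using w by blast
    obtain u where u: "u \<in> U" "u \<in> V" "w = \<phi> u" using w by blast
    have "inv_into U \<phi> w = u" using inv_into_f_f[OF c(2) u(1)] u(3) by simp
    then show ?thesis using inv[OF \<open>w \<in> W\<close>] u(2) by simp
  qed
  have "holomorphic_map ?W ((\<psi> \<circ> X0_proj) \<circ> \<sigma>)"
  proof (rule holomorphic_map_compose[OF _ d(4)])
    show "holomorphic_map ?W \<sigma>" using W(3) by (rule holomorphic_map_subset) blast
    show "\<sigma> ` ?W \<subseteq> {x \<in> mu_complex_stable. X0_proj x \<in> V}" using W(4) in_V by auto
  qed
  then have "holomorphic_map ?W (\<psi> \<circ> inv_into U \<phi>)"
    by (rule holomorphic_map_cong) (auto simp: inv)
  moreover have "openin (top_of_set (\<phi> ` (U \<inter> V))) ?W"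
  proof -
    obtain O' where "open O'" "W = \<phi> ` U \<inter> O'" using W(1) unfolding openin_open by blast
    then have "?W = \<phi> ` (U \<inter> V) \<inter> O'" by blast
    then show ?thesis using \<open>open O'\<close> by (simp add: openin_open_Int)
  qed
  ultimately show "\<exists>W. y \<in> W \<and> openin (top_of_set (\<phi> ` (U \<inter> V))) W \<and> holomorphic_map W (\<psi> \<circ> inv_into U \<phi>)"
    using y W(2) by (intro exI[of _ ?W]) simp
qed


section \<open>The correspondence\<close>

text \<open>
  On the stable locus the chart is given by the rational functions \<open>chart_coord\<close>, and \<open>chart_lift\<close> is
  a global lift of its inverse.
\<close>

lemma pulled_back_chart:
  fixes x :: "'n::finite \<Rightarrow> cp1"
  assumes x: "inj x" and jk: "j \<in> A" "k \<notin> A" and i0: "i0 \<notin> {j, k}"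
    and I: "\<And>y. y \<in> mu_complex_stable \<Longrightarrow> \<I> (X0_proj y) = higgs_class x y"
  shows "({z \<in> X0. \<I> z \<in> H0_chart_dom x A j k i0}, H0_chart_map x A j k i0 \<circ> \<I>) \<in> X0_charts"
proof -
  let ?V = "{z \<in> X0. \<I> z \<in> H0_chart_dom x A j k i0}"
  let ?\<phi> = "H0_chart_map x A j k i0 \<circ> \<I>"
  let ?co = "chart_coord A j k i0"
  have st: "y \<in> mu_complex_stable" if "y \<in> chart_dom A j k i0" for y
    using that by (auto simp: chart_dom_def nf_dom_def)
  have in_V: "X0_proj y \<in> ?V \<longleftrightarrow> y \<in> chart_dom A j k i0" if "y \<in> mu_complex_stable" for y
    using that H0_chart_dom_iff[OF x jk that] X0_eq_image by (auto simp: I)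
  then have pre: "{y \<in> mu_complex_stable. X0_proj y \<in> ?V} = chart_dom A j k i0"
    using st by blast
  have \<phi>: "?\<phi> (X0_proj y) = ?co y" if "y \<in> chart_dom A j k i0" for y
    using H0_chart_map_eq[OF x jk that] I[OF st[OF that]] by simp
  have V: "?V = X0_proj ` chart_dom A j k i0"
  proof
    show "?V \<subseteq> X0_proj ` chart_dom A j k i0"
    proof
      fix z assume z: "z \<in> ?V"
      then obtain y where "y \<in> mu_complex_stable" "z = X0_proj y" using X0_eq_image by blast
      then show "z \<in> X0_proj ` chart_dom A j k i0" using in_V z by blast
    qed
    show "X0_proj ` chart_dom A j k i0 \<subseteq> ?V" using in_V st by blast
  qed
  obtain W where W: "holomorphic_open W ?co" "chart_dom A j k i0 = mu_complex_stable \<inter> W"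
    using holomorphic_chart_coord[OF jk i0] by blast
  have img: "?\<phi> ` ?V = chart_open A j k i0 \<inter> coord_space (chart_ix j k i0)"
  proof
    show "?\<phi> ` ?V \<subseteq> chart_open A j k i0 \<inter> coord_space (chart_ix j k i0)"
      unfolding V image_image using \<phi> chart_coord_in(1)[OF jk i0] by (metis (no_types, lifting) image_subsetI)
    show "chart_open A j k i0 \<inter> coord_space (chart_ix j k i0) \<subseteq> ?\<phi> ` ?V"
    proof
      fix v assume v: "v \<in> chart_open A j k i0 \<inter> coord_space (chart_ix j k i0)"
      then have "chart_lift A j k i0 v \<in> chart_dom A j k i0" "?co (chart_lift A j k i0 v) = v"
        using chart_lift_in[OF jk i0] by blast+
      then have "v = ?\<phi> (X0_proj (chart_lift A j k i0 v))" "X0_proj (chart_lift A j k i0 v) \<in> ?V"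
        using \<phi> V by auto
      then show "v \<in> ?\<phi> ` ?V" by blast
    qed
  qed
  have "openin X0_top ?V"
    unfolding openin_X0_top pre W(2) using W(1) by (auto simp: holomorphic_open_iff openin_open_Int)
  moreover have "inj_on ?\<phi> ?V"
    unfolding V
  proof (rule inj_onI, elim imageE)
    fix z z' y y' assume h: "?\<phi> z = ?\<phi> z'" "z = X0_proj y" "y \<in> chart_dom A j k i0"
      "z' = X0_proj y'" "y' \<in> chart_dom A j k i0"
    then have "?co y = ?co y'" using \<phi> by metis
    then have "chart_lift A j k i0 (?co y) \<in> KC_orbit y" "chart_lift A j k i0 (?co y) \<in> KC_orbit y'"
      using chart_coord_in(2)[OF jk i0] h(3,5) by metis+
    then have "y' \<in> KC_orbit y" using KC_orbit_sym KC_orbit_trans by blast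
    then show "z = z'" using X0_proj_eq_iff[OF st[OF h(3)] st[OF h(5)]] h by simp
  qed
  moreover have "open_in_model (2 * (CARD('n) - 3)) (?\<phi> ` ?V)"
    unfolding open_in_model_def img
    using card_chart_ix[OF jk i0] open_chart_open[OF jk i0]
    by (intro exI[of _ "chart_ix j k i0"]) (auto simp: openin_open)
  moreover have "holomorphic_map {y \<in> mu_complex_stable. X0_proj y \<in> ?V} (?\<phi> \<circ> X0_proj)"
    unfolding pre
  proof (rule holomorphic_open_imp_map[OF W(1)])
    show "chart_dom A j k i0 \<subseteq> W" using W(2) by blast
    show "?co y = (?\<phi> \<circ> X0_proj) y" if "y \<in> chart_dom A j k i0" for y using \<phi>[OF that] by simp
  qed
  moreover have "\<exists>W \<sigma>. openin (top_of_set (?\<phi> ` ?V)) W \<and> v \<in> W \<and>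
        holomorphic_map W (\<sigma> :: complex ^ ('n + 'n) \<Rightarrow> 'n pq) \<and>
        (\<forall>w\<in>W. \<sigma> w \<in> mu_complex_stable \<and> X0_proj (\<sigma> w) \<in> ?V \<and> ?\<phi> (X0_proj (\<sigma> w)) = w)"
    if v: "v \<in> ?\<phi> ` ?V" for v
  proof (intro exI conjI ballI)
    show "openin (top_of_set (?\<phi> ` ?V)) (?\<phi> ` ?V)" by simp
    show "v \<in> ?\<phi> ` ?V" by fact
    show "holomorphic_map (?\<phi> ` ?V) (chart_lift A j k i0)"
      unfolding img by (rule holomorphic_open_imp_map[OF holomorphic_chart_lift[OF jk i0]]) auto
    fix w assume "w \<in> ?\<phi> ` ?V"
    then have w: "w \<in> chart_open A j k i0" "w \<in> coord_space (chart_ix j k i0)" unfolding img by auto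
    note lift = chart_lift_in(1)[OF jk i0 w(1)] chart_lift_in(2)[OF jk i0 w]
    show "chart_lift A j k i0 w \<in> mu_complex_stable" by (rule st[OF lift(1)])
    show "X0_proj (chart_lift A j k i0 w) \<in> ?V" unfolding V by (rule imageI[OF lift(1)])
    show "?\<phi> (X0_proj (chart_lift A j k i0 w)) = w" using \<phi>[OF lift(1)] lift(2) by simp
  qed
  ultimately show ?thesis unfolding X0_charts_def by blast
qed

lemma ex_correspondence:
  fixes x :: "'n::finite \<Rightarrow> cp1"
  assumes x: "inj x"
  obtains \<I> where "\<And>y. y \<in> mu_complex_stable \<Longrightarrow> \<I> (X0_proj y) = higgs_class x y"
    "bij_betw \<I> X0 (H0 (range x))"
proof -
  define \<I> where "\<I> = (\<lambda>z. higgs_class x (SOME y. y \<in> mu_complex_stable \<and> X0_proj y = z))"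
  have I: "\<I> (X0_proj y) = higgs_class x y" if y: "y \<in> mu_complex_stable" for y
  proof -
    have "\<exists>y'. y' \<in> mu_complex_stable \<and> X0_proj y' = X0_proj y" using y by blast
    from someI_ex[OF this] show ?thesis
      unfolding \<I>_def using X0_proj_eq_iff[OF _ y] higgs_class_eq_iff[OF x _ y] by blast
  qed
  have "bij_betw \<I> X0 (H0 (range x))"
    unfolding bij_betw_def
  proof
    show "inj_on \<I> X0"
    proof (rule inj_onI)
      fix z z' :: "'n pq set" assume z: "z \<in> X0" "z' \<in> X0" and eq: "\<I> z = \<I> z'"
      obtain y y' where y: "y \<in> mu_complex_stable" "y' \<in> mu_complex_stable" "z = X0_proj y" "z' = X0_proj y'"
        using z unfolding X0_eq_image by blast
      then have "higgs_class x y = higgs_class x y'" using eq I by simp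
      then show "z = z'" using higgs_class_eq_iff[OF x y(1,2)] X0_proj_eq_iff[OF y(1,2)] y by simp
    qed
    show "\<I> ` X0 = H0 (range x)"
      unfolding X0_eq_image H0_eq_image[OF x] image_image using I by (intro image_cong) auto
  qed
  with I show thesis by (rule that)
qed

lemma complex_atlas_X0:
  fixes x :: "'n::finite \<Rightarrow> cp1"
  assumes x: "inj x"
  shows "complex_atlas (2 * (CARD('n) - 3)) X0_top (X0_charts :: ('n pq set, 'n + 'n) chart set)"
  unfolding complex_atlas_def
proof (intro conjI)
  obtain \<I> where I: "\<And>y. y \<in> mu_complex_stable \<Longrightarrow> \<I> (X0_proj y) = higgs_class x y"
    and "bij_betw \<I> (X0 :: 'n pq set set) (H0 (range x))"
    by (rule ex_correspondence[OF x]) (rule that)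
  show "(\<Union>(U, \<phi>)\<in>(X0_charts :: ('n pq set, 'n + 'n) chart set). U) = topspace X0_top"
  proof
    show "(\<Union>(U, \<phi>)\<in>(X0_charts :: ('n pq set, 'n + 'n) chart set). U) \<subseteq> topspace X0_top"
    proof (rule UN_least, clarify)
      fix V \<phi> and z :: "'n pq set"
      assume "(V, \<phi>) \<in> (X0_charts :: ('n pq set, 'n + 'n) chart set)" "z \<in> V"
      then show "z \<in> topspace X0_top" using openin_subset[OF X0_chartD(1)] by blast
    qed
    show "topspace X0_top \<subseteq> (\<Union>(U, \<phi>)\<in>(X0_charts :: ('n pq set, 'n + 'n) chart set). U)"
    proof
      fix z :: "'n pq set" assume z: "z \<in> topspace X0_top"
      then obtain y where y: "y \<in> mu_complex_stable" "z = X0_proj y"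
        unfolding topspace_X0_top X0_eq_image by blast
      obtain A j k i0 where ch: "j \<in> A" "k \<notin> A" "i0 \<notin> {j, k}" "y \<in> chart_dom A j k i0"
        using ex_chart_dom[OF y(1)] by blast
      have "z \<in> {z \<in> X0. \<I> z \<in> H0_chart_dom x A j k i0}"
        using z y ch H0_chart_dom_iff[OF x ch(1,2) y(1)] by (simp add: I topspace_X0_top)
      then show "z \<in> (\<Union>(U, \<phi>)\<in>(X0_charts :: ('n pq set, 'n + 'n) chart set). U)"
        using pulled_back_chart[OF x ch(1-3) I] by (intro UN_I) auto
    qed
  qed
  show "\<forall>(U, \<phi>)\<in>(X0_charts :: ('n pq set, 'n + 'n) chart set). openin X0_top U \<and>
      open_in_model (2 * (CARD('n) - 3)) (\<phi> ` U) \<and> homeomorphic_map (subtopology X0_top U) (top_of_set (\<phi> ` U)) \<phi>"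
    by (clarify, intro conjI X0_chartD(1,3) X0_chart_homeomorphic)
  show "\<forall>(U, \<phi>)\<in>(X0_charts :: ('n pq set, 'n + 'n) chart set). \<forall>(V, \<psi>)\<in>X0_charts.
      holomorphic_map (\<phi> ` (U \<inter> V)) (\<psi> \<circ> inv_into U \<phi>)"
    by (clarify, rule X0_chart_transition)
qed


section \<open>Transport of a complex structure along a bijection\<close>

text \<open>
  The topology generated by the charts in \<open>\<B>\<close> is the image of the topology of \<open>M\<close>: the pulled back
  charts are open embeddings, and they cover \<open>M\<close>.  Everything else is then carried over by \<open>f\<close>.
\<close>

lemma transported_manifold:
  fixes \<A> :: "('x, 'm::finite) chart set" and \<B> :: "('y, 'm) chart set"
  assumes man: "complex_manifold d M T \<A>"
    and bij: "bij_betw f M M'"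
    and pull: "\<And>V \<psi>. (V, \<psi>) \<in> \<B> \<Longrightarrow> V \<subseteq> M' \<and> ({z \<in> M. f z \<in> V}, \<psi> \<circ> f) \<in> \<A>"
    and cover: "\<And>z. z \<in> M \<Longrightarrow> \<exists>V \<psi>. (V, \<psi>) \<in> \<B> \<and> f z \<in> V"
  defines "T' \<equiv> topology_generated_by {{c \<in> V. \<psi> c \<in> W} | V \<psi> W. (V, \<psi>) \<in> \<B> \<and> open W}"
  shows "complex_manifold d M' T' \<B>" "biholomorphism T \<A> T' \<B> f"
proof -
  have T: "topspace T = M" "Hausdorff_space T" "second_countable T" and atlas: "complex_atlas d T \<A>"
    using man by (auto simp: complex_manifold_def)
  have ch: "openin T U" "open_in_model d (\<phi> ` U)" "homeomorphic_map (subtopology T U) (top_of_set (\<phi> ` U)) \<phi>"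
    if "(U, \<phi>) \<in> \<A>" for U \<phi>
    using atlas that by (auto simp: complex_atlas_def)
  have trans: "holomorphic_map (\<phi> ` (U \<inter> V)) (\<psi> \<circ> inv_into U \<phi>)" if "(U, \<phi>) \<in> \<A>" "(V, \<psi>) \<in> \<A>" for U \<phi> V \<psi>
    using atlas that unfolding complex_atlas_def by blast
  have inj: "inj_on f M" and surj: "f ` M = M'" using bij by (auto simp: bij_betw_def)
  let ?pre = "\<lambda>V. {z \<in> M. f z \<in> V}"
  have pre_img: "f ` ?pre V = V" if "V \<subseteq> M'" for V
    using that surj by auto
  let ?G = "{{c \<in> V. \<psi> c \<in> W} | V \<psi> W. (V, \<psi>) \<in> \<B> \<and> open W}"
  have gen_sub: "\<Union>?G = M'"
  proof
    show "\<Union>?G \<subseteq> M'" using pull by blast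
    show "M' \<subseteq> \<Union>?G"
    proof
      fix c assume "c \<in> M'"
      then obtain z where "z \<in> M" "c = f z" using surj by blast
      then obtain V \<psi> where "(V, \<psi>) \<in> \<B>" "c \<in> V" using cover by blast
      then have "{c \<in> V. \<psi> c \<in> UNIV} \<in> ?G" "c \<in> {c \<in> V. \<psi> c \<in> UNIV}" by auto
      then show "c \<in> \<Union>?G" by blast
    qed
  qed
  then have top': "topspace T' = M'" unfolding T'_def by (simp only: topology_generated_by_topspace)
  have cont: "continuous_map T T' f"
    unfolding T'_def
  proof (rule continuous_on_generated_topo)
    show "f ` topspace T \<subseteq> \<Union>?G" unfolding gen_sub T(1) surj by simp
    fix B assume "B \<in> ?G"
    then obtain V \<psi> W where B: "B = {c \<in> V. \<psi> c \<in> W}" "(V, \<psi>) \<in> \<B>" "open W" by blast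
    note p = pull[OF B(2)]
    note c = ch[OF conjunct2[OF p]]
    have "continuous_map (subtopology T (?pre V)) (top_of_set ((\<psi> \<circ> f) ` ?pre V)) (\<psi> \<circ> f)"
      using c(3) by (rule homeomorphic_imp_continuous_map)
    moreover have "openin (top_of_set ((\<psi> \<circ> f) ` ?pre V)) ((\<psi> \<circ> f) ` ?pre V \<inter> W)"
      using B(3) by (simp add: openin_open_Int)
    ultimately have "openin (subtopology T (?pre V))
        {z \<in> topspace (subtopology T (?pre V)). (\<psi> \<circ> f) z \<in> (\<psi> \<circ> f) ` ?pre V \<inter> W}"
      by (rule openin_continuous_map_preimage)
    moreover have "{z \<in> topspace (subtopology T (?pre V)). (\<psi> \<circ> f) z \<in> (\<psi> \<circ> f) ` ?pre V \<inter> W}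
        = f -` B \<inter> topspace T"
      unfolding B(1) topspace_subtopology T(1) by auto
    ultimately show "openin T (f -` B \<inter> topspace T)"
      using openin_trans_full[of T] c(1) by simp
  qed
  have open_f: "open_map T T' f"
    unfolding open_map_def
  proof (intro allI impI)
    fix U assume U: "openin T U"
    show "openin T' (f ` U)"
    proof (subst openin_subopen, intro ballI)
      fix c assume "c \<in> f ` U"
      then obtain z where z: "z \<in> U" "c = f z" by blast
      have zM: "z \<in> M" using z U T(1) openin_subset by blast
      obtain V \<psi> where V: "(V, \<psi>) \<in> \<B>" "f z \<in> V" using cover[OF zM] by blast
      note p = pull[OF V(1)]
      note h = ch[OF conjunct2[OF p]]
      have "openin (subtopology T (?pre V)) (U \<inter> ?pre V)"
        using U by (simp add: openin_subtopology_Int)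
      then have "openin (top_of_set ((\<psi> \<circ> f) ` ?pre V)) ((\<psi> \<circ> f) ` (U \<inter> ?pre V))"
        using homeomorphic_imp_open_map[OF h(3)] by (simp add: open_map_def)
      then obtain W where W: "open W" "(\<psi> \<circ> f) ` (U \<inter> ?pre V) = (\<psi> \<circ> f) ` ?pre V \<inter> W"
        unfolding openin_open by blast
      have inj': "inj_on (\<psi> \<circ> f) (?pre V)"
        using homeomorphic_imp_injective_map[OF h(3)] h(1) openin_subset by (metis topspace_subtopology_subset)
      have sub: "{c \<in> V. \<psi> c \<in> W} \<subseteq> f ` U"
      proof
        fix c assume c: "c \<in> {c \<in> V. \<psi> c \<in> W}"
        then obtain w where w: "w \<in> ?pre V" "c = f w" using pre_img p by blast
        then have "(\<psi> \<circ> f) w \<in> (\<psi> \<circ> f) ` (U \<inter> ?pre V)" unfolding W(2) using c by auto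
        then obtain w' where "w' \<in> U" "w' \<in> ?pre V" "(\<psi> \<circ> f) w = (\<psi> \<circ> f) w'" by blast
        then have "w = w'" using inj_onD[OF inj'] w by blast
        then show "c \<in> f ` U" using w \<open>w' \<in> U\<close> by blast
      qed
      have "(\<psi> \<circ> f) z \<in> W" using W(2) z(1) V(2) zM by blast
      then have "c \<in> {c \<in> V. \<psi> c \<in> W}" using V(2) z(2) by simp
      moreover have "openin T' {c \<in> V. \<psi> c \<in> W}"
        unfolding T'_def using V(1) W(1) by (intro topology_generated_by_Basis) blast
      ultimately show "\<exists>B. openin T' B \<and> c \<in> B \<and> B \<subseteq> f ` U" using sub by blast
    qed
  qed
  have homeo: "homeomorphic_map T T' f"
    using cont open_f inj surj by (intro bijective_open_imp_homeomorphic_map) (auto simp: T(1) top')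
  then have hs: "T homeomorphic_space T'" using homeomorphic_space by blast
  have inv: "inv_into V \<psi> w = f (inv_into (?pre V) (\<psi> \<circ> f) w)"
    if B: "(V, \<psi>) \<in> \<B>" and w: "w \<in> \<psi> ` V" for V \<psi> w
  proof -
    note p = pull[OF B]
    note h = ch[OF conjunct2[OF p]]
    have inj': "inj_on (\<psi> \<circ> f) (?pre V)"
      using homeomorphic_imp_injective_map[OF h(3)] h(1) openin_subset by (metis topspace_subtopology_subset)
    then have inj_\<psi>: "inj_on \<psi> V"
      using inj_on_imageI[of \<psi> f "?pre V"] pre_img[of V] p by simp
    have "w \<in> \<psi> ` f ` ?pre V" using w pre_img[of V] p by simp
    then obtain z where z: "z \<in> ?pre V" "w = (\<psi> \<circ> f) z" by auto
    have "inv_into (?pre V) (\<psi> \<circ> f) w = z" using inv_into_f_f[OF inj' z(1)] z(2) by simp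
    moreover have "inv_into V \<psi> w = f z" using inv_into_f_f[OF inj_\<psi>, of "f z"] z by simp
    ultimately show ?thesis by simp
  qed
  have img: "(\<psi> \<circ> f) ` ?pre V = \<psi> ` V" if "(V, \<psi>) \<in> \<B>" for V \<psi>
    unfolding image_comp[symmetric] using pre_img[of V] pull[OF that] by simp
  have invf: "inv_into M f (f z) = z" if "z \<in> M" for z using inj that by (rule inv_into_f_f)
  show "complex_manifold d M' T' \<B>"
    unfolding complex_manifold_def complex_atlas_def
  proof (intro conjI)
    show "topspace T' = M'" by (rule top')
    show "Hausdorff_space T'" using homeomorphic_Hausdorff_space[OF hs] T(2) by blast
    show "second_countable T'" using homeomorphic_space_second_countability[OF hs] T(3) by blast
    show "(\<Union>(U, \<phi>)\<in>\<B>. U) = topspace T'"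
    proof
      show "(\<Union>(U, \<phi>)\<in>\<B>. U) \<subseteq> topspace T'" using pull top' by blast
      show "topspace T' \<subseteq> (\<Union>(U, \<phi>)\<in>\<B>. U)" unfolding top' using cover surj by blast
    qed
    show "\<forall>(U, \<phi>)\<in>\<B>. openin T' U \<and> open_in_model d (\<phi> ` U) \<and>
        homeomorphic_map (subtopology T' U) (top_of_set (\<phi> ` U)) \<phi>"
    proof (clarify, intro conjI)
      fix V \<psi> assume B: "(V, \<psi>) \<in> \<B>"
      note p = pull[OF B]
      note h = ch[OF conjunct2[OF p]]
      have "openin T' {c \<in> V. \<psi> c \<in> UNIV}"
        unfolding T'_def using B by (intro topology_generated_by_Basis) blast
      then show "openin T' V" by simp
      show "open_in_model d (\<psi> ` V)" using h(2) unfolding img[OF B] .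
      have f_V: "homeomorphic_map (subtopology T (?pre V)) (subtopology T' V) f"
        using homeomorphic_map_subtopologies[OF homeo, of "?pre V" V] pre_img p T(1) top' surj
        by (metis (no_types, lifting) inf.absorb_iff2 h(1) openin_subset)
      have \<psi>_f: "homeomorphic_map (subtopology T (?pre V)) (top_of_set (\<psi> ` V)) (\<psi> \<circ> f)"
        using h(3) unfolding img[OF B] .
      obtain g where g: "homeomorphic_maps (subtopology T (?pre V)) (subtopology T' V) f g"
        using f_V unfolding homeomorphic_map_maps by (elim exE)
      have "homeomorphic_map (subtopology T' V) (subtopology T (?pre V)) g"
        unfolding homeomorphic_map_maps by (rule exI[of _ f]) (rule iffD1[OF homeomorphic_maps_sym g])
      then have "homeomorphic_map (subtopology T' V) (top_of_set (\<psi> ` V)) ((\<psi> \<circ> f) \<circ> g)"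
        using \<psi>_f by (rule homeomorphic_map_compose)
      then show "homeomorphic_map (subtopology T' V) (top_of_set (\<psi> ` V)) \<psi>"
        by (rule homeomorphic_map_eq) (use g in \<open>simp add: homeomorphic_maps_def\<close>)
    qed
    show "\<forall>(U, \<phi>)\<in>\<B>. \<forall>(V, \<psi>)\<in>\<B>. holomorphic_map (\<phi> ` (U \<inter> V)) (\<psi> \<circ> inv_into U \<phi>)"
    proof clarify
      fix U \<phi> V \<psi> assume B: "(U, \<phi>) \<in> \<B>" "(V, \<psi>) \<in> \<B>"
      have "holomorphic_map ((\<phi> \<circ> f) ` (?pre U \<inter> ?pre V)) ((\<psi> \<circ> f) \<circ> inv_into (?pre U) (\<phi> \<circ> f))"
        using trans pull B by blast
      moreover have "(\<phi> \<circ> f) ` (?pre U \<inter> ?pre V) = \<phi> ` (U \<inter> V)"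
      proof -
        have "f ` (?pre U \<inter> ?pre V) = U \<inter> V" using pull[OF B(1)] surj by auto
        then show ?thesis by (simp only: flip: image_comp)
      qed
      ultimately have "holomorphic_map (\<phi> ` (U \<inter> V)) ((\<psi> \<circ> f) \<circ> inv_into (?pre U) (\<phi> \<circ> f))" by simp
      then show "holomorphic_map (\<phi> ` (U \<inter> V)) (\<psi> \<circ> inv_into U \<phi>)"
        by (rule holomorphic_map_cong) (auto simp: inv[OF B(1)])
    qed
  qed
  show "biholomorphism T \<A> T' \<B> f"
    unfolding biholomorphism_def holomorphic_between_def T(1)
  proof (intro conjI homeo; clarify)
    fix U \<phi> V \<psi> assume A: "(U, \<phi>) \<in> \<A>" and B: "(V, \<psi>) \<in> \<B>"
    have U: "U \<subseteq> M" using ch(1)[OF A] openin_subset T(1) by blast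
    then have eq: "{z \<in> U. f z \<in> V} = U \<inter> ?pre V" by blast
    have "holomorphic_map (\<phi> ` (U \<inter> ?pre V)) ((\<psi> \<circ> f) \<circ> inv_into U \<phi>)"
      using trans[OF A] pull[OF B] by blast
    then show "holomorphic_map (\<phi> ` {z \<in> U. f z \<in> V}) (\<psi> \<circ> f \<circ> inv_into U \<phi>)"
      unfolding eq .
  next
    fix V \<psi> U \<phi> assume B: "(V, \<psi>) \<in> \<B>" and A: "(U, \<phi>) \<in> \<A>"
    have U: "U \<subseteq> M" using ch(1)[OF A] openin_subset T(1) by blast
    have hol: "holomorphic_map ((\<psi> \<circ> f) ` (?pre V \<inter> U)) (\<phi> \<circ> inv_into (?pre V) (\<psi> \<circ> f))"
      using trans[OF _ A] pull[OF B] by blast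
    have eq: "{c \<in> V. inv_into M f c \<in> U} = f ` (?pre V \<inter> U)"
    proof
      show "{c \<in> V. inv_into M f c \<in> U} \<subseteq> f ` (?pre V \<inter> U)"
      proof
        fix c assume c: "c \<in> {c \<in> V. inv_into M f c \<in> U}"
        then obtain z where z: "z \<in> ?pre V" "c = f z" using pre_img pull[OF B] by blast
        then have "z \<in> U" using c invf by auto
        then show "c \<in> f ` (?pre V \<inter> U)" using z by blast
      qed
      show "f ` (?pre V \<inter> U) \<subseteq> {c \<in> V. inv_into M f c \<in> U}" using invf by auto
    qed
    have "holomorphic_map (\<psi> ` {c \<in> V. inv_into M f c \<in> U}) (\<phi> \<circ> inv_into (?pre V) (\<psi> \<circ> f))"
      using hol unfolding eq by (simp add: image_comp)
    then show "holomorphic_map (\<psi> ` {c \<in> V. inv_into M f c \<in> U}) (\<phi> \<circ> inv_into M f \<circ> inv_into V \<psi>)"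
    proof (rule holomorphic_map_cong)
      fix w assume w: "w \<in> \<psi> ` {c \<in> V. inv_into M f c \<in> U}"
      then have wV: "w \<in> \<psi> ` V" by blast
      then have "inv_into (?pre V) (\<psi> \<circ> f) w \<in> ?pre V"
        unfolding img[OF B, symmetric] by (rule inv_into_into)
      then have "inv_into M f (f (inv_into (?pre V) (\<psi> \<circ> f) w)) = inv_into (?pre V) (\<psi> \<circ> f) w"
        by (intro invf) blast
      then show "(\<phi> \<circ> inv_into (?pre V) (\<psi> \<circ> f)) w = (\<phi> \<circ> inv_into M f \<circ> inv_into V \<psi>) w"
        using inv[OF B wV] by simp
    qed
  qed
qed

section \<open>The isomorphism\<close>

theorem theorem3p10:
  fixes x :: "'n::finite \<Rightarrow> cp1"
  assumes "inj x"
  shows "complex_manifold (2 * (CARD('n) - 3)) (X0 :: 'n pq set set) X0_top X0_charts \<and>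
    complex_manifold (2 * (CARD('n) - 3)) (H0 (range x)) (H0_top x) (H0_charts x) \<and>
    (\<exists>\<I>. (\<forall>y \<in> (P0 :: 'n pq set). corresponds x y (\<I> (K_orbit y))) \<and>
         biholomorphism X0_top X0_charts (H0_top x) (H0_charts x) \<I>)"
proof -
  note x = assms
  obtain \<I> where I: "\<And>y. y \<in> mu_complex_stable \<Longrightarrow> \<I> (X0_proj y) = higgs_class x y"
    and bij: "bij_betw \<I> (X0 :: 'n pq set set) (H0 (range x))"
    by (rule ex_correspondence[OF x]) (rule that)
  have X0: "complex_manifold (2 * (CARD('n) - 3)) (X0 :: 'n pq set set) X0_top X0_charts"
    unfolding complex_manifold_def
    using topspace_X0_top Hausdorff_space_X0 second_countable_X0 complex_atlas_X0[OF x] by blast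
  have pull: "V \<subseteq> H0 (range x) \<and> ({z \<in> X0. \<I> z \<in> V}, \<psi> \<circ> \<I>) \<in> X0_charts" if V: "(V, \<psi>) \<in> H0_charts x" for V \<psi>
  proof -
    obtain A j k i0 where ch: "V = H0_chart_dom x A j k i0" "\<psi> = H0_chart_map x A j k i0"
      "j \<in> A" "k \<notin> A" "i0 \<notin> {j, k}"
      using V unfolding H0_charts_def by blast
    then show ?thesis
      using pulled_back_chart[OF x ch(3-5) I] by (auto simp: H0_chart_dom_def)
  qed
  have cover: "\<exists>V \<psi>. (V, \<psi>) \<in> H0_charts x \<and> \<I> z \<in> V" if z: "z \<in> X0" for z
  proof -
    obtain y where y: "y \<in> mu_complex_stable" "z = X0_proj y" using z unfolding X0_eq_image by blast
    obtain A j k i0 where ch: "j \<in> A" "k \<notin> A" "i0 \<notin> {j, k}" "y \<in> chart_dom A j k i0"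
      using ex_chart_dom[OF y(1)] by blast
    have "\<I> z \<in> H0_chart_dom x A j k i0"
      using ch H0_chart_dom_iff[OF x ch(1,2) y(1)] y by (simp add: I)
    moreover have "(H0_chart_dom x A j k i0, H0_chart_map x A j k i0) \<in> H0_charts x"
      unfolding H0_charts_def using ch by blast
    ultimately show ?thesis by blast
  qed
  note H0 = transported_manifold[OF X0 bij pull cover, folded H0_top_def]
  have "corresponds x y (\<I> (K_orbit y))" if y: "y \<in> P0" for y
  proof -
    have st: "y \<in> mu_complex_stable" by (rule P0_imp_stable[OF y])
    have "\<I> (K_orbit y) = higgs_class x y" using I[OF st] X0_proj_eq_K_orbit[OF y] by simp
    then show ?thesis
      using corresponds_iff[OF x mu_complex_stableD(2)[OF st]] st by blast
  qed
  then show ?thesis using X0 H0 by blast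
qed

end
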